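(* There exists a constant $C$ independent of $z$ and $h$ such that for all $0<h<1$ and all $z\in\Omega_h$, $$\|\nabla \widetilde{G}^z\|_{L^\infty(\Omega)}\le C h^{-2}.$$
   Context: Let $\Omega\subset\mathbb{R}^3$ be a convex bounded domain with sufficiently smooth boundary. Let $\{\mathcal{T}_h\}_{0<h<1}$ be a quasi-uniform, shape-regular family of triangulations (by tetrahedra) of size $h$ of polyhedral computational domains $\Omega_h\subset\Omega$, and let $V_h(\Omega_h)$ be the space of continuous functions on $\Omega_h$ that are affine on each tetrahedron of $\mathcal{T}_h$. For $z\in\Omega_h$, let $\tilde\delta^z\ge 0$ be a regularized delta function: a function supported in an element $\tau_0\in\mathcal{T}_h$ containing $z$ with $\int_{\tau_0}\tilde\delta^z v_h\,dx=v_h(z)$ for all $v_h\in V_h(\Omega_h)$ (in particular $\int_{\tau_0}\tilde\delta^z\,dx=1$), and satisfying, with a constant $C$ independent of $z$ and $h$, $\|\tilde\delta^z\|_{W^s_p(\tau_0)}\le C h^{-s-3(1-1/p)}$ for $1\le p\le\infty$, $s=0,1$. The regularized Green's function $\widetilde{G}^z$ is the solution of $-\Delta\widetilde{G}^z=\tilde\delta^z$ in $\Omega$, $\widetilde{G}^z=0$ on $\partial\Omega$. *)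

theory Defs
  imports "HOL-Analysis.Analysis" "HOL-Probability.Essential_Supremum"
begin

section \<open>Smooth functions and domains with smooth boundary\<close>

text \<open>Meaningful for open \<open>S\<close>: all iterated partial derivatives of order at most \<open>k\<close> exist
  and are continuous on \<open>S\<close>.\<close>

fun Ck_on :: "nat \<Rightarrow> 'a::euclidean_space set \<Rightarrow> ('a \<Rightarrow> real) \<Rightarrow> bool" where
  "Ck_on 0 S f \<longleftrightarrow> continuous_on S f"
| "Ck_on (Suc k) S f \<longleftrightarrow>
     (\<forall>x\<in>S. f differentiable (at x)) \<and>
     (\<forall>e\<in>Basis. Ck_on k S (\<lambda>x. frechet_derivative f (at x) e))"

text \<open>Near every boundary point the domain is, after a rotation of coordinates taking the last
  coordinate direction to the unit vector \<open>e\<close>, the region above the graph of a \<open>C\<^sup>k\<close> function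
  \<open>\<gamma>\<close>. Only the values of \<open>\<gamma>\<close> on the hyperplane orthogonal to \<open>e\<close> matter; a \<open>C\<^sup>k\<close> function on
  that hyperplane is the same as the restriction of a \<open>C\<^sup>k\<close> function on the whole space.\<close>

definition Ck_boundary :: "nat \<Rightarrow> 'a::euclidean_space set \<Rightarrow> bool" where
  "Ck_boundary k U \<longleftrightarrow>
     (\<forall>p\<in>frontier U. \<exists>r>0. \<exists>e \<gamma>. norm e = 1 \<and> Ck_on k UNIV \<gamma> \<and>
        U \<inter> ball p r = {x \<in> ball p r. x \<bullet> e > \<gamma> (x - (x \<bullet> e) *\<^sub>R e)})"

definition test_function :: "'a::euclidean_space set \<Rightarrow> ('a \<Rightarrow> real) \<Rightarrow> bool" where
  "test_function U \<phi> \<longleftrightarrow> (\<forall>k. Ck_on k UNIV \<phi>) \<and>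
     compact (closure {x. \<phi> x \<noteq> 0}) \<and> closure {x. \<phi> x \<noteq> 0} \<subseteq> U"


section \<open>Lebesgue and Sobolev norms\<close>

text \<open>Functions are total; on an open set \<open>U\<close> only their values in \<open>U\<close> matter, and only up to
  null sets. Norms are extended-valued: finiteness of the norm expresses membership in the space.\<close>

definition enn_powr :: "ennreal \<Rightarrow> real \<Rightarrow> ennreal" where
  "enn_powr x a = (if x = \<infinity> then \<infinity> else ennreal (enn2real x powr a))"

definition Lp_norm :: "ennreal \<Rightarrow> 'a::euclidean_space set \<Rightarrow> ('a \<Rightarrow> 'b::real_normed_vector) \<Rightarrow> ennreal"
  where
  "Lp_norm p U f =
     (if f \<notin> borel_measurable (lebesgue_on U) then \<infinity>
      else if p = \<infinity> then esssup (lebesgue_on U) (\<lambda>x. ennreal (norm (f x)))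
      else enn_powr (\<integral>\<^sup>+x. ennreal (norm (f x) powr enn2real p) \<partial>lebesgue_on U) (1 / enn2real p))"

definition locally_integrable :: "'a::euclidean_space set \<Rightarrow> ('a \<Rightarrow> 'b::euclidean_space) \<Rightarrow> bool" where
  "locally_integrable U f \<longleftrightarrow> (\<forall>K. compact K \<and> K \<subseteq> U \<longrightarrow> f absolutely_integrable_on K)"

definition has_weak_gradient :: "'a::euclidean_space set \<Rightarrow> ('a \<Rightarrow> real) \<Rightarrow> ('a \<Rightarrow> 'a) \<Rightarrow> bool" where
  "has_weak_gradient U v g \<longleftrightarrow>
     locally_integrable U v \<and> locally_integrable U g \<and>
     (\<forall>\<phi>. test_function U \<phi> \<longrightarrow> (\<forall>e\<in>Basis.
        (LINT x:U|lebesgue. v x * frechet_derivative \<phi> (at x) e) =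
        - (LINT x:U|lebesgue. (g x \<bullet> e) * \<phi> x)))"

definition weakly_differentiable :: "'a::euclidean_space set \<Rightarrow> ('a \<Rightarrow> real) \<Rightarrow> bool" where
  "weakly_differentiable U v \<longleftrightarrow> (\<exists>g. has_weak_gradient U v g)"

text \<open>The weak gradient is determined up to a null set; an arbitrary representative is chosen.\<close>

definition weak_gradient :: "'a::euclidean_space set \<Rightarrow> ('a \<Rightarrow> real) \<Rightarrow> 'a \<Rightarrow> 'a" where
  "weak_gradient U v = (SOME g. has_weak_gradient U v g)"

definition W1p_norm :: "ennreal \<Rightarrow> 'a::euclidean_space set \<Rightarrow> ('a \<Rightarrow> real) \<Rightarrow> ennreal" where
  "W1p_norm p U v =
     (if \<not> weakly_differentiable U v then \<infinity>
      else if p = \<infinity> then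
        max (Lp_norm \<infinity> U v) (Max ((\<lambda>e. Lp_norm \<infinity> U (\<lambda>x. weak_gradient U v x \<bullet> e)) ` Basis))
      else
        enn_powr (enn_powr (Lp_norm p U v) (enn2real p) +
            (\<Sum>e\<in>Basis. enn_powr (Lp_norm p U (\<lambda>x. weak_gradient U v x \<bullet> e)) (enn2real p)))
          (1 / enn2real p))"

text \<open>The closure of the test functions in \<open>H\<^sup>1 = W\<^sup>1\<^sub>2\<close>.\<close>

definition H10 :: "'a::euclidean_space set \<Rightarrow> ('a \<Rightarrow> real) \<Rightarrow> bool" where
  "H10 U v \<longleftrightarrow> W1p_norm 2 U v < \<infinity> \<and>
     (\<exists>\<phi>. (\<forall>n. test_function U (\<phi> n)) \<and>
          (\<lambda>n::nat. W1p_norm 2 U (\<lambda>x. v x - \<phi> n x)) \<longlonglongrightarrow> 0)"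

text \<open>The weak formulation of \<open>-\<Delta>u = f\<close> in \<open>U\<close>, \<open>u = 0\<close> on \<open>\<partial>U\<close>.\<close>

definition poisson_dirichlet_solution ::
    "'a::euclidean_space set \<Rightarrow> ('a \<Rightarrow> real) \<Rightarrow> ('a \<Rightarrow> real) \<Rightarrow> bool" where
  "poisson_dirichlet_solution U f u \<longleftrightarrow> H10 U u \<and>
     (\<forall>w. H10 U w \<longrightarrow>
        (LINT x:U|lebesgue. weak_gradient U u x \<bullet> weak_gradient U w x) =
        (LINT x:U|lebesgue. f x * w x))"


section \<open>Tetrahedral meshes\<close>

text \<open>Elements are closed tetrahedra; the computational domain is the open polyhedral domain whose
  closure is the union of the elements (so that mesh vertices may lie on \<open>\<partial>\<Omega>\<close> although the
  computational domain is contained in \<open>\<Omega>\<close>).\<close>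

definition mesh_domain :: "(real^3) set set \<Rightarrow> (real^3) set" where
  "mesh_domain T = interior (\<Union>T)"

definition tetrahedral_mesh :: "(real^3) set set \<Rightarrow> bool" where
  "tetrahedral_mesh T \<longleftrightarrow> triangulation T \<and> T \<noteq> {} \<and> (\<forall>K\<in>T. 3 simplex K) \<and>
     connected (mesh_domain T)"

definition inball_diameter :: "(real^3) set \<Rightarrow> real" where
  "inball_diameter K = Sup {2 * r |r c. 0 \<le> r \<and> cball c r \<subseteq> K}"

definition shape_regular :: "(real \<Rightarrow> (real^3) set set) \<Rightarrow> bool" where
  "shape_regular \<T> \<longleftrightarrow>
     (\<exists>\<sigma>>0. \<forall>h. 0 < h \<and> h < 1 \<longrightarrow> (\<forall>K\<in>\<T> h. diameter K \<le> \<sigma> * inball_diameter K))"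

text \<open>Every element of the mesh with parameter \<open>h\<close> has diameter comparable to \<open>h\<close>. The upper
  constant is not fixed to be 1 because \<open>h\<close> ranges over all of \<open>(0,1)\<close>, whatever the diameter
  of the domain.\<close>

definition quasi_uniform :: "(real \<Rightarrow> (real^3) set set) \<Rightarrow> bool" where
  "quasi_uniform \<T> \<longleftrightarrow>
     (\<exists>c1>0. \<exists>c2>0. \<forall>h. 0 < h \<and> h < 1 \<longrightarrow>
        (\<forall>K\<in>\<T> h. c1 * h \<le> diameter K \<and> diameter K \<le> c2 * h))"

definition P1_space :: "(real^3) set set \<Rightarrow> (real^3 \<Rightarrow> real) set" where
  "P1_space T = {v. continuous_on (\<Union>T) v \<and> (\<forall>K\<in>T. \<exists>a b. \<forall>x\<in>K. v x = a \<bullet> x + b)}"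


section \<open>Regularized delta functions\<close>

text \<open>\<open>1 / p\<close> is computed in the extended nonnegative reals, so it is \<open>0\<close> for \<open>p = \<infinity>\<close>. The two
  norm bounds are the cases \<open>s = 0\<close> and \<open>s = 1\<close>.\<close>

definition regularized_delta ::
    "real \<Rightarrow> (real^3) set set \<Rightarrow> real \<Rightarrow> real^3 \<Rightarrow> (real^3 \<Rightarrow> real) \<Rightarrow> bool" where
  "regularized_delta C T h z \<delta> \<longleftrightarrow>
     (\<forall>x. 0 \<le> \<delta> x) \<and>
     (\<exists>\<tau>\<in>T. z \<in> \<tau> \<and> (\<forall>x. x \<notin> \<tau> \<longrightarrow> \<delta> x = 0) \<and>
        (\<forall>v\<in>P1_space T. (LINT x:\<tau>|lebesgue. \<delta> x * v x) = v z) \<and>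
        (\<forall>p::ennreal. 1 \<le> p \<longrightarrow>
           Lp_norm p (interior \<tau>) \<delta> \<le> ennreal (C * h powr (- 3 * (1 - enn2real (1 / p)))) \<and>
           W1p_norm p (interior \<tau>) \<delta> \<le> ennreal (C * h powr (- 1 - 3 * (1 - enn2real (1 / p))))))"

end

theory Submission
  imports Defs
begin

text \<open>
  Write \<open>u\<close> for the Green's function and \<open>f\<close> for the regularized delta function. The
  function \<open>f\<close> is a probability density bounded by a multiple of \<open>h^(-3)\<close>. Splitting at distance \<open>h\<close> from
  \<open>p\<close> gives \<open>\<integral> f(x) / |x - p|^2 dx \<le> N\<close> for every point \<open>p\<close>, with \<open>N\<close> a multiple of \<open>h^(-2)\<close>
  (\<open>inverse_square_potential_bound\<close>). The theorem therefore follows from the estimate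
  \<open>|\<nabla>u| \<le> C N\<close> almost everywhere on bounded convex domains (\<open>convex_domain_gradient_bound\<close>),
  in which \<open>C\<close> is an absolute constant.

  On a half-space that estimate is the gradient bound for the Green's function obtained by the method of
  images, and convexity makes a half-space a good comparison domain. Let \<open>p\<close> be a point of the
  domain at distance \<open>d\<close> from the boundary, and let \<open>p'\<close> be its mirror image in the supporting
  hyperplane at a nearest boundary point; every point of the domain is at least as close to \<open>p\<close> as to
  \<open>p'\<close> (\<open>convex_mirror_point\<close>). The argument has two steps.

  Near \<open>p\<close>, \<open>u\<close> is at most of size \<open>N d\<close> in the mean. Smooth the Newtonian kernel at scale \<open>d\<close> and
  let \<open>\<zeta>\<close> be the kernel with pole \<open>p\<close> minus the kernel with pole \<open>p'\<close>. Then \<open>\<zeta>\<close> is nonnegative and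
  superharmonic on the domain, \<open>-\<Delta>\<zeta>\<close> is of size \<open>d^(-3)\<close> on the ball of radius \<open>d / 2\<close> about \<open>p\<close>, and
  \<open>\<zeta>(x) \<le> 2 d / |x - p|^2\<close>. Kato's inequality \<open>-\<integral> |u| \<Delta>\<zeta> \<le> \<integral> |f| \<zeta>\<close> (\<open>kato_inequality\<close>)
  holds for such \<open>\<zeta>\<close> although \<open>\<zeta>\<close> does not vanish on the boundary, because \<open>u\<close> does. It replaces
  the maximum principle and yields a bound of order \<open>N d^4\<close> for the integral of \<open>|u|\<close> over that ball
  (\<open>mirror_L1_bound\<close>).

  Interior regularity then turns a bound for \<open>u\<close> into one for its gradient. Testing the equation with a
  derivative of the smoothed Newtonian kernel, multiplied by a cutoff function living at scale \<open>d\<close>, expresses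
  an average of \<open>\<nabla>u\<close> near \<open>p\<close> as a potential of \<open>f\<close> plus an integral of \<open>u\<close> against a bounded function
  of size \<open>d^(-4)\<close>. Both are at most of order \<open>N\<close>, uniformly in the smoothing parameter
  (\<open>mollified_gradient_bound\<close>); removing the smoothing gives the pointwise bound
  (\<open>mollified_bound_imp_AE_bound\<close>).

  The calculus underneath consists of smooth functions given by explicit formulas, integration by parts
  against test functions, and the fundamental lemma of the calculus of variations
  (\<open>nonpositive_from_test_functions\<close>), which makes the arbitrary choice of a weak gradient harmless and
  gives pointwise meaning to integrated inequalities.
\<close>

section \<open>Calculus of smooth functions\<close>

definition smooth :: "('a::euclidean_space \<Rightarrow> real) \<Rightarrow> bool" where
  "smooth f \<longleftrightarrow> (\<forall>k. Ck_on k UNIV f)"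

definition partial :: "'a::euclidean_space \<Rightarrow> ('a \<Rightarrow> real) \<Rightarrow> 'a \<Rightarrow> real" where
  "partial e f = (\<lambda>x. frechet_derivative f (at x) e)"

definition grad :: "('a::euclidean_space \<Rightarrow> real) \<Rightarrow> 'a \<Rightarrow> 'a" where
  "grad f x = (\<Sum>e\<in>Basis. partial e f x *\<^sub>R e)"

definition laplacian :: "('a::euclidean_space \<Rightarrow> real) \<Rightarrow> 'a \<Rightarrow> real" where
  "laplacian f x = (\<Sum>e\<in>Basis. partial e (partial e f) x)"

lemma Ck_on_continuous: "Ck_on k UNIV f \<Longrightarrow> continuous_on UNIV f"
proof (cases k)
  case (Suc j)
  assume "Ck_on k UNIV f"
  then show ?thesis
    using Suc by (auto intro!: continuous_at_imp_continuous_on differentiable_imp_continuous_within)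
qed auto

lemma Ck_on_Suc_D: "Ck_on (Suc k) UNIV f \<Longrightarrow> Ck_on k UNIV f"
proof (induction k arbitrary: f)
  case 0
  then show ?case
    using Ck_on_continuous by fastforce
next
  case (Suc k)
  then show ?case
    by (metis Ck_on.simps(2))
qed

text \<open>Smoothness passes to partial derivatives and back, so that it can be established without
  counting the order of differentiation.\<close>

lemma smooth_iff:
  "smooth f \<longleftrightarrow> (\<forall>x. f differentiable at x) \<and> (\<forall>e\<in>Basis. smooth (partial e f))"
proof
  assume "smooth f"
  then have "Ck_on (Suc k) UNIV f" for k
    unfolding smooth_def by blast
  then show "(\<forall>x. f differentiable at x) \<and> (\<forall>e\<in>Basis. smooth (partial e f))"
    unfolding smooth_def partial_def by auto
next
  assume *: "(\<forall>x. f differentiable at x) \<and> (\<forall>e\<in>Basis. smooth (partial e f))"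
  have "Ck_on (Suc k) UNIV f" for k
    using * unfolding smooth_def partial_def by auto
  then show "smooth f"
    unfolding smooth_def using Ck_on_Suc_D by blast
qed

lemma smooth_partial: "smooth f \<Longrightarrow> e \<in> Basis \<Longrightarrow> smooth (partial e f)"
  by (simp add: smooth_iff[of f])

lemma smooth_differentiable: "smooth f \<Longrightarrow> f differentiable at x"
  by (simp add: smooth_iff[of f])

lemma smooth_continuous: "smooth f \<Longrightarrow> continuous_on S f"
  unfolding smooth_def using Ck_on_continuous continuous_on_subset by blast

lemma smooth_has_derivative:
  assumes "smooth f"
  shows "(f has_derivative (\<lambda>v. v \<bullet> grad f x)) (at x)"
proof -
  have d: "(f has_derivative frechet_derivative f (at x)) (at x)"
    using smooth_differentiable[OF assms] frechet_derivative_works by blast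
  then have lin: "linear (frechet_derivative f (at x))"
    using linear_frechet_derivative smooth_differentiable[OF assms] by blast
  have "frechet_derivative f (at x) v = v \<bullet> grad f x" for v
  proof -
    have "frechet_derivative f (at x) v = frechet_derivative f (at x) (\<Sum>e\<in>Basis. (v \<bullet> e) *\<^sub>R e)"
      by (simp add: euclidean_representation)
    also have "\<dots> = (\<Sum>e\<in>Basis. (v \<bullet> e) * partial e f x)"
      by (simp add: linear_sum[OF lin] linear_scale[OF lin] partial_def)
    also have "\<dots> = v \<bullet> grad f x"
      by (simp add: grad_def inner_sum_right mult.commute)
    finally show ?thesis .
  qed
  then have "frechet_derivative f (at x) = (\<lambda>v. v \<bullet> grad f x)"
    by blast
  with d show ?thesis by simp
qed

lemma partial_eqI: "(f has_derivative D) (at x) \<Longrightarrow> partial e f x = D e"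
  unfolding partial_def using frechet_derivative_at by metis

lemma inner_grad: "e \<in> Basis \<Longrightarrow> grad f x \<bullet> e = partial e f x"
  by (simp add: grad_def)

lemma partial_eq_inner_grad: "e \<in> Basis \<Longrightarrow> partial e f x = e \<bullet> grad f x"
  using inner_grad[of e f x] by (simp add: inner_commute)

lemma grad_eqI:
  assumes "\<And>e. e \<in> Basis \<Longrightarrow> partial e f x = v \<bullet> e"
  shows "grad f x = v"
  by (rule euclidean_eqI) (simp add: inner_grad assms)

lemma partial_const [simp]: "partial e (\<lambda>x. c) = (\<lambda>x. 0)"
  by (simp add: partial_def)

lemma Ck_on_const: "Ck_on k UNIV (\<lambda>x. c)"
  by (induction k arbitrary: c) auto

lemma smooth_const [simp]: "smooth (\<lambda>x. c)"
  unfolding smooth_def using Ck_on_const by blast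

lemma partial_inner [simp]: "partial e (\<lambda>x. x \<bullet> b) = (\<lambda>x. e \<bullet> b)"
proof
  fix x
  have "((\<lambda>x. x \<bullet> b) has_derivative (\<lambda>v. v \<bullet> b)) (at x)"
    by (auto intro!: derivative_eq_intros)
  then show "partial e (\<lambda>x. x \<bullet> b) x = e \<bullet> b"
    by (rule partial_eqI)
qed

lemma smooth_inner [simp]: "smooth (\<lambda>x. x \<bullet> b)"
  by (subst smooth_iff) (auto intro: derivative_intros bounded_linear_imp_differentiable
      bounded_linear_inner_left)

lemma partial_add:
  assumes "f differentiable at x" "g differentiable at x"
  shows "partial e (\<lambda>x. f x + g x) x = partial e f x + partial e g x"
  using assms unfolding frechet_derivative_works
  by (subst partial_eqI[OF has_derivative_add]) (auto simp: partial_def)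

lemma partial_mult:
  assumes "f differentiable at x" "g differentiable at x"
  shows "partial e (\<lambda>x. f x * g x) x = f x * partial e g x + partial e f x * g x"
  using assms unfolding frechet_derivative_works
  by (subst partial_eqI[OF has_derivative_mult]) (auto simp: partial_def)

lemma partial_chain:
  assumes "(h has_real_derivative d) (at (f x))" "f differentiable at x"
  shows "partial e (\<lambda>x. h (f x)) x = d * partial e f x"
proof -
  have "((\<lambda>x. h (f x)) has_derivative (\<lambda>v. d * frechet_derivative f (at x) v)) (at x)"
    using has_derivative_compose[of f "frechet_derivative f (at x)" x UNIV h "(*) d"] assms
    by (auto simp: frechet_derivative_works has_field_derivative_def)
  from partial_eqI[OF this] show ?thesis by (simp add: partial_def)
qed

lemma Ck_on_add:
  "Ck_on k UNIV f \<Longrightarrow> Ck_on k UNIV g \<Longrightarrow> Ck_on k UNIV (\<lambda>x. f x + g x)"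
proof (induction k arbitrary: f g)
  case 0
  then show ?case by (auto intro: continuous_intros)
next
  case (Suc k)
  then have "Ck_on k UNIV (partial e (\<lambda>x. f x + g x))" if "e \<in> Basis" for e
  proof -
    have "partial e (\<lambda>x. f x + g x) = (\<lambda>x. partial e f x + partial e g x)"
      using Suc.prems by (auto simp: partial_add)
    then show ?thesis
      using Suc that by (auto simp: partial_def)
  qed
  then show ?case using Suc.prems by (auto simp: partial_def)
qed

lemma Ck_on_mult:
  "Ck_on k UNIV f \<Longrightarrow> Ck_on k UNIV g \<Longrightarrow> Ck_on k UNIV (\<lambda>x. f x * g x)"
proof (induction k arbitrary: f g)
  case 0
  then show ?case by (auto intro: continuous_intros)
next
  case (Suc k)
  then have "Ck_on k UNIV (partial e (\<lambda>x. f x * g x))" if "e \<in> Basis" for e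
  proof -
    have "partial e (\<lambda>x. f x * g x) = (\<lambda>x. f x * partial e g x + partial e f x * g x)"
      using Suc.prems by (auto simp: partial_mult)
    moreover have "Ck_on k UNIV f" "Ck_on k UNIV g"
      using Suc.prems Ck_on_Suc_D by auto
    moreover have "Ck_on k UNIV (partial e f)" "Ck_on k UNIV (partial e g)"
      using Suc.prems that by (auto simp: partial_def)
    ultimately show ?thesis
      using Suc.IH by (auto intro: Ck_on_add)
  qed
  then show ?case using Suc.prems by (auto simp: partial_def)
qed

lemma smooth_add: "smooth f \<Longrightarrow> smooth g \<Longrightarrow> smooth (\<lambda>x. f x + g x)"
  unfolding smooth_def by (auto intro: Ck_on_add)

lemma smooth_mult: "smooth f \<Longrightarrow> smooth g \<Longrightarrow> smooth (\<lambda>x. f x * g x)"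
  unfolding smooth_def by (auto intro: Ck_on_mult)

lemma smooth_cmult: "smooth f \<Longrightarrow> smooth (\<lambda>x. c * f x)"
  by (auto intro: smooth_mult)

lemma smooth_minus: "smooth f \<Longrightarrow> smooth (\<lambda>x. - f x)"
  using smooth_cmult[of f "-1"] by simp

lemma smooth_diff: "smooth f \<Longrightarrow> smooth g \<Longrightarrow> smooth (\<lambda>x. f x - g x)"
  using smooth_add[of f "\<lambda>x. - g x"] smooth_minus[of g] by simp

lemma smooth_sum: "(\<And>i. i \<in> I \<Longrightarrow> smooth (f i)) \<Longrightarrow> smooth (\<lambda>x. \<Sum>i\<in>I. f i x)"
  by (induction I rule: infinite_finite_induct) (auto intro: smooth_add)

lemma smooth_prod: "(\<And>i. i \<in> I \<Longrightarrow> smooth (f i)) \<Longrightarrow> smooth (\<lambda>x. \<Prod>i\<in>I. f i x)"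
  by (induction I rule: infinite_finite_induct) (auto intro: smooth_mult)

lemmas smooth_intros = smooth_const smooth_inner smooth_add smooth_mult smooth_minus smooth_diff
  smooth_sum smooth_prod smooth_cmult

text \<open>The outer function enters through a family closed under differentiation rather than through the sequence
  of its derivatives: for the powers and for \<open>exp (- 1 / t)\<close> such a family is obvious, while formulas for
  the higher derivatives are not. The set \<open>I\<close> restricts the argument of a power to positive values.\<close>

lemma smooth_compose:
  assumes "h \<in> F" "open I"
    and closed: "\<And>h. h \<in> F \<Longrightarrow> \<exists>h'\<in>F. \<forall>t\<in>I. (h has_real_derivative h' t) (at t)"
    and "smooth f" and range: "\<And>x. f x \<in> I"
  shows "smooth (\<lambda>x. h (f x))"
proof -
  have "Ck_on k UNIV (\<lambda>x. h (f x))" if "h \<in> F" for k h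
    using that
  proof (induction k arbitrary: h)
    case 0
    then obtain h' where "\<forall>t\<in>I. (h has_real_derivative h' t) (at t)" using closed by blast
    then have "continuous_on I h"
      by (meson DERIV_isCont continuous_at_imp_continuous_on)
    moreover have "continuous_on UNIV f" using assms(4) by (rule smooth_continuous)
    ultimately show ?case
      using range by (auto intro: continuous_on_compose2)
  next
    case (Suc k)
    then obtain h' where h': "h' \<in> F" "\<forall>t\<in>I. (h has_real_derivative h' t) (at t)"
      using closed by blast
    have diff: "f differentiable at x" for x
      using assms(4) by (rule smooth_differentiable)
    have "(\<lambda>x. h (f x)) differentiable at x" for x
      using h' range diff differentiable_compose[of h f x UNIV]
      by (meson DERIV_imp_deriv differentiable_def has_field_derivative_imp_has_derivative
          has_derivative_compose)
    moreover have "Ck_on k UNIV (partial e (\<lambda>x. h (f x)))" if "e \<in> Basis" for e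
    proof -
      have "partial e (\<lambda>x. h (f x)) = (\<lambda>x. h' (f x) * partial e f x)"
        using h' range diff by (auto intro!: partial_chain)
      moreover have "Ck_on k UNIV (partial e f)"
        using smooth_partial[OF assms(4) that] by (simp add: smooth_def)
      ultimately show ?thesis
        using Suc.IH[OF h'(1)] by (auto intro: Ck_on_mult)
    qed
    ultimately show ?case by (auto simp: partial_def)
  qed
  then show ?thesis using assms(1) by (auto simp: smooth_def)
qed

lemma smooth_powr:
  assumes "smooth f" "\<And>x. f x > 0"
  shows "smooth (\<lambda>x. f x powr a)"
proof (rule smooth_compose[where h = "\<lambda>t. t powr a" and f = f and F = "{h. \<exists>c a. h = (\<lambda>t. c * t powr a)}" and I = "{0<..}"])
  show "(\<lambda>t. t powr a) \<in> {h. \<exists>c a. h = (\<lambda>t. c * t powr a)}"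
    by (intro CollectI exI[of _ 1] exI[of _ a]) simp
next
  fix h :: "real \<Rightarrow> real"
  assume "h \<in> {h. \<exists>c a. h = (\<lambda>t. c * t powr a)}"
  then obtain c a where h: "h = (\<lambda>t. c * t powr a)" by blast
  show "\<exists>h'\<in>{h. \<exists>c a. h = (\<lambda>t. c * t powr a)}. \<forall>t\<in>{0<..}. (h has_real_derivative h' t) (at t)"
  proof (rule bexI)
    show "\<forall>t\<in>{0<..}. (h has_real_derivative (c * a) * t powr (a - 1)) (at t)"
      unfolding h by (auto intro!: derivative_eq_intros)
  qed blast
qed (use assms in auto)

text \<open>The standard smooth function that vanishes to infinite order at the origin. All bump and cutoff
  functions are built from it.\<close>

definition flat_step :: "real \<Rightarrow> real" where
  "flat_step t = (if t > 0 then exp (- (1 / t)) else 0)"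

text \<open>In the variable \<open>s = 1 / t\<close> one has \<open>d/dt = - s^2 d/ds\<close>, hence \<open>p(s) exp(-s)\<close> has the derivative
  \<open>s^2 (p - p')(s) exp(-s)\<close>: polynomials times \<open>exp (- 1 / t)\<close> form a family closed under
  differentiation. At the origin the exponential beats every polynomial.\<close>

lemma poly_exp_inverse_has_derivative:
  fixes p :: "real poly"
  defines "h \<equiv> \<lambda>p t. if t > 0 then poly p (1 / t) * exp (- (1 / t)) else (0::real)"
  shows "(h p has_real_derivative h ([:0, 0, 1:] * (p - pderiv p)) t) (at t)"
proof -
  consider "t > 0" | "t < 0" | "t = 0" by linarith
  then show ?thesis
  proof cases
    case 1
    have "((\<lambda>t. poly p (1 / t) * exp (- (1 / t))) has_real_derivative
        poly ([:0, 0, 1:] * (p - pderiv p)) (1 / t) * exp (- (1 / t))) (at t)"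
      using 1 by (auto intro!: derivative_eq_intros DERIV_chain'[OF _ poly_DERIV]
          simp: field_simps power2_eq_square)
    then have "(h p has_real_derivative
        poly ([:0, 0, 1:] * (p - pderiv p)) (1 / t) * exp (- (1 / t))) (at t)"
      by (rule DERIV_cong_ev[THEN iffD1, rotated -1])
         (use 1 in \<open>auto simp: h_def eventually_nhds intro!: exI[of _ "{0<..}"]\<close>)
    then show ?thesis using 1 by (simp add: h_def)
  next
    case 2
    have "((\<lambda>t. 0) has_real_derivative 0) (at t)" by simp
    then have "(h p has_real_derivative 0) (at t)"
      by (rule DERIV_cong_ev[THEN iffD1, rotated -1])
         (use 2 in \<open>auto simp: h_def eventually_nhds intro!: exI[of _ "{..<0}"]\<close>)
    then show ?thesis using 2 by (simp add: h_def)
  next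
    case 3
    \<comment> \<open>The difference quotient at the origin is again of this form, with the polynomial multiplied by the variable.\<close>
    have lim: "((\<lambda>s. poly q s * exp (- s)) \<longlongrightarrow> 0) at_top" for q :: "real poly"
    proof -
      have "((\<lambda>s. \<Sum>i\<le>degree q. coeff q i * (s ^ i / exp s)) \<longlongrightarrow> (\<Sum>i\<le>degree q. coeff q i * 0)) at_top"
        by (intro tendsto_intros tendsto_power_div_exp_0)
      then show ?thesis
        by (simp add: poly_altdef exp_minus field_simps sum_distrib_left sum_divide_distrib)
    qed
    have "((\<lambda>s. poly (pCons 0 p) s * exp (- s)) \<longlongrightarrow> 0) at_top" by (rule lim)
    then have "((\<lambda>t. poly (pCons 0 p) (inverse t) * exp (- (inverse t))) \<longlongrightarrow> 0) (at_right 0)"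
      by (rule filterlim_compose[OF _ filterlim_inverse_at_top_right])
    then have "((\<lambda>t. (h p t - h p 0) / (t - 0)) \<longlongrightarrow> 0) (at_right 0)"
      by (rule Lim_transform_eventually)
         (auto simp: h_def eventually_at_filter field_simps)
    moreover have "((\<lambda>t. (h p t - h p 0) / (t - 0)) \<longlongrightarrow> 0) (at_left 0)"
      by (rule Lim_transform_eventually[of "\<lambda>t. 0"])
         (auto simp: h_def eventually_at_filter)
    ultimately have "((\<lambda>t. (h p t - h p 0) / (t - 0)) \<longlongrightarrow> 0) (at 0)"
      by (rule filterlim_split_at_real[of _ _ 0, rotated])
    then show ?thesis using 3 by (simp add: h_def has_field_derivative_iff)
  qed
qed

lemma smooth_flat_step:
  assumes "smooth f"
  shows "smooth (\<lambda>x. flat_step (f x))"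
proof -
  define h where "h = (\<lambda>p t. if t > 0 then poly p (1 / t) * exp (- (1 / t)) else (0::real))"
  have "smooth (\<lambda>x. h 1 (f x))"
  proof (rule smooth_compose[where h = "h 1" and f = f and F = "range h" and I = UNIV])
    fix g assume "g \<in> range h"
    then obtain p where g: "g = h p" by blast
    have "(h p has_real_derivative h ([:0, 0, 1:] * (p - pderiv p)) t) (at t)" for t
      unfolding h_def by (rule poly_exp_inverse_has_derivative)
    then show "\<exists>h'\<in>range h. \<forall>t\<in>UNIV. (g has_real_derivative h' t) (at t)"
      unfolding g by blast
  qed (use assms in auto)
  moreover have "h 1 = flat_step" by (auto simp: h_def flat_step_def)
  ultimately show ?thesis by simp
qed

lemma flat_step_nonneg: "0 \<le> flat_step t" and flat_step_le_1: "flat_step t \<le> 1"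
  and flat_step_pos: "t > 0 \<Longrightarrow> flat_step t > 0" and flat_step_0: "t \<le> 0 \<Longrightarrow> flat_step t = 0"
  by (auto simp: flat_step_def)

lemma flat_step_mono: "s \<le> t \<Longrightarrow> flat_step s \<le> flat_step t"
  by (auto simp: flat_step_def frac_le)

lemma flat_step_tendsto_1:
  assumes "t > 0"
  shows "(\<lambda>n. flat_step (real n * t)) \<longlonglongrightarrow> 1"
proof -
  have "(\<lambda>n. exp (- (inverse (real n) * (1 / t)))) \<longlonglongrightarrow> exp (- (0 * (1 / t)))"
    by (intro tendsto_intros lim_inverse_n)
  then have "(\<lambda>n. exp (- (inverse (real n) * (1 / t)))) \<longlonglongrightarrow> 1" by simp
  then show ?thesis
    by (rule Lim_transform_eventually)
       (use assms in \<open>auto simp: flat_step_def divide_simps intro!: eventually_sequentiallyI[of 1]\<close>)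
qed

text \<open>The Leibniz rule that separates, in the interior estimate, the singular kernel from the cutoff function.\<close>

lemma laplacian_mult:
  assumes "smooth f" "smooth g"
  shows "laplacian (\<lambda>x. f x * g x) x
    = f x * laplacian g x + 2 * (grad f x \<bullet> grad g x) + laplacian f x * g x"
proof -
  have d: "f differentiable at x" "g differentiable at x" for x
    using assms by (auto intro: smooth_differentiable)
  have d2: "partial e f differentiable at x" "partial e g differentiable at x" if "e \<in> Basis" for e x
    using assms that by (auto intro: smooth_differentiable smooth_partial)
  have "partial e (partial e (\<lambda>x. f x * g x)) x
      = f x * partial e (partial e g) x + 2 * (partial e f x * partial e g x) + partial e (partial e f) x * g x"
    if "e \<in> Basis" for e
  proof -
    have "partial e (\<lambda>x. f x * g x) = (\<lambda>x. f x * partial e g x + partial e f x * g x)"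
      by (auto simp: partial_mult d)
    then show ?thesis
      using d d2[OF that] by (simp add: partial_add partial_mult differentiable_mult)
  qed
  moreover have "grad f x \<bullet> grad g x = (\<Sum>e\<in>Basis. partial e f x * partial e g x)"
    by (subst euclidean_inner) (simp add: inner_grad)
  ultimately show ?thesis
    by (simp add: laplacian_def sum.distrib sum_distrib_left sum_distrib_right)
qed

lemma grad_mult:
  assumes "smooth f" "smooth g"
  shows "grad (\<lambda>x. f x * g x) x = f x *\<^sub>R grad g x + g x *\<^sub>R grad f x"
  using assms
  by (intro grad_eqI) (simp add: partial_mult smooth_differentiable inner_grad inner_add_left)

lemma grad_chain:
  assumes "(h has_real_derivative d) (at (f x))" "smooth f"
  shows "grad (\<lambda>x. h (f x)) x = d *\<^sub>R grad f x"
  using assms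
  by (intro grad_eqI) (simp add: partial_chain smooth_differentiable inner_grad)

lemma smooth_norm_sq: "smooth (\<lambda>x. (norm (x - p))\<^sup>2)"
proof -
  have "(\<lambda>x. (norm (x - p))\<^sup>2) = (\<lambda>x. \<Sum>e\<in>Basis. (x \<bullet> e - p \<bullet> e) * (x \<bullet> e - p \<bullet> e))"
    by (rule ext) (subst power2_norm_eq_inner, subst euclidean_inner, simp add: inner_diff_left)
  then show ?thesis by (auto intro!: smooth_intros)
qed

lemma partial_norm_sq: "partial e (\<lambda>x. (norm (x - p))\<^sup>2) x = 2 * ((x - p) \<bullet> e)"
proof -
  have "((\<lambda>x. (x - p) \<bullet> (x - p)) has_derivative (\<lambda>v. 2 * ((x - p) \<bullet> v))) (at x)"
    by (auto intro!: derivative_eq_intros simp: inner_commute)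
  from partial_eqI[OF this] show ?thesis by (simp add: power2_norm_eq_inner)
qed

section \<open>Test functions\<close>

text \<open>A compact set containing the support is easier to provide than the support itself.\<close>

lemma test_function_iff:
  "test_function U \<phi> \<longleftrightarrow> smooth \<phi> \<and> (\<exists>K. compact K \<and> K \<subseteq> U \<and> (\<forall>x. x \<notin> K \<longrightarrow> \<phi> x = 0))"
proof
  assume "test_function U \<phi>"
  then show "smooth \<phi> \<and> (\<exists>K. compact K \<and> K \<subseteq> U \<and> (\<forall>x. x \<notin> K \<longrightarrow> \<phi> x = 0))"
    unfolding test_function_def smooth_def
    by (intro conjI exI[of _ "closure {x. \<phi> x \<noteq> 0}"])
       (use closure_subset[of "{x. \<phi> x \<noteq> 0}"] in auto)
next
  assume "smooth \<phi> \<and> (\<exists>K. compact K \<and> K \<subseteq> U \<and> (\<forall>x. x \<notin> K \<longrightarrow> \<phi> x = 0))"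
  then obtain K where K: "smooth \<phi>" "compact K" "K \<subseteq> U" "\<And>x. x \<notin> K \<Longrightarrow> \<phi> x = 0" by blast
  then have "closure {x. \<phi> x \<noteq> 0} \<subseteq> K"
    by (intro closure_minimal compact_imp_closed) auto
  then have "compact (closure {x. \<phi> x \<noteq> 0})"
    using K(2) bounded_subset by (auto simp: compact_eq_bounded_closed)
  with K \<open>closure {x. \<phi> x \<noteq> 0} \<subseteq> K\<close> show "test_function U \<phi>"
    unfolding test_function_def smooth_def by auto
qed

lemma test_functionI:
  "smooth \<phi> \<Longrightarrow> compact K \<Longrightarrow> K \<subseteq> U \<Longrightarrow> (\<And>x. x \<notin> K \<Longrightarrow> \<phi> x = 0) \<Longrightarrow> test_function U \<phi>"
  unfolding test_function_iff by blast

lemma test_functionE: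
  assumes "test_function U \<phi>"
  obtains K where "smooth \<phi>" "compact K" "K \<subseteq> U" "\<And>x. x \<notin> K \<Longrightarrow> \<phi> x = 0"
  using assms unfolding test_function_iff by blast

lemma test_function_smooth: "test_function U \<phi> \<Longrightarrow> smooth \<phi>"
  by (auto simp: test_function_iff)

lemma test_function_outside: "test_function U \<phi> \<Longrightarrow> x \<notin> U \<Longrightarrow> \<phi> x = 0"
  by (auto simp: test_function_iff)

lemma test_function_mono: "test_function U \<phi> \<Longrightarrow> U \<subseteq> V \<Longrightarrow> test_function V \<phi>"
  by (auto simp: test_function_iff)

lemma test_function_mult:
  assumes "smooth \<zeta>" "test_function U \<phi>"
  shows "test_function U (\<lambda>x. \<zeta> x * \<phi> x)"
  using assms unfolding test_function_iff by (auto intro!: smooth_mult)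

lemma partial_outside:
  assumes "compact K" "\<And>x. x \<notin> K \<Longrightarrow> \<phi> x = 0" "x \<notin> K"
  shows "partial e \<phi> x = 0"
proof -
  have "open (- K)" using assms by (simp add: compact_imp_closed open_Compl)
  have "((\<lambda>x. 0) has_derivative (\<lambda>x. 0)) (at x)" by simp
  then have "(\<phi> has_derivative (\<lambda>x. 0)) (at x)"
    by (rule has_derivative_transform_within_open[OF _ \<open>open (- K)\<close>]) (use assms in auto)
  from partial_eqI[OF this] show ?thesis by simp
qed

lemma test_function_partial:
  assumes "test_function U \<phi>" "e \<in> Basis"
  shows "test_function U (partial e \<phi>)"
proof -
  obtain K where K: "smooth \<phi>" "compact K" "K \<subseteq> U" "\<And>x. x \<notin> K \<Longrightarrow> \<phi> x = 0"
    using test_functionE[OF assms(1)] by blast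
  then show ?thesis
    by (intro test_functionI[of _ K] smooth_partial assms(2)) (auto intro: partial_outside)
qed

lemma compact_support_bounded:
  fixes f :: "'a::euclidean_space \<Rightarrow> 'b::euclidean_space"
  assumes "continuous_on K f" "compact K" "\<And>x. x \<notin> K \<Longrightarrow> f x = 0"
  obtains B where "B > 0" "\<And>x. norm (f x) \<le> B"
proof -
  have "bounded (f ` K)"
    using assms by (simp add: compact_continuous_image compact_imp_bounded)
  then obtain B where B: "B > 0" "\<forall>y\<in>f ` K. norm y \<le> B"
    by (auto simp: bounded_pos)
  show ?thesis
    by (rule that[of B]) (use B assms(3) in \<open>force+\<close>)
qed

lemma compact_support_integrable:
  fixes f :: "'a::euclidean_space \<Rightarrow> 'b::euclidean_space"
  assumes "continuous_on K f" "compact K" "\<And>x. x \<notin> K \<Longrightarrow> f x = 0"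
  shows "integrable lborel f" "integrable lebesgue f"
proof -
  have "(\<lambda>x. indicator K x *\<^sub>R f x) = f"
    using assms(3) by (auto simp: indicator_def)
  then show i: "integrable lborel f"
    using borel_integrable_compact[OF assms(2,1)] by simp
  then show "integrable lebesgue f"
    using integrable_completion[of f lborel] by auto
qed

lemma integrable_mult_bounded:
  fixes f g :: "'a \<Rightarrow> real"
  assumes f: "integrable M f" and g: "g \<in> borel_measurable M" "\<And>x. x \<in> space M \<Longrightarrow> \<bar>g x\<bar> \<le> B"
  shows "integrable M (\<lambda>x. f x * g x)"
proof (rule Bochner_Integration.integrable_bound[OF integrable_mult_right[OF f, of B]])
  show "(\<lambda>x. f x * g x) \<in> borel_measurable M" using f g(1) by measurable
  have "\<bar>f x\<bar> * \<bar>g x\<bar> \<le> \<bar>f x\<bar> * \<bar>B\<bar>" if "x \<in> space M" for x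
    using g(2)[OF that] by (intro mult_left_mono) auto
  then show "AE x in M. norm (f x * g x) \<le> norm (B * f x)"
    by (intro AE_I2) (simp add: abs_mult mult.commute)
qed

lemma grad_continuous: "smooth f \<Longrightarrow> continuous_on S (grad f)"
  unfolding grad_def[abs_def]
  by (intro continuous_intros smooth_continuous) (auto intro: smooth_partial)

lemma test_function_grad_bounded:
  assumes "test_function U \<phi>"
  obtains B where "B > 0" "\<And>x. norm (grad \<phi> x) \<le> B"
proof -
  obtain K where K: "smooth \<phi>" "compact K" "K \<subseteq> U" "\<And>x. x \<notin> K \<Longrightarrow> \<phi> x = 0"
    using test_functionE[OF assms] by blast
  have "grad \<phi> x = 0" if "x \<notin> K" for x
    using partial_outside[OF K(2,4) that] by (simp add: grad_def)
  with K grad_continuous[OF K(1)] show ?thesis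
    using compact_support_bounded[of K "grad \<phi>"] that by blast
qed

lemma smooth_diff_quotient_bound:
  assumes "smooth F" "\<And>x. norm (grad F x) \<le> B"
  shows "\<bar>F y - F x\<bar> \<le> B * norm (y - x)"
proof -
  have "norm (F y - F x) \<le> B * norm (y - x)"
  proof (rule differentiable_bound[of UNIV])
    fix x :: 'a
    show "(F has_derivative (\<lambda>v. v \<bullet> grad F x)) (at x within UNIV)"
      using smooth_has_derivative[OF assms(1)] by simp
    show "onorm (\<lambda>v. v \<bullet> grad F x) \<le> B"
    proof (rule onorm_le)
      fix v
      have "norm (v \<bullet> grad F x) \<le> norm (grad F x) * norm v"
        by (metis Cauchy_Schwarz_ineq2 mult.commute real_norm_def)
      also have "\<dots> \<le> B * norm v" using assms(2) by (intro mult_right_mono) auto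
      finally show "norm (v \<bullet> grad F x) \<le> B * norm v" .
    qed
  qed auto
  then show ?thesis by simp
qed

text \<open>The integral of a difference quotient vanishes by translation invariance of Lebesgue measure. The
  difference quotients of a test function converge boundedly on a fixed ball, so dominated convergence
  applies.\<close>

lemma integral_partial_eq_0:
  fixes F :: "'a::euclidean_space \<Rightarrow> real"
  assumes "test_function UNIV F" "e \<in> Basis"
  shows "(LINT x|lebesgue. partial e F x) = 0"
proof -
  obtain K where K: "smooth F" "compact K" "\<And>x. x \<notin> K \<Longrightarrow> F x = 0"
    using assms(1) unfolding test_function_iff by blast
  obtain R where "\<forall>x\<in>K. norm x \<le> R"
    using compact_imp_bounded[OF K(2)] by (auto simp: bounded_iff)
  then have R: "K \<subseteq> cball 0 R" by auto
  obtain B where B: "B > 0" "\<And>x. norm (grad F x) \<le> B"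
    using test_function_grad_bounded[OF assms(1)] by blast
  define s where "s = (\<lambda>n. inverse (real (Suc n)))"
  have s: "s n > 0" "s n \<le> 1" for n by (auto simp: s_def field_simps)
  have s0: "s \<longlonglongrightarrow> 0" unfolding s_def by (rule LIMSEQ_inverse_real_of_nat)
  define D where "D = (\<lambda>n x. (F (x + s n *\<^sub>R e) - F x) / s n)"
  have F_int: "integrable lborel F"
    using compact_support_integrable(1)[OF smooth_continuous[OF K(1)] K(2,3)] by blast
  have F_meas: "F \<in> borel_measurable borel"
    using smooth_continuous[OF K(1)] borel_measurable_continuous_onI by blast
  have shift: "integrable lborel (\<lambda>x. F (x + c)) \<and> (LINT x|lborel. F (x + c)) = (LINT x|lborel. F x)" for c
  proof -
    have "integrable (distr lborel borel ((+) c)) F" using F_int by (simp add: lborel_distr_plus)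
    moreover have "(LINT x|distr lborel borel ((+) c). F x) = (LINT x|lborel. F (c + x))"
      by (rule integral_distr) (use F_meas in auto)
    ultimately show ?thesis
      using integrable_distr_eq[of "(+) c" lborel borel F] F_meas
      by (simp add: lborel_distr_plus add.commute)
  qed
  have D0: "(LINT x|lborel. D n x) = 0" for n
    unfolding D_def using shift[of "s n *\<^sub>R e"] F_int by (simp add: integral_diff)
  have lim: "(\<lambda>n. D n x) \<longlonglongrightarrow> partial e F x" for x
  proof -
    have "((\<lambda>t. F (x + t *\<^sub>R e)) has_derivative (\<lambda>t. (t *\<^sub>R e) \<bullet> grad F x)) (at 0)"
      by (rule has_derivative_compose[where s = UNIV and f = "\<lambda>t. x + t *\<^sub>R e" and g = F and g' = "\<lambda>v. v \<bullet> grad F x"])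
         (auto intro!: derivative_eq_intros smooth_has_derivative K)
    then have "((\<lambda>t. F (x + t *\<^sub>R e)) has_real_derivative partial e F x) (at 0)"
      by (simp add: has_field_derivative_def partial_eq_inner_grad[OF assms(2)] mult.commute[of _ "e \<bullet> grad F x"])
    then have "((\<lambda>t. (F (x + t *\<^sub>R e) - F (x + 0 *\<^sub>R e)) / (t - 0)) \<longlongrightarrow> partial e F x) (at 0)"
      by (simp only: has_field_derivative_iff)
    then have "((\<lambda>t. (F (x + t *\<^sub>R e) - F x) / t) \<longlongrightarrow> partial e F x) (at 0)"
      by simp
    moreover have "filterlim s (at 0) sequentially"
      using s0 s(1) by (auto simp: filterlim_at intro!: always_eventually) (metis less_irrefl)
    ultimately show ?thesis unfolding D_def by (rule filterlim_compose)
  qed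
  \<comment> \<open>The shifts have length at most one, so every quotient is supported in the ball of radius \<open>R + 1\<close>.\<close>
  have "(\<lambda>n. LINT x|lborel. D n x) \<longlonglongrightarrow> (LINT x|lborel. partial e F x)"
  proof (rule integral_dominated_convergence[where w = "\<lambda>x. indicator (cball 0 (R + 1)) x *\<^sub>R B"])
    show "partial e F \<in> borel_measurable lborel"
      using smooth_continuous[OF smooth_partial[OF K(1) assms(2)]] borel_measurable_continuous_onI by auto
    show "D n \<in> borel_measurable lborel" for n
      unfolding D_def using F_meas by (auto intro!: borel_measurable_continuous_onI continuous_intros
          continuous_on_compose2[OF smooth_continuous[OF K(1), of UNIV]] smooth_continuous[OF K(1)])
    show "integrable lborel (\<lambda>x::'a. indicator (cball 0 (R + 1)) x *\<^sub>R B)"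
      by (rule borel_integrable_compact) auto
    show "AE x in lborel. norm (D n x) \<le> indicator (cball 0 (R + 1)) x *\<^sub>R B" for n
    proof (rule AE_I2)
      fix x :: 'a
      have 1: "norm (s n *\<^sub>R e) \<le> 1" using s[of n] assms(2) by simp
      show "norm (D n x) \<le> indicator (cball 0 (R + 1)) x *\<^sub>R B"
      proof (cases "x \<in> cball 0 (R + 1)")
        case True
        have "\<bar>F (x + s n *\<^sub>R e) - F x\<bar> \<le> B * norm (x + s n *\<^sub>R e - x)"
          by (rule smooth_diff_quotient_bound[OF K(1) B(2)])
        also have "\<dots> = B * s n" using s[of n] assms(2) by simp
        finally show ?thesis
          using True s[of n] by (simp add: D_def field_simps)
      next
        case False
        then have "norm x > R + 1" by simp
        moreover have "norm x \<le> norm (x + s n *\<^sub>R e) + norm (s n *\<^sub>R e)"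
          using norm_triangle_ineq4[of "x + s n *\<^sub>R e" "s n *\<^sub>R e"] by simp
        ultimately have "norm (x + s n *\<^sub>R e) > R" "norm x > R" using 1 by linarith+
        then have "x + s n *\<^sub>R e \<notin> K" "x \<notin> K" using R by auto
        then show ?thesis using False K(3) by (simp add: D_def)
      qed
    qed
  qed (use lim in auto)
  then have "(LINT x|lborel. partial e F x) = 0"
    by (simp add: D0 LIMSEQ_const_iff)
  moreover have "partial e F \<in> borel_measurable lborel"
    using smooth_continuous[OF smooth_partial[OF K(1) assms(2)]] borel_measurable_continuous_onI by auto
  ultimately show ?thesis
    by (simp add: integral_completion)
qed

lemma set_integral_eq_whole:
  fixes f :: "'a \<Rightarrow> 'b::{banach, second_countable_topology}"
  assumes "\<And>x. x \<notin> U \<Longrightarrow> f x = 0"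
  shows "(LINT x:U|M. f x) = (LINT x|M. f x)" "set_integrable M U f \<longleftrightarrow> integrable M f"
proof -
  have "(\<lambda>x. indicator U x *\<^sub>R f x) = f" using assms by (auto simp: indicator_def)
  then show "(LINT x:U|M. f x) = (LINT x|M. f x)" "set_integrable M U f \<longleftrightarrow> integrable M f"
    by (auto simp: set_lebesgue_integral_def set_integrable_def)
qed

lemma integral_by_parts_test:
  assumes "smooth f" "test_function U \<theta>" "e \<in> Basis"
  shows "(LINT x:U|lebesgue. f x * partial e \<theta> x) = - (LINT x:U|lebesgue. partial e f x * \<theta> x)"
proof -
  obtain K where K: "smooth \<theta>" "compact K" "K \<subseteq> U" "\<And>x. x \<notin> K \<Longrightarrow> \<theta> x = 0"
    using test_functionE[OF assms(2)] by blast
  have 1: "integrable lebesgue (\<lambda>x. f x * partial e \<theta> x)"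
    by (rule compact_support_integrable[of K])
       (use K assms in \<open>auto intro!: continuous_on_mult[OF smooth_continuous smooth_continuous]
          smooth_partial partial_outside[OF K(2,4)]\<close>)
  have 2: "integrable lebesgue (\<lambda>x. partial e f x * \<theta> x)"
    by (rule compact_support_integrable[of K])
       (use K assms in \<open>auto intro!: continuous_on_mult[OF smooth_continuous smooth_continuous]
          smooth_partial\<close>)
  have "partial e (\<lambda>x. f x * \<theta> x) = (\<lambda>x. f x * partial e \<theta> x + partial e f x * \<theta> x)"
    using assms K(1) by (auto simp: partial_mult smooth_differentiable)
  moreover have "test_function UNIV (\<lambda>x. f x * \<theta> x)"
    using test_function_mult[OF assms(1,2)] test_function_mono by blast
  ultimately have "(LINT x|lebesgue. f x * partial e \<theta> x + partial e f x * \<theta> x) = 0"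
    using integral_partial_eq_0[of "\<lambda>x. f x * \<theta> x" e] assms(3) by simp
  then have "(LINT x|lebesgue. f x * partial e \<theta> x) = - (LINT x|lebesgue. partial e f x * \<theta> x)"
    using 1 2 by (simp add: integral_add)
  moreover have "f x * partial e \<theta> x = 0" "partial e f x * \<theta> x = 0" if "x \<notin> U" for x
  proof -
    have "x \<notin> K" using that K(3) by blast
    then show "f x * partial e \<theta> x = 0" "partial e f x * \<theta> x = 0"
      using K(4) partial_outside[OF K(2), of \<theta>] by auto
  qed
  ultimately show ?thesis by (subst (1 2) set_integral_eq_whole) auto
qed

lemma locally_integrable_mult:
  fixes v :: "'a::euclidean_space \<Rightarrow> real"
  assumes "locally_integrable U v" "continuous_on K \<theta>" "compact K" "K \<subseteq> U" "\<And>x. x \<notin> K \<Longrightarrow> \<theta> x = 0"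
  shows "set_integrable lebesgue U (\<lambda>x. v x * \<theta> x)"
proof -
  have v: "integrable lebesgue (\<lambda>x. indicator K x *\<^sub>R v x)"
    using assms(1,3,4) unfolding locally_integrable_def set_integrable_def by blast
  obtain B where B: "B > 0" "\<And>x. norm (\<theta> x) \<le> B"
    using compact_support_bounded[OF assms(2,3,5)] by blast
  have \<theta>: "\<theta> \<in> borel_measurable lebesgue"
    using compact_support_integrable(2)[OF assms(2,3,5)] by auto
  have "integrable lebesgue (\<lambda>x. (indicator K x *\<^sub>R v x) * \<theta> x)"
    by (rule integrable_mult_bounded[OF v \<theta>, of B]) (use B in auto)
  also have "(\<lambda>x. (indicator K x *\<^sub>R v x) * \<theta> x) = (\<lambda>x. indicator U x *\<^sub>R (v x * \<theta> x))"
    using assms(4,5) by (auto simp: indicator_def fun_eq_iff)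
  finally show ?thesis by (simp add: set_integrable_def)
qed

lemma locally_integrable_mult_test:
  fixes v :: "'a::euclidean_space \<Rightarrow> real"
  assumes "locally_integrable U v" "test_function U \<theta>"
  shows "set_integrable lebesgue U (\<lambda>x. v x * \<theta> x)"
proof -
  obtain K where K: "smooth \<theta>" "compact K" "K \<subseteq> U" "\<And>x. x \<notin> K \<Longrightarrow> \<theta> x = 0"
    using test_functionE[OF assms(2)] by blast
  show ?thesis
    by (rule locally_integrable_mult[OF assms(1) smooth_continuous[OF K(1)] K(2-4)])
qed

lemma locally_integrable_inner:
  "locally_integrable U g \<Longrightarrow> locally_integrable U (\<lambda>x. g x \<bullet> e)"
  unfolding locally_integrable_def set_integrable_def
  using integrable_inner_left[of e lebesgue] by fastforce

lemma locally_integrable_diff: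
  "locally_integrable U f \<Longrightarrow> locally_integrable U g \<Longrightarrow> locally_integrable U (\<lambda>x. f x - g x)"
  unfolding locally_integrable_def by (auto intro: set_integral_diff)

lemma continuous_locally_integrable:
  fixes f :: "'a::euclidean_space \<Rightarrow> 'b::euclidean_space"
  assumes "continuous_on U f"
  shows "locally_integrable U f"
  unfolding locally_integrable_def set_integrable_def
proof (intro allI impI)
  fix K assume K: "compact K \<and> K \<subseteq> U"
  then have "integrable lborel (\<lambda>x. indicator K x *\<^sub>R f x)"
    using borel_integrable_compact continuous_on_subset assms by blast
  then show "integrable lebesgue (\<lambda>x. indicator K x *\<^sub>R f x)"
    using integrable_completion borel_measurable_integrable by (metis sets_lborel measurable_lborel1)
qed

section \<open>The fundamental lemma of the calculus of variations\<close>

text \<open>As \<open>s\<close> grows, these functions increase to the indicator function of the open box.\<close>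

definition box_bump :: "real \<Rightarrow> 'a::euclidean_space \<Rightarrow> 'a \<Rightarrow> 'a \<Rightarrow> real" where
  "box_bump s a b x = (\<Prod>i\<in>Basis. flat_step (s * (x \<bullet> i - a \<bullet> i)) * flat_step (s * (b \<bullet> i - x \<bullet> i)))"

lemma smooth_box_bump: "smooth (box_bump s a b)"
  unfolding box_bump_def by (intro smooth_intros smooth_flat_step)

lemma box_bump_bounds: "0 \<le> box_bump s a b x" "box_bump s a b x \<le> 1"
  unfolding box_bump_def
  by (auto intro!: prod_nonneg prod_le_1 mult_le_one simp: flat_step_nonneg flat_step_le_1)

lemma box_bump_outside: "s \<ge> 0 \<Longrightarrow> x \<notin> box a b \<Longrightarrow> box_bump s a b x = 0"
  unfolding box_bump_def mem_box
  by (auto simp: not_less intro!: prod_zero) (metis diff_ge_0_iff_ge diff_le_0_iff_le flat_step_0 mult_nonneg_nonpos)+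

lemma box_bump_tendsto:
  assumes "x \<in> box a b"
  shows "(\<lambda>n. box_bump (real n) a b x) \<longlonglongrightarrow> 1"
proof -
  have "(\<lambda>n. flat_step (real n * (x \<bullet> i - a \<bullet> i)) * flat_step (real n * (b \<bullet> i - x \<bullet> i))) \<longlonglongrightarrow> 1 * 1"
    if "i \<in> Basis" for i
    using assms that by (intro tendsto_mult flat_step_tendsto_1) (auto simp: mem_box)
  then have "(\<lambda>n. box_bump (real n) a b x) \<longlonglongrightarrow> (\<Prod>i\<in>(Basis::'a set). 1 * 1)"
    unfolding box_bump_def by (rule Limits.tendsto_prod)
  then show ?thesis by simp
qed

text \<open>An open set is a countable union of boxes. The expression \<open>1 - \<Prod>(1 - b)\<close> over finitely many bumps \<open>b\<close>
  is a smooth substitute for their maximum: it stays between 0 and 1, dominates each bump, and vanishes where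
  all of them do.\<close>

lemma open_test_function_approximation:
  fixes V :: "'a::euclidean_space set"
  assumes "open V" "V \<subseteq> K" "compact K" "K \<subseteq> U"
  obtains \<theta> :: "nat \<Rightarrow> 'a \<Rightarrow> real" where "\<And>n. test_function U (\<theta> n)" "\<And>n x. 0 \<le> \<theta> n x" "\<And>n x. \<theta> n x \<le> 1"
    "\<And>n x. x \<notin> V \<Longrightarrow> \<theta> n x = 0" "\<And>x. x \<in> V \<Longrightarrow> (\<lambda>n. \<theta> n x) \<longlonglongrightarrow> 1"
proof -
  obtain \<D> :: "'a set set" where \<D>: "countable \<D>" "\<D> \<subseteq> Pow V" "\<And>X. X \<in> \<D> \<Longrightarrow> \<exists>a b. X = box a b" "\<Union>\<D> = V"
    using open_countable_Union_open_box[OF assms(1)] by metis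
  define E where "E = from_nat_into (insert {} \<D>)"
  have E: "range E = insert {} \<D>" unfolding E_def using \<D>(1) by (intro range_from_nat_into) auto
  have "\<exists>a b. E k = box a b" for k
  proof -
    have "E k = {} \<or> E k \<in> \<D>" using E by blast
    then show ?thesis using \<D>(3) by (metis box_eq_empty(1) box_idem)
  qed
  then obtain a b where ab: "\<And>k. E k = box (a k) (b k)" by metis
  have V: "V = (\<Union>k. box (a k) (b k))"
  proof -
    have "(\<Union>k. box (a k) (b k)) = \<Union>(range E)" by (simp add: ab)
    also have "\<dots> = V" unfolding E using \<D>(4) by simp
    finally show ?thesis ..
  qed
  define \<theta> where "\<theta> = (\<lambda>n x. 1 - (\<Prod>k<n. 1 - box_bump (real n) (a k) (b k) x))"
  have bb: "0 \<le> 1 - box_bump s a b x" "1 - box_bump s a b x \<le> 1" for s and a b x :: 'a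
    using box_bump_bounds[of s a b x] by auto
  have out: "\<theta> n x = 0" if "x \<notin> V" for n x
    using that V by (auto simp: \<theta>_def box_bump_outside)
  show ?thesis
  proof (rule that[of \<theta>])
    show "test_function U (\<theta> n)" for n
    proof (rule test_functionI[OF _ assms(3,4)])
      show "smooth (\<theta> n)"
        unfolding \<theta>_def by (intro smooth_intros) (simp add: smooth_box_bump)
    qed (use out assms(2) in auto)
    show "0 \<le> \<theta> n x" for n x
      using prod_le_1[of "{..<n}" "\<lambda>k. 1 - box_bump (real n) (a k) (b k) x"] bb by (auto simp: \<theta>_def)
    show "\<theta> n x \<le> 1" for n x
      using prod_nonneg[of "{..<n}" "\<lambda>k. 1 - box_bump (real n) (a k) (b k) x"] bb by (auto simp: \<theta>_def)
    show "(\<lambda>n. \<theta> n x) \<longlonglongrightarrow> 1" if "x \<in> V" for x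
    proof -
      obtain k where k: "x \<in> box (a k) (b k)" using \<open>x \<in> V\<close> V by blast
      have *: "1 - (1 - box_bump (real n) (a k) (b k) x) \<le> \<theta> n x" if "n > k" for n
      proof -
        have "(\<Prod>k<n. 1 - box_bump (real n) (a k) (b k) x)
            = (1 - box_bump (real n) (a k) (b k) x) * (\<Prod>k\<in>{..<n} - {k}. 1 - box_bump (real n) (a k) (b k) x)"
          using that by (intro prod.remove) auto
        also have "\<dots> \<le> (1 - box_bump (real n) (a k) (b k) x) * 1"
          using bb by (intro mult_left_mono prod_le_1) auto
        finally show ?thesis by (simp add: \<theta>_def)
      qed
      show ?thesis
      proof (rule tendsto_sandwich)
        show "(\<lambda>n. box_bump (real n) (a k) (b k) x) \<longlonglongrightarrow> 1" by (rule box_bump_tendsto[OF k])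
        show "\<forall>\<^sub>F n in sequentially. box_bump (real n) (a k) (b k) x \<le> \<theta> n x"
          by (rule eventually_mono[OF eventually_gt_at_top[of k]]) (use * in auto)
        show "\<forall>\<^sub>F n in sequentially. \<theta> n x \<le> 1"
          using prod_nonneg[of _ "\<lambda>k. 1 - box_bump _ (a k) (b k) x"] bb by (auto simp: \<theta>_def)
      qed auto
    qed
  qed (use out in auto)
qed

text \<open>By the Lindelof property countably many of the balls suffice.\<close>

lemma AE_on_open_local:
  fixes U :: "'a::euclidean_space set"
  assumes "\<And>p. p \<in> U \<Longrightarrow> \<exists>r>0. AE x in lebesgue. x \<in> ball p r \<longrightarrow> P x"
  shows "AE x in lebesgue. x \<in> U \<longrightarrow> P x"
proof -
  obtain r where r: "\<And>p. p \<in> U \<Longrightarrow> r p > 0" "\<And>p. p \<in> U \<Longrightarrow> AE x in lebesgue. x \<in> ball p (r p) \<longrightarrow> P x"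
    using assms by metis
  define \<F> where "\<F> = (\<lambda>p. ball p (r p)) ` U"
  obtain \<G> where \<G>: "\<G> \<subseteq> \<F>" "countable \<G>" "\<Union>\<G> = \<Union>\<F>"
    using Lindelof[of \<F>] unfolding \<F>_def by blast
  have "AE x in lebesgue. \<forall>B\<in>\<G>. x \<in> B \<longrightarrow> P x"
  proof (subst AE_ball_countable[OF \<G>(2)], intro ballI)
    fix B assume "B \<in> \<G>"
    then show "AE x in lebesgue. x \<in> B \<longrightarrow> P x" using r(2) \<G>(1) unfolding \<F>_def by blast
  qed
  moreover have "U \<subseteq> \<Union>\<G>" unfolding \<G>(3) \<F>_def using r(1) by force
  ultimately show ?thesis by (auto elim!: eventually_mono)
qed

text \<open>The one-sided form of the fundamental lemma. Test functions approximate the indicator functions of open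
  sets, so \<open>F\<close> has nonpositive integral over every open subset of a small ball. The set where \<open>F\<close> is positive
  is, up to a null set, a decreasing limit of open sets; its integral is therefore nonpositive as well, which
  is only possible if the set is null.\<close>

theorem nonpositive_from_test_functions:
  fixes F :: "'a::euclidean_space \<Rightarrow> real"
  assumes "open U" "locally_integrable U F"
    and test: "\<And>\<theta>. test_function U \<theta> \<Longrightarrow> (\<And>x. 0 \<le> \<theta> x) \<Longrightarrow> (LINT x:U|lebesgue. F x * \<theta> x) \<le> 0"
  shows "AE x in lebesgue. x \<in> U \<longrightarrow> F x \<le> 0"
proof (rule AE_on_open_local)
  fix p assume "p \<in> U"
  then obtain r where r: "r > 0" "cball p r \<subseteq> U"
    using \<open>open U\<close> open_contains_cball by blast
  define G where "G = (\<lambda>x. indicator (cball p r) x *\<^sub>R F x)"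
  have G_int: "integrable lebesgue G"
    using assms(2) r unfolding G_def locally_integrable_def set_integrable_def by auto
  then have [measurable]: "G \<in> borel_measurable lebesgue" by auto
  have open_le: "(LINT x|lebesgue. indicator V x * G x) \<le> 0" if V: "open V" "V \<subseteq> ball p r" for V
  proof -
    have sub: "V \<subseteq> cball p r" using V(2) ball_subset_cball by blast
    obtain \<theta> where \<theta>: "\<And>n. test_function U (\<theta> n)" "\<And>n x. 0 \<le> \<theta> n x" "\<And>n x. \<theta> n x \<le> 1"
      "\<And>n x. x \<notin> V \<Longrightarrow> \<theta> n x = 0" "\<And>x. x \<in> V \<Longrightarrow> (\<lambda>n. \<theta> n x) \<longlonglongrightarrow> (1::real)"
      by (rule open_test_function_approximation[OF V(1) sub compact_cball r(2)]) (rule that)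
    have [measurable]: "\<theta> n \<in> borel_measurable lebesgue" for n
      using borel_measurable_continuous_onI[OF smooth_continuous[OF test_function_smooth[OF \<theta>(1)]]]
      by (simp add: measurable_completion)
    have [measurable]: "V \<in> sets lebesgue" using V(1) by auto
    have lim: "(\<lambda>n. LINT x|lebesgue. \<theta> n x * G x) \<longlonglongrightarrow> (LINT x|lebesgue. indicator V x * G x)"
    proof (rule integral_dominated_convergence[where w = "\<lambda>x. norm (G x)"])
      have "(\<lambda>n. \<theta> n x * G x) \<longlonglongrightarrow> indicator V x * G x" for x
        using \<theta>(4,5) by (cases "x \<in> V") (auto intro!: tendsto_eq_intros)
      then show "AE x in lebesgue. (\<lambda>n. \<theta> n x * G x) \<longlonglongrightarrow> indicator V x * G x" by simp
      show "AE x in lebesgue. norm (\<theta> n x * G x) \<le> norm (G x)" for n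
        using \<theta>(2,3) by (intro AE_I2) (simp add: abs_mult mult_left_le_one_le)
    qed (use G_int in auto)
    have "(LINT x|lebesgue. \<theta> n x * G x) \<le> 0" for n
    proof -
      have "(\<lambda>x. \<theta> n x * G x) = (\<lambda>x. F x * \<theta> n x)"
      proof
        fix x show "\<theta> n x * G x = F x * \<theta> n x"
        using \<theta>(4)[of x n] V(2) by (cases "x \<in> V") (auto simp: G_def indicator_def)
      qed
      moreover have "(LINT x:U|lebesgue. F x * \<theta> n x) = (LINT x|lebesgue. F x * \<theta> n x)"
        by (rule set_integral_eq_whole) (use test_function_outside[OF \<theta>(1)] in auto)
      ultimately show ?thesis using test[OF \<theta>(1,2), of n] by simp
    qed
    then show ?thesis by (intro LIMSEQ_le_const2[OF lim]) auto
  qed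
  \<comment> \<open>The set of positivity has an open hull of the same measure, the intersection of countably many open sets.\<close>
  define E where "E = {x. indicator (ball p r) x * G x > 0}"
  have [measurable]: "ball p r \<in> sets lebesgue" by auto
  have "(\<lambda>x. indicator (ball p r) x * G x) \<in> borel_measurable lebesgue" by measurable
  then have E: "E \<in> sets lebesgue"
    using measurable_sets[of "\<lambda>x. indicator (ball p r) x * G x" lebesgue borel "{0<..}"]
    by (simp add: E_def vimage_def)
  obtain C T where CT: "gdelta C" "T \<in> null_sets lebesgue" "E \<union> T = C"
    using lebesgue_set_almost_gdelta[OF E] by metis
  obtain H :: "nat \<Rightarrow> 'a set" where H: "\<And>n. open (H n)" "C = (\<Inter>n. H n)"
    using CT(1) by (auto elim: gdelta.cases)
  define V where "V = (\<lambda>n. ball p r \<inter> (\<Inter>k\<le>n. H k))"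
  have V: "open (V n)" "V n \<subseteq> ball p r" for n unfolding V_def using H by auto
  have [measurable]: "V n \<in> sets lebesgue" for n using V by auto
  have "(\<lambda>n. LINT x|lebesgue. indicator (V n) x * G x) \<longlonglongrightarrow> (LINT x|lebesgue. indicator E x * G x)"
  proof (rule integral_dominated_convergence[where w = "\<lambda>x. norm (G x)"])
    show "(\<lambda>x. indicator E x * G x) \<in> borel_measurable lebesgue" using E by measurable
    have "(\<lambda>n. indicator (V n) x * G x) \<longlonglongrightarrow> indicator E x * G x" if "x \<notin> T" for x
    proof (rule tendsto_eventually)
      show "\<forall>\<^sub>F n in sequentially. indicator (V n) x * G x = indicator E x * G x"
      proof (cases "x \<in> E")
        case True
        have "x \<in> C" using True CT(3) by blast
        moreover have "x \<in> ball p r"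
        proof (rule ccontr)
          assume "x \<notin> ball p r"
          then have "indicator (ball p r) x = (0::real)" by simp
          with True show False by (simp add: E_def)
        qed
        ultimately have "x \<in> V n" for n using H(2) by (auto simp: V_def)
        then show ?thesis using True by simp
      next
        case False
        then have "x \<notin> C" using that CT(3) by blast
        then obtain m where "x \<notin> H m" using H(2) by blast
        then have "x \<notin> V n" if "n \<ge> m" for n using that by (auto simp: V_def)
        then show ?thesis using False by (auto simp: eventually_sequentially intro!: exI[of _ m])
      qed
    qed
    then show "AE x in lebesgue. (\<lambda>n. indicator (V n) x * G x) \<longlonglongrightarrow> indicator E x * G x"
      using AE_not_in[OF CT(2)] by (auto elim!: eventually_mono)
  qed (use G_int in \<open>auto simp: indicator_def\<close>)
  then have "(LINT x|lebesgue. indicator E x * G x) \<le> 0"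
    by (rule LIMSEQ_le_const2) (use open_le[OF V] in auto)
  moreover have int_E: "integrable lebesgue (\<lambda>x. indicator E x * G x)"
    using integrable_mult_indicator[OF E G_int] by simp
  moreover have nn: "0 \<le> indicator E x * G x" for x
    by (auto simp: indicator_def E_def split: if_splits)
  ultimately have "(LINT x|lebesgue. indicator E x * G x) = 0"
    by (intro antisym Bochner_Integration.integral_nonneg nn)
  then have "AE x in lebesgue. indicator E x * G x = 0"
    using integral_nonneg_eq_0_iff_AE[OF int_E] nn by auto
  then have "AE x in lebesgue. x \<in> ball p r \<longrightarrow> F x \<le> 0"
    by (rule eventually_mono) (auto simp: E_def G_def indicator_def split: if_splits)
  with r(1) show "\<exists>r>0. AE x in lebesgue. x \<in> ball p r \<longrightarrow> F x \<le> 0" by blast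
qed

section \<open>Weak gradients and energy norms\<close>

lemma open_sets_lebesgue: "open U \<Longrightarrow> U \<inter> space lebesgue \<in> sets lebesgue"
  by auto

lemma set_integral_lebesgue_on:
  fixes f :: "'a::euclidean_space \<Rightarrow> 'b::{banach, second_countable_topology}"
  assumes "open U"
  shows "(LINT x:U|lebesgue. f x) = (LINT x|lebesgue_on U. f x)"
    "set_integrable lebesgue U f \<longleftrightarrow> integrable (lebesgue_on U) f"
  using integral_restrict_space[OF open_sets_lebesgue[OF assms], of f]
    integrable_restrict_space[OF open_sets_lebesgue[OF assms], of f]
  by (auto simp: set_lebesgue_integral_def set_integrable_def)

lemma AE_lebesgue_on: "open U \<Longrightarrow> (AE x in lebesgue_on U. P x) \<longleftrightarrow> (AE x in lebesgue. x \<in> U \<longrightarrow> P x)"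
  by (rule AE_restrict_space_iff[OF open_sets_lebesgue])

lemma continuous_measurable_lebesgue_on:
  fixes f :: "'a::euclidean_space \<Rightarrow> 'b::euclidean_space"
  assumes "continuous_on U f" "open U"
  shows "f \<in> borel_measurable (lebesgue_on U)"
  using continuous_imp_measurable_on_sets_lebesgue[OF assms(1)] assms(2) by auto

text \<open>Local integrability controls the function on compact sets only, so measurability is obtained along a
  compact exhaustion.\<close>

lemma locally_integrable_measurable:
  fixes f :: "'a::euclidean_space \<Rightarrow> 'b::euclidean_space"
  assumes "open U" "locally_integrable U f"
  shows "f \<in> borel_measurable (lebesgue_on U)"
proof -
  obtain C :: "nat \<Rightarrow> 'a set" where C: "\<And>n. compact (C n)" "\<And>n. C n \<subseteq> U"
    "\<And>n. C n \<subseteq> interior (C (Suc n))" "\<Union>(range C) = U"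
    using open_Union_compact_subsets[OF assms(1)] by metis
  have mono: "C m \<subseteq> C n" if "m \<le> n" for m n
    using that by (rule lift_Suc_mono_le[rotated]) (meson C(3) interior_subset order_trans)
  have "(\<lambda>x. indicator U x *\<^sub>R f x) \<in> borel_measurable lebesgue"
  proof (rule borel_measurable_LIMSEQ_metric)
    show "(\<lambda>x. indicator (C n) x *\<^sub>R f x) \<in> borel_measurable lebesgue" for n
      using assms(2) C(1,2) unfolding locally_integrable_def set_integrable_def
      by (blast intro: borel_measurable_integrable)
    show "(\<lambda>n. indicator (C n) x *\<^sub>R f x) \<longlonglongrightarrow> indicator U x *\<^sub>R f x" for x
    proof (rule tendsto_eventually, cases "x \<in> U")
      case True
      then obtain m where "x \<in> C m" using C(4) by blast
      then have "x \<in> C n" if "n \<ge> m" for n using mono that by blast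
      then show "\<forall>\<^sub>F n in sequentially. indicator (C n) x *\<^sub>R f x = indicator U x *\<^sub>R f x"
        using True by (auto simp: eventually_sequentially indicator_def intro!: exI[of _ m])
    next
      case False
      then have "x \<notin> C n" for n using C(2) by blast
      then show "\<forall>\<^sub>F n in sequentially. indicator (C n) x *\<^sub>R f x = indicator U x *\<^sub>R f x"
        using False by simp
    qed
  qed
  then show ?thesis
    using borel_measurable_restrict_space_iff[OF open_sets_lebesgue[OF assms(1)], of f] by simp
qed

text \<open>This licenses computing with any weak gradient in place of the representative chosen by
  \<open>weak_gradient\<close>.\<close>

lemma weak_gradient_unique:
  assumes "open U" "has_weak_gradient U v g" "has_weak_gradient U v g'"
  shows "AE x in lebesgue_on U. g x = g' x"
proof -
  have le: "AE x in lebesgue. x \<in> U \<longrightarrow> a x \<bullet> e - b x \<bullet> e \<le> 0"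
    if ab: "has_weak_gradient U v a" "has_weak_gradient U v b" and e: "e \<in> Basis" for a b and e :: 'a
  proof (rule nonpositive_from_test_functions[OF assms(1)])
    have li: "locally_integrable U (\<lambda>x. a x \<bullet> e)" "locally_integrable U (\<lambda>x. b x \<bullet> e)"
      using ab by (auto simp: has_weak_gradient_def intro: locally_integrable_inner)
    then show "locally_integrable U (\<lambda>x. a x \<bullet> e - b x \<bullet> e)"
      by (rule locally_integrable_diff)
    fix \<theta> assume \<theta>: "test_function U \<theta>"
    have "(LINT x:U|lebesgue. (a x \<bullet> e) * \<theta> x) = (LINT x:U|lebesgue. (b x \<bullet> e) * \<theta> x)"
      using ab \<theta> e by (simp add: has_weak_gradient_def)
    then have "(LINT x:U|lebesgue. (a x \<bullet> e) * \<theta> x - (b x \<bullet> e) * \<theta> x) = 0"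
      using locally_integrable_mult_test[OF li(1) \<theta>] locally_integrable_mult_test[OF li(2) \<theta>]
      by (simp add: set_integral_diff)
    then show "(LINT x:U|lebesgue. (a x \<bullet> e - b x \<bullet> e) * \<theta> x) \<le> 0"
      by (simp add: left_diff_distrib)
  qed
  have "AE x in lebesgue. \<forall>e\<in>Basis. x \<in> U \<longrightarrow> g x \<bullet> e = g' x \<bullet> e"
  proof (subst AE_ball_countable)
    show "countable (Basis :: 'a set)" by (simp add: countable_finite)
    show "\<forall>e\<in>Basis. AE x in lebesgue. x \<in> U \<longrightarrow> g x \<bullet> e = g' x \<bullet> e"
    proof
      fix e :: 'a assume e: "e \<in> Basis"
      from le[OF assms(2,3) e] le[OF assms(3,2) e]
      show "AE x in lebesgue. x \<in> U \<longrightarrow> g x \<bullet> e = g' x \<bullet> e"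
        by eventually_elim auto
    qed
  qed
  then show ?thesis
    unfolding AE_lebesgue_on[OF assms(1)] by eventually_elim (auto intro: euclidean_eqI)
qed

lemma has_weak_gradient_smooth:
  assumes "smooth f"
  shows "has_weak_gradient U f (grad f)"
  unfolding has_weak_gradient_def
proof (intro conjI allI impI ballI)
  show "locally_integrable U f" "locally_integrable U (grad f)"
    using assms by (auto intro: continuous_locally_integrable smooth_continuous grad_continuous)
  fix \<phi> and e :: 'a assume "test_function U \<phi>" "e \<in> Basis"
  then show "(LINT x:U|lebesgue. f x * frechet_derivative \<phi> (at x) e)
      = - (LINT x:U|lebesgue. (grad f x \<bullet> e) * \<phi> x)"
    using integral_by_parts_test[OF assms, of U \<phi> e] by (simp add: partial_def[of e \<phi>] inner_grad)
qed

lemma weak_gradient_works: "weakly_differentiable U v \<Longrightarrow> has_weak_gradient U v (weak_gradient U v)"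
  unfolding weakly_differentiable_def weak_gradient_def
  using someI_ex[of "has_weak_gradient U v"] by simp

lemma weak_gradient_AE_eq:
  "open U \<Longrightarrow> has_weak_gradient U v g \<Longrightarrow> AE x in lebesgue_on U. weak_gradient U v x = g x"
  by (rule weak_gradient_unique[OF _ weak_gradient_works]) (auto simp: weakly_differentiable_def)

lemma has_weak_gradient_diff:
  assumes "has_weak_gradient U v g" "smooth \<phi>"
  shows "has_weak_gradient U (\<lambda>x. v x - \<phi> x) (\<lambda>x. g x - grad \<phi> x)"
proof -
  note \<phi> = has_weak_gradient_smooth[OF assms(2), of U]
  have v: "locally_integrable U v" "locally_integrable U g"
    and p: "locally_integrable U \<phi>" "locally_integrable U (grad \<phi>)"
    using assms(1) \<phi> by (auto simp: has_weak_gradient_def)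
  show ?thesis
    unfolding has_weak_gradient_def
  proof (intro conjI allI impI ballI)
    show "locally_integrable U (\<lambda>x. v x - \<phi> x)" by (rule locally_integrable_diff[OF v(1) p(1)])
    show "locally_integrable U (\<lambda>x. g x - grad \<phi> x)"
      using v(2) p(2) by (auto simp: locally_integrable_def intro: set_integral_diff)
    fix \<theta> and e :: 'a assume \<theta>: "test_function U \<theta>" and e: "e \<in> Basis"
    have "(LINT x:U|lebesgue. (v x - \<phi> x) * partial e \<theta> x)
        = (LINT x:U|lebesgue. v x * partial e \<theta> x) - (LINT x:U|lebesgue. \<phi> x * partial e \<theta> x)"
      using locally_integrable_mult_test[OF v(1) test_function_partial[OF \<theta> e]]
        locally_integrable_mult_test[OF p(1) test_function_partial[OF \<theta> e]]
      by (simp add: left_diff_distrib set_integral_diff)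
    also have "\<dots> = - ((LINT x:U|lebesgue. (g x \<bullet> e) * \<theta> x) - (LINT x:U|lebesgue. (grad \<phi> x \<bullet> e) * \<theta> x))"
      using assms(1) \<phi> \<theta> e by (simp add: has_weak_gradient_def partial_def[of e \<theta>])
    also have "\<dots> = - (LINT x:U|lebesgue. ((g x - grad \<phi> x) \<bullet> e) * \<theta> x)"
      using locally_integrable_mult_test[OF locally_integrable_inner[OF v(2)] \<theta>, of e]
        locally_integrable_mult_test[OF locally_integrable_inner[OF p(2)] \<theta>, of e]
      by (simp add: inner_diff_left left_diff_distrib set_integral_diff)
    finally show "(LINT x:U|lebesgue. (v x - \<phi> x) * frechet_derivative \<theta> (at x) e)
        = - (LINT x:U|lebesgue. ((g x - grad \<phi> x) \<bullet> e) * \<theta> x)"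
      by (simp add: partial_def)
  qed
qed

lemma enn_powr_half_square: "enn_powr (enn_powr N (1 / 2)) 2 = N"
  by (cases N) (auto simp: enn_powr_def powr_powr)

lemma Lp_norm_2_square:
  assumes "f \<in> borel_measurable (lebesgue_on U)"
  shows "enn_powr (Lp_norm 2 U f) 2 = (\<integral>\<^sup>+x. ennreal ((norm (f x))\<^sup>2) \<partial>lebesgue_on U)"
proof -
  have "norm (f x) powr 2 = (norm (f x))\<^sup>2" for x
    by (simp add: powr_numeral)
  then show ?thesis
    using assms by (simp add: Lp_norm_def enn_powr_half_square)
qed

text \<open>The nested roots and powers in the definition of the norm cancel for exponent two and leave a single
  integral, which may be evaluated with any weak gradient.\<close>

lemma W1p_norm_2_eq:
  assumes "open U" "has_weak_gradient U v g"
  shows "W1p_norm 2 U v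
    = enn_powr (\<integral>\<^sup>+x. ennreal ((v x)\<^sup>2 + (norm (g x))\<^sup>2) \<partial>lebesgue_on U) (1 / 2)"
proof -
  let ?w = "weak_gradient U v"
  have w: "has_weak_gradient U v ?w"
    using assms(2) weak_gradient_works by (auto simp: weakly_differentiable_def)
  have [measurable]: "v \<in> borel_measurable (lebesgue_on U)" "?w \<in> borel_measurable (lebesgue_on U)"
    using w locally_integrable_measurable[OF assms(1)] by (auto simp: has_weak_gradient_def)
  have "W1p_norm 2 U v = enn_powr ((\<integral>\<^sup>+x. ennreal ((v x)\<^sup>2) \<partial>lebesgue_on U)
      + (\<Sum>e\<in>Basis. \<integral>\<^sup>+x. ennreal ((?w x \<bullet> e)\<^sup>2) \<partial>lebesgue_on U)) (1 / 2)"
    using assms(2) by (auto simp: W1p_norm_def Lp_norm_2_square weakly_differentiable_def)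
  also have "(\<integral>\<^sup>+x. ennreal ((v x)\<^sup>2) \<partial>lebesgue_on U)
      + (\<Sum>e\<in>Basis. \<integral>\<^sup>+x. ennreal ((?w x \<bullet> e)\<^sup>2) \<partial>lebesgue_on U)
      = (\<integral>\<^sup>+x. ennreal ((v x)\<^sup>2) + (\<Sum>e\<in>Basis. ennreal ((?w x \<bullet> e)\<^sup>2)) \<partial>lebesgue_on U)"
    by (simp add: nn_integral_sum nn_integral_add del: sum_ennreal)
  also have "\<dots> = (\<integral>\<^sup>+x. ennreal ((v x)\<^sup>2 + (norm (?w x))\<^sup>2) \<partial>lebesgue_on U)"
  proof (rule nn_integral_cong)
    fix x
    have "(norm (?w x))\<^sup>2 = (\<Sum>e\<in>Basis. (?w x \<bullet> e)\<^sup>2)"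
      by (subst power2_norm_eq_inner, subst euclidean_inner) (simp add: power2_eq_square)
    then show "ennreal ((v x)\<^sup>2) + (\<Sum>e\<in>Basis. ennreal ((?w x \<bullet> e)\<^sup>2)) = ennreal ((v x)\<^sup>2 + (norm (?w x))\<^sup>2)"
      by (simp add: sum_nonneg)
  qed
  also have "\<dots> = (\<integral>\<^sup>+x. ennreal ((v x)\<^sup>2 + (norm (g x))\<^sup>2) \<partial>lebesgue_on U)"
    using weak_gradient_AE_eq[OF assms] by (intro nn_integral_cong_AE) auto
  finally show ?thesis .
qed

lemma W12_norm_less_imp:
  assumes "open U" "has_weak_gradient U v g" "W1p_norm 2 U v < ennreal r" "r \<ge> 0"
  shows "integrable (lebesgue_on U) (\<lambda>x. (v x)\<^sup>2 + (norm (g x))\<^sup>2)"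
    and "(LINT x|lebesgue_on U. (v x)\<^sup>2 + (norm (g x))\<^sup>2) \<le> r\<^sup>2"
proof -
  let ?f = "\<lambda>x. (v x)\<^sup>2 + (norm (g x))\<^sup>2"
  define X where "X = (\<integral>\<^sup>+x. ennreal (?f x) \<partial>lebesgue_on U)"
  have [measurable]: "v \<in> borel_measurable (lebesgue_on U)" "g \<in> borel_measurable (lebesgue_on U)"
    using assms(2) locally_integrable_measurable[OF assms(1)] by (auto simp: has_weak_gradient_def)
  have *: "enn_powr X (1 / 2) < ennreal r" using assms(3) unfolding W1p_norm_2_eq[OF assms(1,2)] X_def .
  then have fin: "X \<noteq> \<infinity>" by (auto simp: enn_powr_def)
  then have "ennreal (enn2real X powr (1 / 2)) < ennreal r" using * by (simp add: enn_powr_def)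
  then have "enn2real X powr (1 / 2) < r" by (simp add: ennreal_less_iff)
  then have "(enn2real X powr (1 / 2))\<^sup>2 \<le> r\<^sup>2" by (intro power_mono) auto
  then have le: "enn2real X \<le> r\<^sup>2" by (simp add: powr_half_sqrt)
  show "integrable (lebesgue_on U) ?f"
    by (rule integrableI_nonneg) (use fin in \<open>auto simp: X_def less_top simp del: ennreal_plus\<close>)
  have "integral\<^sup>L (lebesgue_on U) ?f = enn2real X"
    unfolding X_def by (rule integral_eq_nn_integral) auto
  with le show "integral\<^sup>L (lebesgue_on U) ?f \<le> r\<^sup>2" by simp
qed

lemma test_function_H10:
  assumes "open U" "test_function U \<phi>"
  shows "H10 U \<phi>"
proof -
  obtain K where K: "smooth \<phi>" "compact K" "K \<subseteq> U" "\<And>x. x \<notin> K \<Longrightarrow> \<phi> x = 0"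
    using test_functionE[OF assms(2)] by blast
  have wg: "has_weak_gradient U \<phi> (grad \<phi>)" by (rule has_weak_gradient_smooth[OF K(1)])
  let ?f = "\<lambda>x. (\<phi> x)\<^sup>2 + (norm (grad \<phi> x))\<^sup>2"
  have "grad \<phi> x = 0" if "x \<notin> K" for x
    using partial_outside[OF K(2,4) that] by (simp add: grad_def)
  moreover have "continuous_on K ?f"
    by (intro continuous_on_add continuous_on_power continuous_on_norm smooth_continuous[OF K(1)]
        grad_continuous[OF K(1)])
  ultimately have "integrable lebesgue ?f"
    using K by (intro compact_support_integrable(2)[of K]) auto
  then have "integrable (lebesgue_on U) ?f"
    using integrable_mult_indicator[of U lebesgue ?f] assms(1)
      set_integral_lebesgue_on(2)[OF assms(1), of ?f] by (auto simp: set_integrable_def)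
  then have "(\<integral>\<^sup>+x. ennreal (?f x) \<partial>lebesgue_on U) < \<infinity>"
    by (subst nn_integral_eq_integral) auto
  then have fin: "W1p_norm 2 U \<phi> < \<infinity>"
    unfolding W1p_norm_2_eq[OF assms(1) wg] by (auto simp: enn_powr_def)
  have "has_weak_gradient U (\<lambda>x. \<phi> x - \<phi> x) (\<lambda>x. grad \<phi> x - grad \<phi> x)"
    by (rule has_weak_gradient_diff[OF wg K(1)])
  from W1p_norm_2_eq[OF assms(1) this]
  have "W1p_norm 2 U (\<lambda>x. \<phi> x - \<phi> x) = 0" by (simp add: enn_powr_def)
  then show ?thesis
    unfolding H10_def using fin assms(2) by (intro conjI exI[of _ "\<lambda>_. \<phi>"]) auto
qed

lemma H10_has_weak_gradient: "H10 U v \<Longrightarrow> has_weak_gradient U v (weak_gradient U v)"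
  by (rule weak_gradient_works) (auto simp: H10_def W1p_norm_def split: if_splits)

lemma H10_integrable_energy:
  assumes "open U" "H10 U v"
  shows "integrable (lebesgue_on U) (\<lambda>x. (v x)\<^sup>2 + (norm (weak_gradient U v x))\<^sup>2)"
proof -
  have "W1p_norm 2 U v < \<infinity>" using assms(2) by (simp add: H10_def)
  then obtain r where "W1p_norm 2 U v = ennreal r" "r \<ge> 0"
    by (cases "W1p_norm 2 U v") auto
  then have "W1p_norm 2 U v < ennreal (r + 1)" "r + 1 \<ge> 0" by (auto simp: ennreal_less_iff)
  then show ?thesis
    using W12_norm_less_imp(1)[OF assms(1) H10_has_weak_gradient[OF assms(2)]] by blast
qed

text \<open>Nonlinear functions of an \<open>H10\<close> function are never formed; they are applied to an approximating test function,
  and the error is estimated by this integral.\<close>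

lemma H10_test_function_approximation:
  assumes "open U" "H10 U v" "\<epsilon> > 0"
  obtains \<phi> where "test_function U \<phi>"
    "integrable (lebesgue_on U) (\<lambda>x. (v x - \<phi> x)\<^sup>2 + (norm (weak_gradient U v x - grad \<phi> x))\<^sup>2)"
    "(LINT x|lebesgue_on U. (v x - \<phi> x)\<^sup>2 + (norm (weak_gradient U v x - grad \<phi> x))\<^sup>2) \<le> \<epsilon>\<^sup>2"
proof -
  obtain \<phi> where \<phi>: "\<And>n::nat. test_function U (\<phi> n)"
    "(\<lambda>n. W1p_norm 2 U (\<lambda>x. v x - \<phi> n x)) \<longlonglongrightarrow> 0"
    using assms(2) by (auto simp: H10_def)
  have "\<forall>\<^sub>F n in sequentially. W1p_norm 2 U (\<lambda>x. v x - \<phi> n x) < ennreal \<epsilon>"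
    using order_tendstoD(2)[OF \<phi>(2), of "ennreal \<epsilon>"] assms(3) by simp
  then obtain n where n: "W1p_norm 2 U (\<lambda>x. v x - \<phi> n x) < ennreal \<epsilon>"
    by (auto simp: eventually_sequentially)
  have "has_weak_gradient U (\<lambda>x. v x - \<phi> n x) (\<lambda>x. weak_gradient U v x - grad (\<phi> n) x)"
    by (rule has_weak_gradient_diff[OF H10_has_weak_gradient[OF assms(2)] test_function_smooth[OF \<phi>(1)]])
  from W12_norm_less_imp[OF assms(1) this n] show ?thesis
    using that \<phi>(1) assms(3) by auto
qed

lemma poisson_dirichlet_test:
  assumes "open U" "poisson_dirichlet_solution U f u" "test_function U w"
  shows "(LINT x|lebesgue_on U. weak_gradient U u x \<bullet> grad w x) = (LINT x|lebesgue_on U. f x * w x)"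
proof -
  have w: "H10 U w" by (rule test_function_H10[OF assms(1,3)])
  have [measurable]: "weak_gradient U u \<in> borel_measurable (lebesgue_on U)"
    "weak_gradient U w \<in> borel_measurable (lebesgue_on U)"
    using H10_has_weak_gradient[OF w] assms(2) H10_has_weak_gradient[of U u]
      locally_integrable_measurable[OF assms(1)]
    by (auto simp: has_weak_gradient_def poisson_dirichlet_solution_def)
  have [measurable]: "grad w \<in> borel_measurable (lebesgue_on U)"
    using grad_continuous[OF test_function_smooth[OF assms(3)]]
    by (rule continuous_measurable_lebesgue_on) fact
  have "(LINT x|lebesgue_on U. weak_gradient U u x \<bullet> grad w x)
      = (LINT x|lebesgue_on U. weak_gradient U u x \<bullet> weak_gradient U w x)"
    using weak_gradient_AE_eq[OF assms(1) has_weak_gradient_smooth[OF test_function_smooth[OF assms(3)]]]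
    by (intro integral_cong_AE) auto
  also have "\<dots> = (LINT x|lebesgue_on U. f x * w x)"
    using assms(2) w by (simp add: poisson_dirichlet_solution_def set_integral_lebesgue_on[OF assms(1)])
  finally show ?thesis .
qed

section \<open>Kato's inequality up to the boundary\<close>

lemma test_function_integrable:
  assumes "open U" "test_function U \<theta>"
  shows "integrable (lebesgue_on U) \<theta>"
proof -
  obtain K where K: "smooth \<theta>" "compact K" "K \<subseteq> U" "\<And>x. x \<notin> K \<Longrightarrow> \<theta> x = 0"
    using test_functionE[OF assms(2)] by blast
  have "integrable lebesgue \<theta>"
    by (rule compact_support_integrable(2)[OF smooth_continuous[OF K(1)] K(2,4)])
  then show ?thesis
    using set_integral_eq_whole(2)[of U \<theta> lebesgue] test_function_outside[OF assms(2)]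
      set_integral_lebesgue_on(2)[OF assms(1), of \<theta>] by auto
qed

lemma inner_grad_sum: "grad f x \<bullet> grad g x = (\<Sum>e\<in>Basis. partial e f x * partial e g x)"
  by (subst euclidean_inner) (simp add: inner_grad)

lemma green_identity_test:
  assumes "open U" "smooth \<zeta>" "test_function U \<theta>"
  shows "integrable (lebesgue_on U) (\<lambda>x. grad \<zeta> x \<bullet> grad \<theta> x)"
    and "integrable (lebesgue_on U) (\<lambda>x. laplacian \<zeta> x * \<theta> x)"
    and "(LINT x|lebesgue_on U. grad \<zeta> x \<bullet> grad \<theta> x) = - (LINT x|lebesgue_on U. laplacian \<zeta> x * \<theta> x)"
proof -
  have 1: "integrable (lebesgue_on U) (\<lambda>x. partial e \<zeta> x * partial e \<theta> x)" if "e \<in> Basis" for e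
    by (rule test_function_integrable[OF assms(1)
          test_function_mult[OF smooth_partial[OF assms(2) that] test_function_partial[OF assms(3) that]]])
  have 2: "integrable (lebesgue_on U) (\<lambda>x. partial e (partial e \<zeta>) x * \<theta> x)" if "e \<in> Basis" for e
    by (rule test_function_integrable[OF assms(1)
          test_function_mult[OF smooth_partial[OF smooth_partial[OF assms(2) that] that] assms(3)]])
  show "integrable (lebesgue_on U) (\<lambda>x. grad \<zeta> x \<bullet> grad \<theta> x)"
    unfolding inner_grad_sum by (intro Bochner_Integration.integrable_sum 1)
  show "integrable (lebesgue_on U) (\<lambda>x. laplacian \<zeta> x * \<theta> x)"
    unfolding laplacian_def sum_distrib_right by (intro Bochner_Integration.integrable_sum 2)
  have "(LINT x|lebesgue_on U. partial e \<zeta> x * partial e \<theta> x)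
      = - (LINT x|lebesgue_on U. partial e (partial e \<zeta>) x * \<theta> x)" if "e \<in> Basis" for e
    using integral_by_parts_test[OF smooth_partial[OF assms(2) that] assms(3) that]
    by (simp add: set_integral_lebesgue_on[OF assms(1)])
  then show "(LINT x|lebesgue_on U. grad \<zeta> x \<bullet> grad \<theta> x) = - (LINT x|lebesgue_on U. laplacian \<zeta> x * \<theta> x)"
    unfolding inner_grad_sum laplacian_def sum_distrib_right
    by (subst (1 2) Bochner_Integration.integral_sum) (auto simp: 1 2 sum_negf)
qed

lemma smooth_laplacian: "smooth f \<Longrightarrow> smooth (laplacian f)"
  unfolding laplacian_def[abs_def] by (intro smooth_sum smooth_partial)

lemma continuous_bounded_on_bounded:
  fixes f :: "'a::euclidean_space \<Rightarrow> 'b::real_normed_vector"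
  assumes "bounded U" "continuous_on UNIV f"
  obtains B where "B \<ge> 0" "\<And>x. x \<in> U \<Longrightarrow> norm (f x) \<le> B"
proof -
  have "compact (closure U)" using assms(1) by simp
  then have "compact (f ` closure U)"
    using assms(2) continuous_on_subset by (intro compact_continuous_image) auto
  then obtain B where B: "B > 0" "\<And>y. y \<in> f ` closure U \<Longrightarrow> norm y \<le> B"
    using compact_imp_bounded bounded_pos by metis
  have "norm (f x) \<le> B" if "x \<in> U" for x
    using B(2) that closure_subset by blast
  with B(1) show ?thesis using that[of B] by simp
qed

lemma open_bounded_finite_measure:
  assumes "open U" "bounded U"
  shows "finite_measure (lebesgue_on (U :: 'a::euclidean_space set))"
  using assms by (intro finite_measure_lebesgue_on lmeasurable_open) auto

lemma H10_integrable:
  assumes "open U" "bounded U" "H10 U u"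
  shows "integrable (lebesgue_on U) u" "integrable (lebesgue_on U) (weak_gradient U u)"
proof -
  interpret finite_measure "lebesgue_on U" by (rule open_bounded_finite_measure[OF assms(1,2)])
  have i: "integrable (lebesgue_on U) (\<lambda>x. 1 + ((u x)\<^sup>2 + (norm (weak_gradient U u x))\<^sup>2))"
    using H10_integrable_energy[OF assms(1,3)] by simp
  have m: "u \<in> borel_measurable (lebesgue_on U)" "weak_gradient U u \<in> borel_measurable (lebesgue_on U)"
    using H10_has_weak_gradient[OF assms(3)] locally_integrable_measurable[OF assms(1)]
    by (auto simp: has_weak_gradient_def)
  have le: "\<bar>t\<bar> \<le> 1 + t\<^sup>2" for t :: real
  proof -
    have "0 \<le> (\<bar>t\<bar> - 1)\<^sup>2" "0 \<le> t\<^sup>2" by auto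
    moreover have "(\<bar>t\<bar> - 1)\<^sup>2 = t\<^sup>2 - 2 * \<bar>t\<bar> + 1" by (simp add: power2_diff)
    ultimately show ?thesis by linarith
  qed
  show "integrable (lebesgue_on U) u"
  proof (rule Bochner_Integration.integrable_bound[OF i m(1)], rule AE_I2)
    fix x
    show "norm (u x) \<le> norm (1 + ((u x)\<^sup>2 + (norm (weak_gradient U u x))\<^sup>2))"
      using le[of "u x"] zero_le_power2[of "norm (weak_gradient U u x)"] zero_le_power2[of "u x"]
      unfolding real_norm_def by linarith
  qed
  show "integrable (lebesgue_on U) (weak_gradient U u)"
  proof (rule Bochner_Integration.integrable_bound[OF i m(2)], rule AE_I2)
    fix x
    show "norm (weak_gradient U u x) \<le> norm (1 + ((u x)\<^sup>2 + (norm (weak_gradient U u x))\<^sup>2))"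
      using le[of "norm (weak_gradient U u x)"] zero_le_power2[of "norm (weak_gradient U u x)"]
        zero_le_power2[of "u x"]
      unfolding real_norm_def by linarith
  qed
qed

text \<open>If \<open>a\<close> is close to \<open>b\<close>, then \<open>a \<bullet> b\<close> is almost nonnegative. In the proof of Kato's inequality this
  disposes of the term that contains the second derivative of the approximate absolute value.\<close>

lemma inner_ge_minus_square: "a \<bullet> b \<ge> - (norm (a - b))\<^sup>2 / 4" for a b :: "'a::real_inner"
proof -
  have "0 \<le> (norm ((1 / 2) *\<^sub>R (a - b) + b))\<^sup>2" by simp
  also have "\<dots> = a \<bullet> b + (norm (a - b))\<^sup>2 / 4"
    by (simp add: power2_norm_eq_inner inner_simps inner_commute field_simps)
  finally show ?thesis by simp
qed

text \<open>\<open>\<eta>\<close> is a smooth convex approximation of the absolute value and \<open>\<psi> = \<eta>'\<close> approximates the sign. Since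
  \<open>\<psi> 0 = 0\<close>, composing \<open>\<psi>\<close> with a test function gives a test function again.\<close>

lemma smooth_abs_approx:
  fixes \<delta> :: real
  assumes "\<delta> > 0"
  defines "\<eta> \<equiv> \<lambda>t. (t\<^sup>2 + \<delta>\<^sup>2) powr (1 / 2) - \<delta>" and "\<psi> \<equiv> \<lambda>t. (t\<^sup>2 + \<delta>\<^sup>2) powr (- 1 / 2) * t"
    and "\<psi>' \<equiv> \<lambda>t. \<delta>\<^sup>2 * (t\<^sup>2 + \<delta>\<^sup>2) powr (- 3 / 2)"
  shows "(\<eta> has_real_derivative \<psi> t) (at t)" "(\<psi> has_real_derivative \<psi>' t) (at t)"
    "\<bar>\<psi> t\<bar> \<le> 1" "0 \<le> \<psi>' t" "\<psi>' t \<le> 1 / \<delta>" "\<bar>\<bar>s\<bar> - \<eta> t\<bar> \<le> \<bar>s - t\<bar> + \<delta>"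
proof -
  have pos: "t\<^sup>2 + \<delta>\<^sup>2 > 0" for t using assms(1) by (simp add: add_nonneg_pos)
  have sq: "(t\<^sup>2 + \<delta>\<^sup>2) powr (1 / 2) = sqrt (t\<^sup>2 + \<delta>\<^sup>2)" for t
    using pos by (simp add: powr_half_sqrt less_imp_le)
  have sqm: "(t\<^sup>2 + \<delta>\<^sup>2) powr (- 1 / 2) = 1 / sqrt (t\<^sup>2 + \<delta>\<^sup>2)" for t
    using sq powr_minus_divide[of "t\<^sup>2 + \<delta>\<^sup>2" "1 / 2"] by simp
  show "(\<eta> has_real_derivative \<psi> t) (at t)"
    unfolding \<eta>_def \<psi>_def by (rule derivative_eq_intros | use pos[of t] in simp)+
  have "(t\<^sup>2 + \<delta>\<^sup>2) powr (- 1 / 2) = (t\<^sup>2 + \<delta>\<^sup>2) powr (1 + (- 3 / 2))" by simp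
  also have "\<dots> = (t\<^sup>2 + \<delta>\<^sup>2) * (t\<^sup>2 + \<delta>\<^sup>2) powr (- 3 / 2)"
    using pos[of t] by (simp only: powr_add powr_one)
  finally have eq: "(t\<^sup>2 + \<delta>\<^sup>2) powr (- 1 / 2) = (t\<^sup>2 + \<delta>\<^sup>2) * (t\<^sup>2 + \<delta>\<^sup>2) powr (- 3 / 2)" .
  have "(\<psi> has_real_derivative
      ((- 1 / 2) * (t\<^sup>2 + \<delta>\<^sup>2) powr (- 1 / 2 - 1) * (2 * t)) * t + (t\<^sup>2 + \<delta>\<^sup>2) powr (- 1 / 2) * 1) (at t)"
    unfolding \<psi>_def by (rule derivative_eq_intros | use pos[of t] in simp)+
  moreover have "((- 1 / 2) * (t\<^sup>2 + \<delta>\<^sup>2) powr (- 1 / 2 - 1) * (2 * t)) * t + (t\<^sup>2 + \<delta>\<^sup>2) powr (- 1 / 2) * 1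
      = \<psi>' t"
    unfolding eq \<psi>'_def by (simp add: algebra_simps power2_eq_square)
  ultimately show "(\<psi> has_real_derivative \<psi>' t) (at t)" by simp
  have ge_t: "\<bar>t\<bar> \<le> sqrt (t\<^sup>2 + \<delta>\<^sup>2)" and ge_d: "\<delta> \<le> sqrt (t\<^sup>2 + \<delta>\<^sup>2)" for t
    using assms(1) by (auto intro!: real_le_rsqrt)
  show "\<bar>\<psi> t\<bar> \<le> 1"
    unfolding \<psi>_def sqm using ge_t[of t] pos[of t] by (simp add: abs_mult divide_le_eq)
  show "0 \<le> \<psi>' t" by (simp add: \<psi>'_def)
  have "\<psi>' t \<le> (t\<^sup>2 + \<delta>\<^sup>2) * (t\<^sup>2 + \<delta>\<^sup>2) powr (- 3 / 2)"
    unfolding \<psi>'_def by (intro mult_right_mono) auto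
  also have "\<dots> = 1 / sqrt (t\<^sup>2 + \<delta>\<^sup>2)" using eq sqm by simp
  also have "\<dots> \<le> 1 / \<delta>" using ge_d[of t] pos[of t] assms(1) by (intro divide_left_mono mult_pos_pos) auto
  finally show "\<psi>' t \<le> 1 / \<delta>" .
  have "sqrt (t\<^sup>2 + \<delta>\<^sup>2) \<le> \<bar>t\<bar> + \<delta>"
    using assms(1) sqrt_add_le_add_sqrt[of "t\<^sup>2" "\<delta>\<^sup>2"] by simp
  then show "\<bar>\<bar>s\<bar> - \<eta> t\<bar> \<le> \<bar>s - t\<bar> + \<delta>"
    unfolding \<eta>_def sq using ge_t[of t] by linarith
qed

text \<open>The equation is tested with \<open>\<zeta> \<psi>(\<phi>)\<close>, where \<open>\<psi>\<close> approximates the sign and \<open>\<phi>\<close> is a test function close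
  to \<open>u\<close>. This is admissible for every smooth \<open>\<zeta>\<close>, since \<open>\<phi>\<close> supplies the compact support. With
  \<open>\<nabla>u\<close> replaced by \<open>\<nabla>\<phi>\<close>, the left side would be
  \<open>\<integral> \<zeta> \<psi>'(\<phi>) |\<nabla>\<phi>|^2 + \<integral> \<nabla>\<zeta> \<bullet> \<nabla>\<eta>(\<phi>)\<close>, whose first term is nonnegative by convexity of \<open>\<eta>\<close>
  and whose second term becomes \<open>-\<integral> \<eta>(\<phi>) \<Delta>\<zeta>\<close>. One parameter \<open>\<epsilon>\<close> measures both the smoothing of the
  absolute value and the distance of \<open>\<phi>\<close> from \<open>u\<close> in the energy norm; as \<open>\<psi>'\<close> is at most \<open>1 / \<epsilon>\<close> and the
  squared distance at most \<open>\<epsilon>^2\<close>, all errors are of order \<open>\<epsilon>\<close>.\<close>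

lemma kato_test_function_bound:
  fixes u :: "'a::euclidean_space \<Rightarrow> real"
  assumes U: "open U" "bounded U" and sol: "poisson_dirichlet_solution U f u"
    and f: "integrable (lebesgue_on U) f"
    and \<zeta>: "smooth \<zeta>" "\<And>x. x \<in> U \<Longrightarrow> 0 \<le> \<zeta> x"
    and Z0: "0 \<le> Z"
    and Z: "\<And>x. x \<in> U \<Longrightarrow> \<bar>\<zeta> x\<bar> \<le> Z" "\<And>x. x \<in> U \<Longrightarrow> norm (grad \<zeta> x) \<le> Z"
      "\<And>x. x \<in> U \<Longrightarrow> \<bar>laplacian \<zeta> x\<bar> \<le> Z"
    and \<epsilon>: "\<epsilon> > 0"
  shows "- (LINT x|lebesgue_on U. \<bar>u x\<bar> * laplacian \<zeta> x)
    \<le> (LINT x|lebesgue_on U. \<bar>f x\<bar> * \<zeta> x) + \<epsilon> * (Z * (3 * measure lebesgue U + 2))"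
proof -
  let ?M = "lebesgue_on U" and ?g = "weak_gradient U u"
  interpret finite_measure ?M by (rule open_bounded_finite_measure[OF U])
  have u: "H10 U u" using sol by (simp add: poisson_dirichlet_solution_def)
  note ui = H10_integrable[OF U u]
  obtain \<phi> where \<phi>: "test_function U \<phi>"
    and ei: "integrable ?M (\<lambda>x. (u x - \<phi> x)\<^sup>2 + (norm (?g x - grad \<phi> x))\<^sup>2)"
    and ele: "(LINT x|?M. (u x - \<phi> x)\<^sup>2 + (norm (?g x - grad \<phi> x))\<^sup>2) \<le> \<epsilon>\<^sup>2"
    using H10_test_function_approximation[OF U(1) u \<epsilon>] by blast
  let ?err = "\<lambda>x. (u x - \<phi> x)\<^sup>2 + (norm (?g x - grad \<phi> x))\<^sup>2"
  define \<eta> where "\<eta> = (\<lambda>t. (t\<^sup>2 + \<epsilon>\<^sup>2) powr (1 / 2) - \<epsilon>)"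
  define \<psi> where "\<psi> = (\<lambda>t. (t\<^sup>2 + \<epsilon>\<^sup>2) powr (- 1 / 2) * t)"
  define \<psi>' where "\<psi>' = (\<lambda>t. \<epsilon>\<^sup>2 * (t\<^sup>2 + \<epsilon>\<^sup>2) powr (- 3 / 2))"
  have abs_approx: "(\<eta> has_real_derivative \<psi> t) (at t)" "(\<psi> has_real_derivative \<psi>' t) (at t)"
    "\<bar>\<psi> t\<bar> \<le> 1" "0 \<le> \<psi>' t" "\<psi>' t \<le> 1 / \<epsilon>" "\<bar>\<bar>s\<bar> - \<eta> t\<bar> \<le> \<bar>s - t\<bar> + \<epsilon>" for s t
    unfolding \<eta>_def \<psi>_def \<psi>'_def by (rule smooth_abs_approx[OF \<epsilon>])+
  have sm: "smooth \<phi>" by (rule test_function_smooth[OF \<phi>])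
  have pos: "(\<phi> x)\<^sup>2 + \<epsilon>\<^sup>2 > 0" for x using \<epsilon> by (simp add: add_nonneg_pos)
  have smq: "smooth (\<lambda>x. ((\<phi> x)\<^sup>2 + \<epsilon>\<^sup>2) powr a)" for a
    using pos sm by (intro smooth_powr) (auto simp: power2_eq_square intro!: smooth_add smooth_mult)
  define P where "P = (\<lambda>x. \<psi> (\<phi> x))"
  define E where "E = (\<lambda>x. \<eta> (\<phi> x))"
  define w where "w = (\<lambda>x. \<zeta> x * P x)"
  obtain K where K: "compact K" "K \<subseteq> U" "\<And>x. x \<notin> K \<Longrightarrow> \<phi> x = 0"
    using \<phi> unfolding test_function_iff by blast
  have testP: "test_function U P"
    unfolding P_def \<psi>_def by (rule test_function_mult[OF smq \<phi>])
  have testE: "test_function U E"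
  proof (rule test_functionI[OF _ K(1,2)])
    show "smooth E" unfolding E_def \<eta>_def by (intro smooth_diff smq smooth_const)
    show "E x = 0" if "x \<notin> K" for x
      using K(3)[OF that] \<epsilon> by (simp add: E_def \<eta>_def powr_half_sqrt)
  qed
  have testw: "test_function U w" unfolding w_def by (rule test_function_mult[OF \<zeta>(1) testP])
  have gradP: "grad P x = \<psi>' (\<phi> x) *\<^sub>R grad \<phi> x" for x
    unfolding P_def by (rule grad_chain[where h = \<psi> and f = \<phi>, OF abs_approx(2) sm])
  have gradE: "grad E x = P x *\<^sub>R grad \<phi> x" for x
    unfolding P_def E_def by (rule grad_chain[where h = \<eta> and f = \<phi>, OF abs_approx(1) sm])
  have gradw: "grad w x = \<zeta> x *\<^sub>R (\<psi>' (\<phi> x) *\<^sub>R grad \<phi> x) + P x *\<^sub>R grad \<zeta> x" for x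
    unfolding w_def grad_mult[OF \<zeta>(1) test_function_smooth[OF testP]] gradP ..
  define q where "q = (\<lambda>x. norm (?g x - grad \<phi> x))"
  define r where "r = (\<lambda>x. \<bar>u x - \<phi> x\<bar>)"
  note green = green_identity_test[OF U(1) \<zeta>(1) testE]
  have young: "t \<le> \<epsilon> + t\<^sup>2 / \<epsilon>" for t :: real
  proof -
    have "\<epsilon> * t \<le> \<epsilon> * \<epsilon> + t\<^sup>2"
    proof (cases "t \<ge> 0")
      case True
      then have "0 \<le> (t - \<epsilon>)\<^sup>2 + \<epsilon> * t" using \<epsilon> by simp
      then show ?thesis by (simp add: power2_eq_square algebra_simps)
    next
      case False
      then have "\<epsilon> * t \<le> 0" using \<epsilon> by (simp add: mult_nonneg_nonpos)
      moreover have "0 \<le> \<epsilon> * \<epsilon> + t\<^sup>2" by simp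
      ultimately show ?thesis by linarith
    qed
    then show ?thesis using \<epsilon> by (simp add: field_simps power2_eq_square)
  qed
  \<comment> \<open>\<open>D\<close> dominates pointwise all errors made by passing between \<open>u\<close> and \<open>\<phi>\<close>; the inequality
    \<open>t \<le> \<epsilon> + t^2 / \<epsilon>\<close> reduces the errors of first order to quadratic ones.\<close>
  define D where "D = (\<lambda>x. 3 * \<epsilon> + 2 / \<epsilon> * ?err x)"
  have Di: "integrable ?M D"
    unfolding D_def by (intro Bochner_Integration.integrable_add integrable_const integrable_mult_right ei)
  have Dle: "(LINT x|?M. D x) \<le> 3 * \<epsilon> * measure lebesgue U + 2 * \<epsilon>"
  proof -
    have "(LINT x|?M. D x) = (LINT x|?M. 3 * \<epsilon>)
        + 2 / \<epsilon> * (LINT x|?M. ?err x)"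
      unfolding D_def by (simp only: Bochner_Integration.integral_add[OF integrable_const integrable_mult_right[OF ei]]
          integral_mult_right_zero)
    also have "(LINT x|?M. 3 * \<epsilon>) = 3 * \<epsilon> * measure lebesgue U"
      using U(1) by (simp add: measure_restrict_space)
    also have "3 * \<epsilon> * measure lebesgue U + 2 / \<epsilon> * (LINT x|?M. ?err x)
        \<le> 3 * \<epsilon> * measure lebesgue U + 2 / \<epsilon> * \<epsilon>\<^sup>2"
      using ele \<epsilon> by (intro add_left_mono mult_left_mono) auto
    also have "2 / \<epsilon> * \<epsilon>\<^sup>2 = 2 * \<epsilon>" using \<epsilon> by (simp add: power2_eq_square)
    finally show ?thesis .
  qed
  have pw: "- (\<bar>u x\<bar> * laplacian \<zeta> x)
      \<le> \<bar>f x\<bar> * \<zeta> x - f x * w x + ?g x \<bullet> grad w x - grad \<zeta> x \<bullet> grad E x - laplacian \<zeta> x * E x + Z * D x"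
    if x: "x \<in> U" for x
  proof -
    have a: "f x * w x \<le> \<bar>f x\<bar> * \<zeta> x"
    proof -
      have "f x * w x = \<zeta> x * (f x * P x)" by (simp add: w_def)
      also have "\<dots> \<le> \<zeta> x * (\<bar>f x\<bar> * 1)"
      proof (rule mult_left_mono[OF _ \<zeta>(2)[OF x]])
        have "f x * P x \<le> \<bar>f x\<bar> * \<bar>P x\<bar>" by (metis abs_ge_self abs_mult)
        also have "\<dots> \<le> \<bar>f x\<bar> * 1" unfolding P_def by (intro mult_left_mono abs_approx(3)) simp
        finally show "f x * P x \<le> \<bar>f x\<bar> * 1" .
      qed
      finally show ?thesis by (simp add: mult.commute)
    qed
    have b: "?g x \<bullet> grad w x - grad \<zeta> x \<bullet> grad E x \<ge> - (Z * ((q x)\<^sup>2 / \<epsilon>)) - Z * q x"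
    proof -
      have eq: "?g x \<bullet> grad w x - grad \<zeta> x \<bullet> grad E x
          = \<zeta> x * \<psi>' (\<phi> x) * (?g x \<bullet> grad \<phi> x) + P x * ((?g x - grad \<phi> x) \<bullet> grad \<zeta> x)"
        unfolding gradw gradE by (simp add: algebra_simps inner_commute)
      have "\<zeta> x * \<psi>' (\<phi> x) * (?g x \<bullet> grad \<phi> x) \<ge> \<zeta> x * \<psi>' (\<phi> x) * (- (q x)\<^sup>2 / 4)"
        unfolding q_def using \<zeta>(2)[OF x] abs_approx(4) inner_ge_minus_square[of "?g x" "grad \<phi> x"]
        by (intro mult_left_mono) auto
      moreover have "\<zeta> x * \<psi>' (\<phi> x) * ((q x)\<^sup>2 / 4) \<le> Z * (1 / \<epsilon>) * (q x)\<^sup>2"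
        using Z(1)[OF x] \<zeta>(2)[OF x] abs_approx(4,5)[of "\<phi> x"] Z0 \<epsilon>
        by (intro mult_mono) auto
      moreover have "\<bar>P x * ((?g x - grad \<phi> x) \<bullet> grad \<zeta> x)\<bar> \<le> 1 * (q x * Z)"
        unfolding abs_mult
      proof (rule mult_mono)
        show "\<bar>P x\<bar> \<le> 1" unfolding P_def by (rule abs_approx(3))
        have "\<bar>(?g x - grad \<phi> x) \<bullet> grad \<zeta> x\<bar> \<le> norm (?g x - grad \<phi> x) * norm (grad \<zeta> x)"
          by (rule Cauchy_Schwarz_ineq2)
        also have "\<dots> \<le> q x * Z" unfolding q_def using Z(2)[OF x] by (intro mult_left_mono) auto
        finally show "\<bar>(?g x - grad \<phi> x) \<bullet> grad \<zeta> x\<bar> \<le> q x * Z" .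
      qed auto
      ultimately show ?thesis unfolding eq by (simp add: mult.commute)
    qed
    have c: "- (\<bar>u x\<bar> * laplacian \<zeta> x) \<le> - (laplacian \<zeta> x * E x) + Z * (r x + \<epsilon>)"
    proof -
      have "\<bar>(\<bar>u x\<bar> - E x) * laplacian \<zeta> x\<bar> \<le> (r x + \<epsilon>) * Z"
        unfolding abs_mult E_def r_def using Z(3)[OF x] \<epsilon> abs_approx(6)[of "u x" "\<phi> x"]
        by (intro mult_mono) auto
      then show ?thesis by (simp add: algebra_simps abs_le_iff)
    qed
    have d: "(q x)\<^sup>2 / \<epsilon> + q x + (r x + \<epsilon>) \<le> D x"
    proof -
      have "D x = 3 * \<epsilon> + 2 * ((r x)\<^sup>2 / \<epsilon>) + 2 * ((q x)\<^sup>2 / \<epsilon>)"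
        by (simp add: D_def q_def r_def algebra_simps)
      moreover have "0 \<le> (r x)\<^sup>2 / \<epsilon>" using \<epsilon> by simp
      ultimately show ?thesis using young[of "q x"] young[of "r x"] by linarith
    qed
    have "Z * ((q x)\<^sup>2 / \<epsilon>) + Z * q x + Z * (r x + \<epsilon>) = Z * ((q x)\<^sup>2 / \<epsilon> + q x + (r x + \<epsilon>))"
      by (simp add: algebra_simps)
    also have "\<dots> \<le> Z * D x" by (rule mult_left_mono[OF d Z0])
    finally show ?thesis using a b c by linarith
  qed
  have meas: "\<zeta> \<in> borel_measurable ?M" "laplacian \<zeta> \<in> borel_measurable ?M" "w \<in> borel_measurable ?M"
    "grad w \<in> borel_measurable ?M"
    by (intro continuous_measurable_lebesgue_on U(1) smooth_continuous grad_continuous smooth_laplacian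
        \<zeta>(1) test_function_smooth[OF testw])+
  obtain B where B: "B \<ge> 0" "\<And>x. x \<in> U \<Longrightarrow> norm (w x) \<le> B"
    using continuous_bounded_on_bounded[OF U(2) smooth_continuous[OF test_function_smooth[OF testw]]] by blast
  obtain B' where B': "B' > 0" "\<And>x. norm (grad w x) \<le> B'"
    using test_function_grad_bounded[OF testw] by blast
  have i1: "integrable ?M (\<lambda>x. \<bar>f x\<bar> * \<zeta> x)"
    by (rule integrable_mult_bounded[of _ _ _ Z]) (use f Z(1) meas in auto)
  have i2: "integrable ?M (\<lambda>x. f x * w x)"
    by (rule integrable_mult_bounded[of _ _ _ B]) (use f B(2) meas in auto)
  have i3: "integrable ?M (\<lambda>x. ?g x \<bullet> grad w x)"
  proof (rule Bochner_Integration.integrable_bound[OF integrable_mult_right[OF integrable_norm[OF ui(2)], of B']])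
    show "(\<lambda>x. ?g x \<bullet> grad w x) \<in> borel_measurable ?M" using ui(2) meas by measurable
    have "\<bar>?g x \<bullet> grad w x\<bar> \<le> B' * norm (?g x)" for x
    proof -
      have "\<bar>?g x \<bullet> grad w x\<bar> \<le> norm (?g x) * norm (grad w x)" by (rule Cauchy_Schwarz_ineq2)
      also have "\<dots> \<le> norm (?g x) * B'" using B'(2) by (intro mult_left_mono) auto
      finally show ?thesis by (simp add: mult.commute)
    qed
    then show "AE x in ?M. norm (?g x \<bullet> grad w x) \<le> norm (B' * norm (?g x))"
      using B'(1) by (intro AE_I2) auto
  qed
  have i4: "integrable ?M (\<lambda>x. \<bar>u x\<bar> * laplacian \<zeta> x)"
    by (rule integrable_mult_bounded[of _ _ _ Z]) (use ui(1) Z(3) meas in auto)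
  have "- (LINT x|?M. \<bar>u x\<bar> * laplacian \<zeta> x) = (LINT x|?M. - (\<bar>u x\<bar> * laplacian \<zeta> x))"
    by simp
  also have "\<dots> \<le> (LINT x|?M. \<bar>f x\<bar> * \<zeta> x - f x * w x + ?g x \<bullet> grad w x - grad \<zeta> x \<bullet> grad E x
      - laplacian \<zeta> x * E x + Z * D x)"
    using i1 i2 i3 i4 green Di pw
    by (intro integral_mono) (auto intro!: Bochner_Integration.integrable_add Bochner_Integration.integrable_diff)
  also have "\<dots> = (LINT x|?M. \<bar>f x\<bar> * \<zeta> x) - (LINT x|?M. f x * w x) + (LINT x|?M. ?g x \<bullet> grad w x)
      - (LINT x|?M. grad \<zeta> x \<bullet> grad E x) - (LINT x|?M. laplacian \<zeta> x * E x) + Z * (LINT x|?M. D x)"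
    using i1 i2 i3 green Di by simp
  also have "\<dots> = (LINT x|?M. \<bar>f x\<bar> * \<zeta> x) + Z * (LINT x|?M. D x)"
    using poisson_dirichlet_test[OF U(1) sol testw] green(3) by simp
  also have "\<dots> \<le> (LINT x|?M. \<bar>f x\<bar> * \<zeta> x) + Z * (3 * \<epsilon> * measure lebesgue U + 2 * \<epsilon>)"
    using Dle Z0 by (intro add_left_mono mult_left_mono) auto
  finally show ?thesis by (simp add: algebra_simps)
qed

text \<open>Formally \<open>-\<Delta>|u| \<le> |f|\<close>. Although \<open>\<zeta>\<close> may be positive on the boundary, no boundary term is left: in Green's
  formula it would be the integral of \<open>\<zeta>\<close> times the inner normal derivative of \<open>|u|\<close>, and this derivative is nonnegative
  because \<open>|u|\<close> attains its minimum there.\<close>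

theorem kato_inequality:
  fixes u :: "'a::euclidean_space \<Rightarrow> real"
  assumes U: "open U" "bounded U" and sol: "poisson_dirichlet_solution U f u"
    and f: "integrable (lebesgue_on U) f"
    and \<zeta>: "smooth \<zeta>" "\<And>x. x \<in> U \<Longrightarrow> 0 \<le> \<zeta> x"
  shows "- (LINT x|lebesgue_on U. \<bar>u x\<bar> * laplacian \<zeta> x) \<le> (LINT x|lebesgue_on U. \<bar>f x\<bar> * \<zeta> x)"
proof -
  obtain A where A: "A \<ge> 0" "\<And>x. x \<in> U \<Longrightarrow> norm (\<zeta> x) \<le> A"
    using continuous_bounded_on_bounded[OF U(2) smooth_continuous[OF \<zeta>(1)]] by blast
  obtain B where B: "B \<ge> 0" "\<And>x. x \<in> U \<Longrightarrow> norm (grad \<zeta> x) \<le> B"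
    using continuous_bounded_on_bounded[OF U(2) grad_continuous[OF \<zeta>(1)]] by blast
  obtain C where C: "C \<ge> 0" "\<And>x. x \<in> U \<Longrightarrow> norm (laplacian \<zeta> x) \<le> C"
    using continuous_bounded_on_bounded[OF U(2) smooth_continuous[OF smooth_laplacian[OF \<zeta>(1)]]] by blast
  define Z where "Z = A + B + C"
  have Z: "\<bar>\<zeta> x\<bar> \<le> Z" "norm (grad \<zeta> x) \<le> Z" "\<bar>laplacian \<zeta> x\<bar> \<le> Z" if "x \<in> U" for x
    using A B C A(2)[OF that] B(2)[OF that] C(2)[OF that] by (auto simp: Z_def)
  define c where "c = Z * (3 * measure lebesgue U + 2)"
  have Z0: "0 \<le> Z" using A(1) B(1) C(1) by (simp add: Z_def)
  then have c: "c \<ge> 0" by (simp add: c_def)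
  show ?thesis
  proof (rule field_le_epsilon)
    fix e :: real assume "e > 0"
    define \<epsilon> where "\<epsilon> = e / (c + 1)"
    have "\<epsilon> > 0" using \<open>e > 0\<close> c by (simp add: \<epsilon>_def)
    from kato_test_function_bound[OF U sol f \<zeta> Z0 Z this]
    have "- (LINT x|lebesgue_on U. \<bar>u x\<bar> * laplacian \<zeta> x) \<le> (LINT x|lebesgue_on U. \<bar>f x\<bar> * \<zeta> x) + \<epsilon> * c"
      by (simp add: c_def)
    moreover have "\<epsilon> * c \<le> e" using c \<open>e > 0\<close> by (simp add: \<epsilon>_def field_simps)
    ultimately show "- (LINT x|lebesgue_on U. \<bar>u x\<bar> * laplacian \<zeta> x) \<le> (LINT x|lebesgue_on U. \<bar>f x\<bar> * \<zeta> x) + e"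
      by linarith
  qed
qed

section \<open>The Plummer kernel\<close>

lemma partial_cmult:
  "f differentiable at x \<Longrightarrow> partial e (\<lambda>x. c * f x) x = c * partial e f x"
  by (subst partial_mult) auto

text \<open>Powers of the softened squared distance \<open>|x - p|^2 + \<epsilon>^2\<close>. For \<open>a = - 1 / 2\<close> this is, up to a constant factor,
  the Newtonian potential in three dimensions softened as in the Plummer model of stellar dynamics. The derivatives
  stay in the family, up to linear factors.\<close>

definition plummer :: "real \<Rightarrow> real \<Rightarrow> 'a::euclidean_space \<Rightarrow> 'a \<Rightarrow> real" where
  "plummer a \<epsilon> p x = ((norm (x - p))\<^sup>2 + \<epsilon>\<^sup>2) powr a"

lemma plummer_base_pos: "\<epsilon> > 0 \<Longrightarrow> (norm (x - p))\<^sup>2 + \<epsilon>\<^sup>2 > 0"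
  by (simp add: add_nonneg_pos)

lemma plummer_nonneg: "0 \<le> plummer a \<epsilon> p x"
  by (simp add: plummer_def)

lemma plummer_commute: "plummer a \<epsilon> p x = plummer a \<epsilon> x p"
  by (simp add: plummer_def norm_minus_commute)

lemma smooth_plummer: "\<epsilon> > 0 \<Longrightarrow> smooth (plummer a \<epsilon> p)"
  unfolding plummer_def[abs_def]
  by (intro smooth_powr smooth_add smooth_norm_sq smooth_const plummer_base_pos)

lemma partial_plummer:
  assumes "\<epsilon> > 0"
  shows "partial e (plummer a \<epsilon> p) x = 2 * a * ((x - p) \<bullet> e) * plummer (a - 1) \<epsilon> p x"
proof -
  let ?Q = "\<lambda>x. (norm (x - p))\<^sup>2 + \<epsilon>\<^sup>2"
  have d: "(\<lambda>x. (norm (x - p))\<^sup>2) differentiable at x" for x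
    using smooth_norm_sq smooth_differentiable by blast
  have "partial e ?Q x = 2 * ((x - p) \<bullet> e)"
    using d by (simp add: partial_add partial_norm_sq)
  moreover have "((\<lambda>t. t powr a) has_real_derivative a * ?Q x powr (a - 1)) (at (?Q x))"
    using plummer_base_pos[OF assms, of x p] by (rule has_real_derivative_powr)
  ultimately show ?thesis
    using partial_chain[of "\<lambda>t. t powr a" _ ?Q x e] d
    by (simp add: plummer_def[abs_def] differentiable_add)
qed

lemma grad_plummer:
  "\<epsilon> > 0 \<Longrightarrow> grad (plummer a \<epsilon> p) x = (2 * a * plummer (a - 1) \<epsilon> p x) *\<^sub>R (x - p)"
  by (intro grad_eqI) (simp add: partial_plummer)

lemma plummer_add_1: "\<epsilon> > 0 \<Longrightarrow> plummer (a + 1) \<epsilon> p x = ((norm (x - p))\<^sup>2 + \<epsilon>\<^sup>2) * plummer a \<epsilon> p x"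
  using plummer_base_pos[of \<epsilon> x p] by (simp add: plummer_def powr_add)

text \<open>In dimension three the coefficient \<open>2 a (2 a + 1)\<close> vanishes for \<open>a = - 1 / 2\<close>; then only a concentrated and
  integrable term is left.\<close>

lemma laplacian_plummer:
  fixes p :: "real^3"
  assumes "\<epsilon> > 0"
  shows "laplacian (plummer a \<epsilon> p) x
    = 2 * a * (2 * a + 1) * plummer (a - 1) \<epsilon> p x - 4 * a * (a - 1) * \<epsilon>\<^sup>2 * plummer (a - 2) \<epsilon> p x"
proof -
  have lin: "smooth (\<lambda>x. (x - p) \<bullet> e)" for e
    unfolding inner_diff_left by (intro smooth_intros)
  have plin: "partial e (\<lambda>x. (x - p) \<bullet> e) x = e \<bullet> e" for e x :: "real^3"
  proof -
    have "((\<lambda>x. (x - p) \<bullet> e) has_derivative (\<lambda>v. v \<bullet> e)) (at x)"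
      by (auto intro!: derivative_eq_intros)
    from partial_eqI[OF this] show ?thesis by simp
  qed
  have "partial e (partial e (plummer a \<epsilon> p)) x
      = 2 * a * (plummer (a - 1) \<epsilon> p x + 2 * (a - 1) * ((x - p) \<bullet> e)\<^sup>2 * plummer (a - 2) \<epsilon> p x)"
    if "e \<in> Basis" for e
  proof -
    have "partial e (plummer a \<epsilon> p) = (\<lambda>x. (2 * a) * (((x - p) \<bullet> e) * plummer (a - 1) \<epsilon> p x))"
      by (auto simp: partial_plummer[OF assms])
    moreover have "partial e (\<lambda>x. (2 * a) * (((x - p) \<bullet> e) * plummer (a - 1) \<epsilon> p x)) x
        = (2 * a) * (((x - p) \<bullet> e) * partial e (plummer (a - 1) \<epsilon> p) x + (e \<bullet> e) * plummer (a - 1) \<epsilon> p x)"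
      by (subst partial_cmult, rule smooth_differentiable, intro smooth_mult lin smooth_plummer[OF assms],
          subst partial_mult[OF smooth_differentiable[OF lin] smooth_differentiable[OF smooth_plummer[OF assms]]])
         (simp add: plin)
    ultimately show ?thesis
      using that by (simp add: partial_plummer[OF assms] power2_eq_square algebra_simps)
  qed
  then have "laplacian (plummer a \<epsilon> p) x
      = (\<Sum>e\<in>(Basis::(real^3) set). 2 * a * plummer (a - 1) \<epsilon> p x
          + (4 * a * (a - 1) * plummer (a - 2) \<epsilon> p x) * ((x - p) \<bullet> e)\<^sup>2)"
    unfolding laplacian_def by (intro sum.cong) (auto simp: algebra_simps)
  also have "\<dots> = 3 * (2 * a * plummer (a - 1) \<epsilon> p x)
      + (4 * a * (a - 1) * plummer (a - 2) \<epsilon> p x) * (\<Sum>e\<in>(Basis::(real^3) set). ((x - p) \<bullet> e)\<^sup>2)"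
    by (simp add: sum.distrib sum_distrib_left)
  also have "(\<Sum>e\<in>(Basis::(real^3) set). ((x - p) \<bullet> e)\<^sup>2) = (norm (x - p))\<^sup>2"
    by (subst power2_norm_eq_inner, subst euclidean_inner) (simp add: power2_eq_square)
  finally have *: "laplacian (plummer a \<epsilon> p) x = 3 * (2 * a * plummer (a - 1) \<epsilon> p x)
      + (4 * a * (a - 1) * plummer (a - 2) \<epsilon> p x) * (norm (x - p))\<^sup>2" .
  have "plummer (a - 1) \<epsilon> p x = ((norm (x - p))\<^sup>2 + \<epsilon>\<^sup>2) * plummer (a - 2) \<epsilon> p x"
    using plummer_add_1[OF assms, of "a - 2" p x] by simp
  then show ?thesis unfolding * by (simp add: algebra_simps)
qed

text \<open>Minus the Laplacian of the softened Newtonian kernel. These functions are positive and form, up to the constant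
  \<open>mollifier_mass\<close>, an approximate identity as \<open>\<epsilon>\<close> tends to zero.\<close>

definition mollifier :: "real \<Rightarrow> 'a::euclidean_space \<Rightarrow> 'a \<Rightarrow> real" where
  "mollifier \<epsilon> p x = 3 * \<epsilon>\<^sup>2 * plummer (- 5 / 2) \<epsilon> p x"

lemma smooth_mollifier: "\<epsilon> > 0 \<Longrightarrow> smooth (mollifier \<epsilon> p)"
  unfolding mollifier_def[abs_def] by (intro smooth_cmult smooth_plummer)

lemma mollifier_nonneg: "0 \<le> mollifier \<epsilon> p x"
  by (simp add: mollifier_def plummer_nonneg)

lemma laplacian_newton:
  fixes p :: "real^3"
  assumes "\<epsilon> > 0"
  shows "laplacian (plummer (- 1 / 2) \<epsilon> p) x = - mollifier \<epsilon> p x"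
  by (simp add: laplacian_plummer[OF assms] mollifier_def)

text \<open>The partial derivative of \<open>plummer (- 1 / 2) \<epsilon> p\<close> in direction \<open>e\<close>.\<close>

definition newton_deriv :: "'a::euclidean_space \<Rightarrow> real \<Rightarrow> 'a \<Rightarrow> 'a \<Rightarrow> real" where
  "newton_deriv e \<epsilon> p x = ((p - x) \<bullet> e) * plummer (- 3 / 2) \<epsilon> p x"

lemma smooth_lin: "smooth (\<lambda>x. (p - x) \<bullet> e)"
  unfolding inner_diff_left by (intro smooth_intros)

lemma partial_lin: "partial v (\<lambda>x. (p - x) \<bullet> e) = (\<lambda>x. - (v \<bullet> e))"
proof
  fix x
  have "((\<lambda>x. (p - x) \<bullet> e) has_derivative (\<lambda>v. - (v \<bullet> e))) (at x)"
    by (auto intro!: derivative_eq_intros)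
  from partial_eqI[OF this] show "partial v (\<lambda>x. (p - x) \<bullet> e) x = - (v \<bullet> e)" by simp
qed

lemma grad_lin: "grad (\<lambda>x. (p - x) \<bullet> e) x = - e"
  by (rule grad_eqI) (simp only: partial_lin inner_minus_left inner_commute[of e])

lemma laplacian_lin: "laplacian (\<lambda>x. (p - x) \<bullet> e) x = 0"
  by (simp add: laplacian_def partial_lin)

lemma smooth_newton_deriv: "\<epsilon> > 0 \<Longrightarrow> smooth (newton_deriv e \<epsilon> p)"
  unfolding newton_deriv_def[abs_def] by (intro smooth_mult smooth_lin smooth_plummer)

text \<open>The Laplacian commutes with the partial derivative, which is checked here by computing both sides.\<close>

lemma laplacian_newton_deriv:
  fixes p :: "real^3"
  assumes "\<epsilon> > 0"
  shows "laplacian (newton_deriv e \<epsilon> p) x = - partial e (mollifier \<epsilon> p) x"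
proof -
  have "partial e (mollifier \<epsilon> p) x = 3 * \<epsilon>\<^sup>2 * partial e (plummer (- 5 / 2) \<epsilon> p) x"
    unfolding mollifier_def[abs_def]
    by (rule partial_cmult[OF smooth_differentiable[OF smooth_plummer[OF assms]]])
  then have "partial e (mollifier \<epsilon> p) x = - 15 * \<epsilon>\<^sup>2 * ((x - p) \<bullet> e) * plummer (- 7 / 2) \<epsilon> p x"
    by (simp add: partial_plummer[OF assms])
  moreover have "laplacian (newton_deriv e \<epsilon> p) x
      = 15 * \<epsilon>\<^sup>2 * ((x - p) \<bullet> e) * plummer (- 7 / 2) \<epsilon> p x"
    unfolding newton_deriv_def[abs_def]
    by (subst laplacian_mult[OF smooth_lin smooth_plummer[OF assms]])
       (simp only: laplacian_lin grad_lin grad_plummer[OF assms] laplacian_plummer[OF assms],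
        simp add: inner_diff_left inner_diff_right inner_commute algebra_simps)
  ultimately show ?thesis by simp
qed

lemma square_powr: "0 < s \<Longrightarrow> (s\<^sup>2) powr a = s powr (2 * a)" for s :: real
proof -
  assume "0 < s"
  then have "(s\<^sup>2) powr a = (s powr 2) powr a" by simp
  then show ?thesis by (simp only: powr_powr)
qed

lemma plummer_le:
  assumes "\<epsilon> > 0" "s > 0" "s \<le> norm (x - p)" "a \<ge> 0"
  shows "plummer (- a) \<epsilon> p x \<le> s powr (- 2 * a)"
proof -
  have "s\<^sup>2 \<le> (norm (x - p))\<^sup>2" using assms by (intro power_mono) auto
  then have "s\<^sup>2 \<le> (norm (x - p))\<^sup>2 + \<epsilon>\<^sup>2" using zero_le_power2[of \<epsilon>] by linarith
  then have "plummer (- a) \<epsilon> p x \<le> (s\<^sup>2) powr (- a)"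
    unfolding plummer_def using assms by (intro powr_mono2') auto
  also have "(s\<^sup>2) powr (- a) = s powr (- 2 * a)"
    using square_powr[OF assms(2), of "- a"] by simp
  finally show ?thesis .
qed

lemma newton_deriv_le:
  assumes "\<epsilon> > 0" "norm e = 1" "x \<noteq> p"
  shows "\<bar>newton_deriv e \<epsilon> p x\<bar> \<le> 1 / (norm (x - p))\<^sup>2"
proof -
  let ?s = "norm (x - p)"
  have s: "?s > 0" using assms(3) by simp
  have "\<bar>(p - x) \<bullet> e\<bar> \<le> ?s"
    using Cauchy_Schwarz_ineq2[of "p - x" e] assms(2) by (simp add: norm_minus_commute)
  moreover have "plummer (- 3 / 2) \<epsilon> p x \<le> ?s powr (- 3)"
    using plummer_le[OF assms(1) s order_refl, of "3 / 2"] by simp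
  ultimately have "\<bar>newton_deriv e \<epsilon> p x\<bar> \<le> ?s * ?s powr (- 3)"
    unfolding newton_deriv_def abs_mult by (intro mult_mono) (auto simp: plummer_nonneg)
  also have "\<dots> = 1 / ?s\<^sup>2"
    using s by (simp add: powr_neg_numeral power2_eq_square power3_eq_cube)
  finally show ?thesis .
qed

lemma grad_newton_deriv_le:
  fixes p :: "'a::euclidean_space"
  assumes "\<epsilon> > 0" "norm e = 1" "s > 0" "s \<le> norm (x - p)"
  shows "norm (grad (newton_deriv e \<epsilon> p) x) \<le> 4 * s powr (- 3)"
proof -
  have g: "grad (newton_deriv e \<epsilon> p) x
      = ((p - x) \<bullet> e * (-3) * plummer (- 5 / 2) \<epsilon> p x) *\<^sub>R (x - p) - plummer (- 3 / 2) \<epsilon> p x *\<^sub>R e"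
    unfolding newton_deriv_def[abs_def]
    by (subst grad_mult[OF smooth_lin smooth_plummer[OF assms(1)]])
       (simp add: grad_lin grad_plummer[OF assms(1)])
  have "plummer (- 3 / 2) \<epsilon> p x = ((norm (x - p))\<^sup>2 + \<epsilon>\<^sup>2) * plummer (- 5 / 2) \<epsilon> p x"
    using plummer_add_1[OF assms(1), of "- 5 / 2" p x] by simp
  moreover have "(norm (x - p))\<^sup>2 * plummer (- 5 / 2) \<epsilon> p x \<le> ((norm (x - p))\<^sup>2 + \<epsilon>\<^sup>2) * plummer (- 5 / 2) \<epsilon> p x"
    by (intro mult_right_mono) (auto simp: plummer_nonneg)
  ultimately have b: "(norm (x - p))\<^sup>2 * plummer (- 5 / 2) \<epsilon> p x \<le> plummer (- 3 / 2) \<epsilon> p x" by simp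
  have cs: "\<bar>(p - x) \<bullet> e\<bar> \<le> norm (x - p)"
    using Cauchy_Schwarz_ineq2[of "p - x" e] assms(2) by (simp add: norm_minus_commute)
  have "norm (((p - x) \<bullet> e * (-3) * plummer (- 5 / 2) \<epsilon> p x) *\<^sub>R (x - p))
      = 3 * (\<bar>(p - x) \<bullet> e\<bar> * (plummer (- 5 / 2) \<epsilon> p x * norm (x - p)))"
    by (simp add: abs_mult plummer_nonneg)
  also have "\<dots> \<le> 3 * (norm (x - p) * (plummer (- 5 / 2) \<epsilon> p x * norm (x - p)))"
    using cs by (intro mult_left_mono mult_right_mono) (auto simp: plummer_nonneg)
  also have "\<dots> \<le> 3 * plummer (- 3 / 2) \<epsilon> p x"
    using b by (simp add: power2_eq_square mult_ac)
  finally have c: "norm (((p - x) \<bullet> e * (-3) * plummer (- 5 / 2) \<epsilon> p x) *\<^sub>R (x - p)) \<le> 3 * plummer (- 3 / 2) \<epsilon> p x" .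
  have d: "norm (plummer (- 3 / 2) \<epsilon> p x *\<^sub>R e) = plummer (- 3 / 2) \<epsilon> p x"
    using assms(2) by (simp add: plummer_nonneg)
  have "norm (grad (newton_deriv e \<epsilon> p) x) \<le> 4 * plummer (- 3 / 2) \<epsilon> p x"
    unfolding g using c d norm_triangle_ineq4[of "((p - x) \<bullet> e * (-3) * plummer (- 5 / 2) \<epsilon> p x) *\<^sub>R (x - p)"
        "plummer (- 3 / 2) \<epsilon> p x *\<^sub>R e"] by linarith
  also have "plummer (- 3 / 2) \<epsilon> p x \<le> s powr (- 3)"
    using plummer_le[OF assms(1,3,4), of "3 / 2"] by simp
  finally show ?thesis by simp
qed

lemma mollifier_le:
  assumes "\<epsilon> > 0" "s > 0" "s \<le> norm (x - p)"
  shows "mollifier \<epsilon> p x \<le> 3 * \<epsilon>\<^sup>2 * s powr (- 5)"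
  unfolding mollifier_def using plummer_le[OF assms, of "5 / 2"] by (intro mult_left_mono) auto

section \<open>Integrals of the kernels\<close>

lemma term_le_suminf_ennreal: "f k \<le> (\<Sum>k. f k :: ennreal)"
  using sum_le_suminf[of f "{k}"] by simp

lemma nn_integral_ball_series:
  fixes p :: "real^3"
  assumes "\<And>k. a k \<ge> 0" "\<And>k. r k \<ge> 0"
  shows "(\<integral>\<^sup>+x. (\<Sum>k. ennreal (a k) * indicator (ball p (r k)) x) \<partial>lborel)
    = (\<Sum>k. ennreal (a k * (unit_ball_vol 3 * r k ^ 3)))"
proof -
  have "(\<integral>\<^sup>+x. (\<Sum>k. ennreal (a k) * indicator (ball p (r k)) x) \<partial>lborel)
      = (\<Sum>k. \<integral>\<^sup>+x. ennreal (a k) * indicator (ball p (r k)) x \<partial>lborel)"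
    by (rule nn_integral_suminf) (intro borel_measurable_times_ennreal borel_measurable_const
        borel_measurable_indicator, simp add: borel_open)
  also have "\<dots> = (\<Sum>k. ennreal (a k * (unit_ball_vol 3 * r k ^ 3)))"
    using assms by (simp add: nn_integral_cmult_indicator borel_open emeasure_ball ennreal_mult')
  finally show ?thesis .
qed

text \<open>In the dyadic shell between the radii \<open>h 2^(-k-1)\<close> and \<open>h 2^(-k)\<close> the integrand is at most
  \<open>4^(k+1) / h^2\<close>, while the volume is of order \<open>h^3 8^(-k)\<close>; the sum over all shells is a geometric series.\<close>

lemma nn_integral_inverse_square_ball:
  fixes p :: "real^3"
  assumes "h > 0"
  shows "(\<integral>\<^sup>+x. ennreal (indicator (ball p h) x / (norm (x - p))\<^sup>2) \<partial>lborel)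
    \<le> ennreal (8 * unit_ball_vol 3 * h)"
proof -
  define r where "r = (\<lambda>k::nat. h * (1 / 2) ^ k)"
  define c where "c = (\<lambda>k::nat. 4 * 4 ^ k / h\<^sup>2)"
  have r: "r k > 0" for k using assms by (simp add: r_def)
  have c: "c k \<ge> 0" for k by (simp add: c_def)
  have pw: "ennreal (indicator (ball p h) x / (norm (x - p))\<^sup>2)
      \<le> (\<Sum>k. ennreal (c k) * indicator (ball p (r k)) x)" for x
  proof (cases "x \<in> ball p h \<and> x \<noteq> p")
    case True
    let ?s = "norm (x - p)"
    have s: "?s > 0" "?s < h" using True by (auto simp: dist_norm norm_minus_commute)
    have "r \<longlonglongrightarrow> h * 0" unfolding r_def by (intro tendsto_intros LIMSEQ_realpow_zero) auto
    then have "\<forall>\<^sub>F k in sequentially. r k < ?s" using s(1) by (auto intro: order_tendstoD)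
    then have ex: "\<exists>k. r k \<le> ?s" by (auto simp: eventually_sequentially intro: less_imp_le)
    define K where "K = (LEAST k. r k \<le> ?s)"
    have K: "r K \<le> ?s" unfolding K_def using ex by (rule LeastI_ex)
    have "K \<noteq> 0"
    proof
      assume "K = 0"
      with K s(2) show False by (simp add: r_def)
    qed
    then obtain k where k: "K = Suc k" by (cases K) auto
    have "\<not> r k \<le> ?s" using not_less_Least[of k "\<lambda>k. r k \<le> ?s"] k unfolding K_def by simp
    then have mem: "x \<in> ball p (r k)" by (simp add: dist_norm norm_minus_commute)
    have rk: "r (Suc k) > 0" "r (Suc k) \<le> ?s" using r K k by auto
    have "indicator (ball p h) x / ?s\<^sup>2 = 1 / ?s\<^sup>2" using True by simp
    also have "\<dots> \<le> 1 / (r (Suc k))\<^sup>2"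
      using rk s by (intro divide_left_mono power_mono) auto
    also have "\<dots> = c k"
      by (simp add: r_def c_def power_mult_distrib power_divide field_simps power2_eq_square
          flip: power_mult_distrib)
    finally have "ennreal (indicator (ball p h) x / ?s\<^sup>2) \<le> ennreal (c k) * indicator (ball p (r k)) x"
      using mem by (simp add: ennreal_leI)
    also have "\<dots> \<le> (\<Sum>k. ennreal (c k) * indicator (ball p (r k)) x)"
      by (rule term_le_suminf_ennreal[of "\<lambda>k. ennreal (c k) * indicator (ball p (r k)) x"])
    finally show ?thesis .
  next
    case False
    then have "indicator (ball p h) x / (norm (x - p))\<^sup>2 = (0::real)" by (auto simp: indicator_def)
    then show ?thesis by (simp only: ennreal_0 zero_le)
  qed
  have "(\<integral>\<^sup>+x. ennreal (indicator (ball p h) x / (norm (x - p))\<^sup>2) \<partial>lborel)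
      \<le> (\<integral>\<^sup>+x. (\<Sum>k. ennreal (c k) * indicator (ball p (r k)) x) \<partial>lborel)"
    by (intro nn_integral_mono pw)
  also have "\<dots> = (\<Sum>k. ennreal (c k * (unit_ball_vol 3 * r k ^ 3)))"
    using c r by (intro nn_integral_ball_series) (auto intro: less_imp_le)
  also have "\<dots> = (\<Sum>k. ennreal (4 * unit_ball_vol 3 * h * (1 / 2) ^ k))"
  proof (intro arg_cong[where f = suminf] ext arg_cong[where f = ennreal])
    fix k
    have "c k * (unit_ball_vol 3 * r k ^ 3) = 4 * unit_ball_vol 3 * h * (4 ^ k * ((1 / 2) ^ k) ^ 3)"
      using assms by (simp add: c_def r_def power_mult_distrib power2_eq_square power3_eq_cube)
    also have "4 ^ k * ((1 / 2) ^ k) ^ 3 = (4 * (1 / 2) ^ 3 :: real) ^ k"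
      by (metis mult.commute power_mult power_mult_distrib)
    also have "4 * (1 / 2) ^ 3 = (1 / 2 :: real)" by (simp add: power3_eq_cube)
    finally show "c k * (unit_ball_vol 3 * r k ^ 3) = 4 * unit_ball_vol 3 * h * (1 / 2) ^ k" .
  qed
  also have "\<dots> = ennreal (8 * unit_ball_vol 3 * h)"
  proof (rule suminf_ennreal_eq)
    have "(\<lambda>k. 4 * unit_ball_vol 3 * h * (1 / 2) ^ k) sums (4 * unit_ball_vol 3 * h * (1 / (1 - 1 / 2)))"
      by (intro sums_mult geometric_sums) simp
    then show "(\<lambda>k. 4 * unit_ball_vol 3 * h * (1 / 2) ^ k) sums (8 * unit_ball_vol 3 * h)" by (simp add: mult.assoc)
  qed (use assms in auto)
  finally show ?thesis .
qed

text \<open>The same dyadic decomposition towards infinity: the decay \<open>|x|^(-5)\<close> beats the volume growth \<open>|x|^3\<close>.\<close>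

lemma mollifier_integrable:
  "integrable lborel (mollifier 1 (0 :: real^3))"
proof (rule integrableI_nonneg)
  show "mollifier 1 (0 :: real^3) \<in> borel_measurable lborel"
    using borel_measurable_continuous_onI[OF smooth_continuous[OF smooth_mollifier[OF zero_less_one]]]
    by simp
  show "AE x in lborel. 0 \<le> mollifier 1 (0::real^3) x" by (simp add: mollifier_nonneg)
  define r where "r = (\<lambda>k::nat. (2::real) ^ k)"
  have pw: "ennreal (mollifier 1 0 x) \<le> (\<Sum>k. ennreal (96 * (1 / 32) ^ k) * indicator (ball 0 (r k)) x)"
    for x :: "real^3"
  proof -
    let ?s = "norm x"
    obtain m where "?s < r m" unfolding r_def using real_arch_pow[of 2 ?s] by auto
    then have ex: "\<exists>k. ?s < r k" by blast
    define K where "K = (LEAST k. ?s < r k)"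
    have K: "?s < r K" unfolding K_def using ex by (rule LeastI_ex)
    have "mollifier 1 0 x \<le> 96 * (1 / 32) ^ K"
    proof (cases K)
      case 0
      have "plummer (- (5 / 2)) 1 0 x \<le> 1"
        unfolding plummer_def using powr_mono2'[of "- (5 / 2)" 1 "(norm (x - 0))\<^sup>2 + 1\<^sup>2"] by simp
      then show ?thesis using 0 by (simp add: mollifier_def)
    next
      case (Suc k)
      have "\<not> ?s < r k" using not_less_Least[of k "\<lambda>k. ?s < r k"] Suc unfolding K_def by simp
      then have "r k \<le> norm (x - 0)" by simp
      then have "mollifier 1 0 x \<le> 3 * 1\<^sup>2 * r k powr (- 5)"
        by (intro mollifier_le) (auto simp: r_def)
      also have "r k powr (- 5) = (1 / 32) ^ k"
      proof -
        have "((2::real) ^ k) ^ 5 = (2 ^ 5) ^ k" by (simp only: power_mult[symmetric] mult.commute)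
        then show ?thesis by (simp add: r_def powr_neg_numeral power_divide)
      qed
      finally show ?thesis using Suc by simp
    qed
    then have "ennreal (mollifier 1 0 x) \<le> ennreal (96 * (1 / 32) ^ K) * indicator (ball 0 (r K)) x"
      using K by (simp add: ennreal_leI)
    also have "\<dots> \<le> (\<Sum>k. ennreal (96 * (1 / 32) ^ k) * indicator (ball 0 (r k)) x)"
      by (rule term_le_suminf_ennreal[of "\<lambda>k. ennreal (96 * (1 / 32) ^ k) * indicator (ball 0 (r k)) x"])
    finally show ?thesis .
  qed
  have "(\<integral>\<^sup>+x. ennreal (mollifier 1 (0::real^3) x) \<partial>lborel)
      \<le> (\<integral>\<^sup>+x. (\<Sum>k. ennreal (96 * (1 / 32) ^ k) * indicator (ball (0::real^3) (r k)) x) \<partial>lborel)"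
    by (intro nn_integral_mono pw)
  also have "\<dots> = (\<Sum>k. ennreal (96 * (1 / 32) ^ k * (unit_ball_vol 3 * r k ^ 3)))"
    by (intro nn_integral_ball_series) (auto simp: r_def)
  also have "\<dots> = (\<Sum>k. ennreal (96 * unit_ball_vol 3 * (1 / 4) ^ k))"
  proof (intro arg_cong[where f = suminf] ext arg_cong[where f = ennreal])
    fix k
    have "96 * (1 / 32) ^ k * (unit_ball_vol 3 * r k ^ 3) = 96 * unit_ball_vol 3 * ((1 / 32) ^ k * (2 ^ k) ^ 3)"
      by (simp add: r_def)
    also have "(1 / 32) ^ k * (2 ^ k) ^ 3 = ((1 / 32) * 2 ^ 3 :: real) ^ k"
      by (metis mult.commute power_mult power_mult_distrib)
    also have "(1 / 32) * 2 ^ 3 = (1 / 4 :: real)" by simp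
    finally show "96 * (1 / 32) ^ k * (unit_ball_vol 3 * r k ^ 3) = 96 * unit_ball_vol 3 * (1 / 4) ^ k" .
  qed
  also have "\<dots> = ennreal (96 * unit_ball_vol 3 * (1 / (1 - 1 / 4)))"
    by (intro suminf_ennreal_eq sums_mult geometric_sums) auto
  finally show "(\<integral>\<^sup>+x. ennreal (mollifier 1 (0::real^3) x) \<partial>lborel) < \<infinity>"
    by (simp add: le_less_trans)
qed

definition mollifier_mass :: real where
  "mollifier_mass = (LINT x|lborel. mollifier 1 (0::real^3) x)"

lemma mollifier_mass_pos: "mollifier_mass > 0"
proof -
  have nn: "0 \<le> mollifier 1 (0::real^3) x" for x by (rule mollifier_nonneg)
  have "mollifier_mass \<noteq> 0"
  proof
    assume "mollifier_mass = 0"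
    then have "AE x in lborel. mollifier 1 (0::real^3) x = 0"
      using integral_nonneg_eq_0_iff_AE[OF mollifier_integrable] nn by (simp add: mollifier_mass_def)
    moreover have "mollifier 1 (0::real^3) x \<noteq> 0" for x
      using plummer_base_pos[of 1 x 0] by (simp add: mollifier_def plummer_def)
    ultimately have "AE x in (lborel :: (real^3) measure). False" by simp
    then show False
      using AE_iff_measurable[of "UNIV :: (real^3) set" lborel "\<lambda>_. False"] by simp
  qed
  moreover have "mollifier_mass \<ge> 0"
    unfolding mollifier_mass_def by (intro Bochner_Integration.integral_nonneg nn)
  ultimately show ?thesis by simp
qed

lemma lborel_integral_affine:
  fixes f :: "real^3 \<Rightarrow> real"
  assumes "c > 0" "f \<in> borel_measurable borel"
  shows "(LINT x|lborel. f x) = c ^ 3 * (LINT x|lborel. f (t + c *\<^sub>R x))"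
proof -
  have "(LINT x|lborel. f x) = (LINT x|density (distr lborel borel (\<lambda>x. t + c *\<^sub>R x)) (\<lambda>_. ennreal (c ^ 3)). f x)"
    using assms lborel_affine[of c t] by (simp add: ennreal_power)
  also have "\<dots> = (LINT x|distr lborel borel (\<lambda>x. t + c *\<^sub>R x). c ^ 3 *\<^sub>R f x)"
    using assms by (intro integral_density) auto
  also have "\<dots> = (LINT x|lborel. c ^ 3 *\<^sub>R f (t + c *\<^sub>R x))"
    using assms by (intro integral_distr) auto
  finally show ?thesis by simp
qed

lemma mollifier_scale:
  assumes "\<epsilon> > 0"
  shows "\<epsilon> ^ 3 * mollifier \<epsilon> p (p + \<epsilon> *\<^sub>R y) = mollifier 1 0 y"
proof -
  have "(norm (p + \<epsilon> *\<^sub>R y - p))\<^sup>2 + \<epsilon>\<^sup>2 = \<epsilon>\<^sup>2 * ((norm y)\<^sup>2 + 1)"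
    using assms by (simp add: power_mult_distrib algebra_simps)
  then have "plummer (- 5 / 2) \<epsilon> p (p + \<epsilon> *\<^sub>R y) = (\<epsilon>\<^sup>2) powr (- 5 / 2) * ((norm y)\<^sup>2 + 1) powr (- 5 / 2)"
    unfolding plummer_def by (simp add: powr_mult add_nonneg_pos)
  moreover have "(\<epsilon>\<^sup>2) powr (- 5 / 2) = \<epsilon> powr (- 5)"
    using square_powr[OF assms, of "- 5 / 2"] by simp
  moreover have "\<epsilon> ^ 3 * (3 * \<epsilon>\<^sup>2 * (\<epsilon> powr (- 5) * A)) = 3 * A" for A
    using assms by (simp add: powr_neg_numeral field_simps eval_nat_numeral)
  ultimately show ?thesis
    by (simp add: mollifier_def plummer_def)
qed

section \<open>Removing the mollification\<close>

lemma mollifier_measurable: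
  "(\<lambda>z. mollifier \<epsilon> (snd z) (fst z)) \<in> borel_measurable (lborel \<Otimes>\<^sub>M (lborel :: (real^3) measure))"
  unfolding mollifier_def plummer_def by measurable

text \<open>Substituting \<open>y = x + \<epsilon> z\<close> moves the dependence on \<open>\<epsilon>\<close> from the kernel to the function that is being
  averaged, after which boundedness and continuity are enough.\<close>

lemma mollify_test_function:
  fixes \<theta> :: "real^3 \<Rightarrow> real"
  assumes \<theta>: "continuous_on UNIV \<theta>" "\<And>x. \<bar>\<theta> x\<bar> \<le> T"
  shows "\<epsilon> > 0 \<Longrightarrow> \<bar>LINT y|lborel. \<theta> y * mollifier \<epsilon> y x\<bar> \<le> T * mollifier_mass"
    and "(\<And>n. \<epsilon>' n > 0) \<Longrightarrow> \<epsilon>' \<longlonglongrightarrow> 0 \<Longrightarrow>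
      (\<lambda>n. LINT y|lborel. \<theta> y * mollifier (\<epsilon>' n) y x) \<longlonglongrightarrow> mollifier_mass * \<theta> x"
proof -
  have [measurable]: "\<theta> \<in> borel_measurable borel"
    using \<theta>(1) by (rule borel_measurable_continuous_onI)
  have [measurable]: "mollifier 1 (0::real^3) \<in> borel_measurable borel"
    by (rule borel_measurable_continuous_onI[OF smooth_continuous[OF smooth_mollifier]]) simp
  have eq: "(LINT y|lborel. \<theta> y * mollifier \<epsilon> y x) = (LINT y|lborel. \<theta> (x + \<epsilon> *\<^sub>R y) * mollifier 1 0 y)"
    if \<epsilon>: "\<epsilon> > 0" for \<epsilon>
  proof -
    have [measurable]: "mollifier \<epsilon> x \<in> borel_measurable borel"
      by (rule borel_measurable_continuous_onI[OF smooth_continuous[OF smooth_mollifier[OF \<epsilon>]]])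
    have "(LINT y|lborel. \<theta> y * mollifier \<epsilon> y x) = (LINT y|lborel. \<theta> y * mollifier \<epsilon> x y)"
      by (simp add: mollifier_def plummer_commute[of _ _ x])
    also have "\<dots> = \<epsilon> ^ 3 * (LINT y|lborel. \<theta> (x + \<epsilon> *\<^sub>R y) * mollifier \<epsilon> x (x + \<epsilon> *\<^sub>R y))"
      using lborel_integral_affine[OF \<epsilon>, of "\<lambda>y. \<theta> y * mollifier \<epsilon> x y" x] by simp
    also have "\<dots> = (LINT y|lborel. \<epsilon> ^ 3 * (\<theta> (x + \<epsilon> *\<^sub>R y) * mollifier \<epsilon> x (x + \<epsilon> *\<^sub>R y)))"
      by simp
    also have "\<dots> = (LINT y|lborel. \<theta> (x + \<epsilon> *\<^sub>R y) * (\<epsilon> ^ 3 * mollifier \<epsilon> x (x + \<epsilon> *\<^sub>R y)))"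
      by (simp add: mult_ac)
    finally show ?thesis by (simp only: mollifier_scale[OF \<epsilon>])
  qed
  have dom: "norm (\<theta> z * mollifier 1 0 y) \<le> T * mollifier 1 0 y" for z y :: "real^3"
    using \<theta>(2)[of z] mollifier_nonneg[of 1 0 y] by (simp add: abs_mult mult_right_mono)
  have dom_int: "integrable lborel (\<lambda>y::real^3. T * mollifier 1 0 y)"
    using mollifier_integrable by simp
  have "\<bar>LINT y|lborel. \<theta> (x + \<epsilon> *\<^sub>R y) * mollifier 1 0 y\<bar> \<le> T * mollifier_mass" for \<epsilon>
  proof -
    have "norm (LINT y|lborel. \<theta> (x + \<epsilon> *\<^sub>R y) * mollifier 1 0 y) \<le> (LINT y|lborel. T * mollifier 1 (0::real^3) y)"
    proof (rule Bochner_Integration.integral_norm_bound_integral[OF _ dom_int dom])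
      show "integrable lborel (\<lambda>y. \<theta> (x + \<epsilon> *\<^sub>R y) * mollifier 1 0 y)"
      proof (rule Bochner_Integration.integrable_bound[OF dom_int])
        show "AE y in lborel. norm (\<theta> (x + \<epsilon> *\<^sub>R y) * mollifier 1 0 y) \<le> norm (T * mollifier 1 0 y)"
          by (intro AE_I2 order_trans[OF dom]) simp
      qed measurable
    qed
    then show ?thesis by (simp add: mollifier_mass_def)
  qed
  then show "\<epsilon> > 0 \<Longrightarrow> \<bar>LINT y|lborel. \<theta> y * mollifier \<epsilon> y x\<bar> \<le> T * mollifier_mass"
    using eq by simp
  show "(\<lambda>n. LINT y|lborel. \<theta> y * mollifier (\<epsilon>' n) y x) \<longlonglongrightarrow> mollifier_mass * \<theta> x"
    if "\<And>n. \<epsilon>' n > 0" "\<epsilon>' \<longlonglongrightarrow> 0"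
  proof -
    have "(\<lambda>n. LINT y|lborel. \<theta> (x + \<epsilon>' n *\<^sub>R y) * mollifier 1 0 y) \<longlonglongrightarrow> (LINT y|lborel. \<theta> x * mollifier 1 (0::real^3) y)"
    proof (rule integral_dominated_convergence[OF _ _ dom_int])
      have "(\<lambda>n. \<theta> (x + \<epsilon>' n *\<^sub>R y) * mollifier 1 0 y) \<longlonglongrightarrow> \<theta> (x + 0 *\<^sub>R y) * mollifier 1 0 y" for y
        using \<theta>(1) that(2)
        by (intro tendsto_mult tendsto_const continuous_on_tendsto_compose[OF \<theta>(1)] tendsto_add tendsto_scaleR) auto
      then show "AE y in lborel. (\<lambda>n. \<theta> (x + \<epsilon>' n *\<^sub>R y) * mollifier 1 0 y) \<longlonglongrightarrow> \<theta> x * mollifier 1 0 y"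
        by simp
    qed (use dom in auto)
    then show ?thesis using eq that(1) by (simp add: mollifier_mass_def mult.commute)
  qed
qed

text \<open>By Fubini's theorem and the symmetry of the kernel the mollification can be moved from \<open>F\<close>, which is merely
  integrable, to the continuous function \<open>\<theta>\<close>, where its limit is known.\<close>

lemma mollified_bound_imp_test_bound:
  fixes F :: "real^3 \<Rightarrow> real"
  assumes F: "integrable lebesgue F" and \<theta>: "test_function UNIV \<theta>" "\<And>x. 0 \<le> \<theta> x"
    and \<epsilon>: "\<And>n. \<epsilon> n > 0" "\<epsilon> \<longlonglongrightarrow> 0"
    and bound: "\<And>n y. \<theta> y \<noteq> 0 \<Longrightarrow> (LINT x|lebesgue. F x * mollifier (\<epsilon> n) y x) \<le> c"
  shows "mollifier_mass * (LINT x|lebesgue. F x * \<theta> x) \<le> c * (LINT x|lebesgue. \<theta> x)"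
proof -
  obtain K where K: "smooth \<theta>" "compact K" "\<And>x. x \<notin> K \<Longrightarrow> \<theta> x = 0"
    using \<theta>(1) unfolding test_function_iff by blast
  have \<theta>c: "continuous_on UNIV \<theta>" by (rule smooth_continuous[OF K(1)])
  obtain T where T: "T > 0" "\<And>x. norm (\<theta> x) \<le> T"
    using compact_support_bounded[OF smooth_continuous[OF K(1)] K(2,3)] by blast
  then have T': "\<bar>\<theta> x\<bar> \<le> T" for x by simp
  have \<theta>i: "integrable lborel \<theta>"
    by (rule compact_support_integrable(1)[OF smooth_continuous[OF K(1)] K(2,3)])
  then have [measurable]: "\<theta> \<in> borel_measurable borel" by auto
  \<comment> \<open>Products of Lebesgue measures need a Borel measurable representative.\<close>
  obtain G where G[measurable]: "G \<in> borel_measurable borel" and FG: "AE x in lborel. F x = G x"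
    using completion_ex_borel_measurable_real[of F lborel] F by auto
  have FG': "AE x in lebesgue. F x = G x" using FG by (rule AE_completion)
  have to_G: "(LINT x|lebesgue. F x * b x) = (LINT x|lborel. G x * b x)" if [measurable]: "b \<in> borel_measurable borel" for b
  proof -
    have [measurable]: "F \<in> borel_measurable lebesgue" using F by auto
    have [measurable]: "G \<in> borel_measurable lebesgue" "b \<in> borel_measurable lebesgue"
      by (auto intro: measurable_completion)
    have "(LINT x|lebesgue. F x * b x) = (LINT x|lebesgue. G x * b x)"
      using FG' by (intro integral_cong_AE) auto
    also have "\<dots> = (LINT x|lborel. G x * b x)" by (rule integral_completion) measurable
    finally show ?thesis .
  qed
  have Gi: "integrable lborel G"
  proof -
    have "integrable lebesgue G"
      using F FG' by (subst integrable_cong_AE[of G _ F, OF measurable_completion]) (auto simp: eq_commute)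
    then show ?thesis using integrable_completion[of G lborel] by simp
  qed
  have mb[measurable]: "mollifier (\<epsilon> n) y \<in> borel_measurable borel" for n and y :: "real^3"
    by (rule borel_measurable_continuous_onI[OF smooth_continuous[OF smooth_mollifier[OF \<epsilon>(1)]]])
  define J where "J = (\<lambda>n x. LINT y|lborel. \<theta> y * mollifier (\<epsilon> n) y x)"
  have Jm: "J n \<in> borel_measurable lborel" for n
    unfolding J_def using mollifier_measurable[of "\<epsilon> n"]
    by (intro lborel.borel_measurable_lebesgue_integral) (simp add: case_prod_beta)
  have J_bound: "\<bar>J n x\<bar> \<le> T * mollifier_mass" for n x
    unfolding J_def by (rule mollify_test_function(1)[OF \<theta>c T' \<epsilon>(1)])
  define H where "H = (\<lambda>n x y. G x * (\<theta> y * mollifier (\<epsilon> n) y x))"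
  have Hm: "(\<lambda>z. H n (fst z) (snd z)) \<in> borel_measurable (lborel \<Otimes>\<^sub>M lborel)" for n
    unfolding H_def using mollifier_measurable[of "\<epsilon> n"] by measurable
  have my: "integrable lborel (\<lambda>y. \<theta> y * mollifier (\<epsilon> n) y x)" for n x
  proof (rule compact_support_integrable(1)[OF _ K(2)])
    show "continuous_on K (\<lambda>y. \<theta> y * mollifier (\<epsilon> n) y x)"
      unfolding mollifier_def plummer_commute[of _ _ _ x]
      by (intro continuous_on_mult smooth_continuous K(1) smooth_const smooth_plummer \<epsilon>(1))
  qed (use K(3) in auto)
  have nn: "0 \<le> \<theta> y * mollifier (\<epsilon> n) y x" for y n x
    by (intro mult_nonneg_nonneg \<theta>(2) mollifier_nonneg)
  have Hi: "integrable (lborel \<Otimes>\<^sub>M lborel) (\<lambda>(x, y). H n x y)" for n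
  proof (rule lborel_pair.Fubini_integrable)
    show "(\<lambda>(x, y). H n x y) \<in> borel_measurable (lborel \<Otimes>\<^sub>M lborel)"
      using Hm[of n] by (simp add: case_prod_beta)
    have "(LINT y|lborel. norm (H n x y)) = \<bar>G x\<bar> * J n x" for x
      unfolding H_def J_def using nn by (simp add: abs_mult mollifier_nonneg \<theta>(2))
    moreover have "integrable lborel (\<lambda>x. \<bar>G x\<bar> * J n x)"
    proof (rule Bochner_Integration.integrable_bound[OF integrable_mult_right[OF Gi, of "T * mollifier_mass"]])
      show "(\<lambda>x. \<bar>G x\<bar> * J n x) \<in> borel_measurable lborel"
        using Jm[of n] by measurable
      show "AE x in lborel. norm (\<bar>G x\<bar> * J n x) \<le> norm (T * mollifier_mass * G x)"
      proof (rule AE_I2)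
        fix x
        have "\<bar>G x\<bar> * \<bar>J n x\<bar> \<le> \<bar>G x\<bar> * (T * mollifier_mass)"
          by (intro mult_left_mono J_bound) auto
        then show "norm (\<bar>G x\<bar> * J n x) \<le> norm (T * mollifier_mass * G x)"
          using T(1) mollifier_mass_pos by (simp add: abs_mult mult_ac)
      qed
    qed
    ultimately show "integrable lborel (\<lambda>x. LINT y|lborel. norm (case (x, y) of (x, y) \<Rightarrow> H n x y))" by simp
    show "AE x in lborel. integrable lborel (\<lambda>y. case (x, y) of (x, y) \<Rightarrow> H n x y)"
      unfolding H_def using my by (intro AE_I2) simp
  qed
  have le: "(LINT x|lborel. G x * J n x) \<le> c * (LINT y|lborel. \<theta> y)" for n
  proof -
    have "(LINT x|lborel. G x * J n x) = (LINT x|lborel. LINT y|lborel. H n x y)"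
      unfolding H_def J_def by simp
    also have "\<dots> = (LINT y|lborel. LINT x|lborel. H n x y)"
      using lborel_pair.Fubini_integral[OF Hi[of n]] by simp
    also have "\<dots> \<le> (LINT y|lborel. c * \<theta> y)"
    proof (rule integral_mono)
      show "integrable lborel (\<lambda>y. LINT x|lborel. H n x y)"
        using lborel_pair.integrable_snd[OF Hi[of n]] by simp
      show "integrable lborel (\<lambda>y. c * \<theta> y)" using \<theta>i by simp
      fix y
      have "(LINT x|lborel. H n x y) = \<theta> y * (LINT x|lborel. G x * mollifier (\<epsilon> n) y x)"
        unfolding H_def by (simp add: mult_ac flip: integral_mult_right_zero)
      also have "\<dots> \<le> \<theta> y * c"
      proof (cases "\<theta> y = 0")
        case False
        then show ?thesis
          using bound[OF False, of n] to_G[OF mb, of n y] \<theta>(2)[of y] by (intro mult_left_mono) auto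
      qed simp
      finally show "(LINT x|lborel. H n x y) \<le> c * \<theta> y" by (simp add: mult.commute)
    qed
    finally show ?thesis by simp
  qed
  have lim: "(\<lambda>n. LINT x|lborel. G x * J n x) \<longlonglongrightarrow> (LINT x|lborel. G x * (mollifier_mass * \<theta> x))"
  proof (rule integral_dominated_convergence[where w = "\<lambda>x. \<bar>G x\<bar> * (T * mollifier_mass)"])
    show "(\<lambda>x. G x * J n x) \<in> borel_measurable lborel" for n
      using Jm[of n] by measurable
    show "integrable lborel (\<lambda>x. \<bar>G x\<bar> * (T * mollifier_mass))" using Gi by simp
    show "AE x in lborel. (\<lambda>n. G x * J n x) \<longlonglongrightarrow> G x * (mollifier_mass * \<theta> x)"
      unfolding J_def by (intro AE_I2 tendsto_mult tendsto_const mollify_test_function(2)[OF \<theta>c T' \<epsilon>])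
    show "AE x in lborel. norm (G x * J n x) \<le> \<bar>G x\<bar> * (T * mollifier_mass)" for n
      unfolding real_norm_def abs_mult
      by (intro AE_I2 mult_left_mono J_bound) auto
  qed measurable
  have "(LINT x|lborel. G x * (mollifier_mass * \<theta> x)) \<le> c * (LINT y|lborel. \<theta> y)"
    by (rule LIMSEQ_le_const2[OF lim]) (use le in auto)
  moreover have "(LINT x|lborel. G x * (mollifier_mass * \<theta> x)) = mollifier_mass * (LINT x|lebesgue. F x * \<theta> x)"
  proof -
    have "(LINT x|lborel. G x * (mollifier_mass * \<theta> x)) = mollifier_mass * (LINT x|lborel. G x * \<theta> x)"
      by (simp add: mult_ac flip: integral_mult_right_zero)
    then show ?thesis using to_G[of \<theta>] by simp
  qed
  moreover have "(LINT x|lebesgue. \<theta> x) = (LINT x|lborel. \<theta> x)" by (rule integral_completion) simp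
  ultimately show ?thesis by simp
qed

text \<open>This takes the place of the Lebesgue differentiation theorem: the bound is inherited by integrals against test
  functions, and from there by \<open>F\<close> itself.\<close>

lemma mollified_bound_imp_AE_bound:
  fixes F :: "real^3 \<Rightarrow> real"
  assumes F: "integrable lebesgue F" and V: "open V" and d: "d > 0"
    and bound: "\<And>\<epsilon> y. y \<in> V \<Longrightarrow> 0 < \<epsilon> \<Longrightarrow> \<epsilon> \<le> d \<Longrightarrow>
      (LINT x|lebesgue. F x * mollifier \<epsilon> y x) \<le> mollifier_mass * c"
  shows "AE x in lebesgue. x \<in> V \<longrightarrow> F x - c \<le> 0"
proof (rule nonpositive_from_test_functions[OF V])
  have "integrable lebesgue (\<lambda>x. indicator K x *\<^sub>R F x)" if "compact K" for K
    using that by (intro integrable_mult_indicator F) (auto simp: compact_imp_closed)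
  then have liF: "locally_integrable V F"
    by (simp add: locally_integrable_def set_integrable_def)
  have liC: "locally_integrable V (\<lambda>x. c)"
    by (intro continuous_locally_integrable continuous_on_const)
  show "locally_integrable V (\<lambda>x. F x - c)" by (rule locally_integrable_diff[OF liF liC])
  fix \<theta> assume \<theta>: "test_function V \<theta>" "\<And>x. 0 \<le> \<theta> x"
  have \<theta>V: "\<theta> x = 0" if "x \<notin> V" for x using test_function_outside[OF \<theta>(1) that] .
  define \<epsilon> where "\<epsilon> = (\<lambda>n. d * inverse (real (Suc n)))"
  have \<epsilon>: "\<epsilon> n > 0" "\<epsilon> n \<le> d" for n
    using d by (auto simp: \<epsilon>_def field_simps)
  have "\<epsilon> \<longlonglongrightarrow> d * 0" unfolding \<epsilon>_def by (intro tendsto_intros LIMSEQ_inverse_real_of_nat)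
  then have \<epsilon>0: "\<epsilon> \<longlonglongrightarrow> 0" by simp
  have "mollifier_mass * (LINT x|lebesgue. F x * \<theta> x) \<le> (mollifier_mass * c) * (LINT x|lebesgue. \<theta> x)"
  proof (rule mollified_bound_imp_test_bound[OF F test_function_mono[OF \<theta>(1)] \<theta>(2) \<epsilon>(1) \<epsilon>0])
    show "(LINT x|lebesgue. F x * mollifier (\<epsilon> n) y x) \<le> mollifier_mass * c" if "\<theta> y \<noteq> 0" for n y
      using that \<theta>V by (intro bound \<epsilon>) auto
  qed simp
  then have le: "(LINT x|lebesgue. F x * \<theta> x) \<le> c * (LINT x|lebesgue. \<theta> x)"
    using mollifier_mass_pos by (simp add: mult.assoc)
  have "(LINT x:V|lebesgue. (F x - c) * \<theta> x)
      = (LINT x:V|lebesgue. F x * \<theta> x) - (LINT x:V|lebesgue. c * \<theta> x)"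
    unfolding left_diff_distrib
    by (rule set_integral_diff(2)[OF locally_integrable_mult_test[OF liF \<theta>(1)]
          locally_integrable_mult_test[OF liC \<theta>(1)]])
  also have "\<dots> = (LINT x|lebesgue. F x * \<theta> x) - c * (LINT x|lebesgue. \<theta> x)"
    using \<theta>V by (simp add: set_integral_eq_whole(1))
  also have "\<dots> \<le> 0" using le by simp
  finally show "(LINT x:V|lebesgue. (F x - c) * \<theta> x) \<le> 0" .
qed

text \<open>Within distance \<open>h\<close> of \<open>p\<close> the bound \<open>B / h^3\<close> on the density is used, farther away the bound 1 on the total
  mass. Both contributions are of order \<open>h^(-2)\<close>.\<close>

lemma inverse_square_potential_bound:
  fixes f :: "real^3 \<Rightarrow> real"
  assumes f: "integrable lebesgue f" "\<And>x. 0 \<le> f x" "(LINT x|lebesgue. f x) \<le> 1"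
    and B: "AE x in lebesgue. f x \<le> B / h ^ 3" "B \<ge> 0" and h: "h > 0"
  shows "integrable lebesgue (\<lambda>x. f x / (norm (x - p))\<^sup>2)"
    and "(LINT x|lebesgue. f x / (norm (x - p))\<^sup>2) \<le> (1 + 8 * unit_ball_vol 3 * B) / h\<^sup>2"
proof -
  define s where "s = (\<lambda>x. indicator (ball p h) x / (norm (x - p))\<^sup>2 :: real)"
  have s0: "0 \<le> s x" for x by (simp add: s_def)
  have sm: "s \<in> borel_measurable borel"
    unfolding s_def by (intro borel_measurable_divide borel_measurable_indicator borel_measurable_power
        borel_measurable_norm borel_measurable_diff) (auto simp: borel_open)
  have le: "(\<integral>\<^sup>+x. ennreal (s x) \<partial>lborel) \<le> ennreal (8 * unit_ball_vol 3 * h)"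
    unfolding s_def by (rule nn_integral_inverse_square_ball[OF h])
  have si: "integrable lborel s"
    by (rule integrableI_nonneg) (use s0 sm le in \<open>auto intro: le_less_trans\<close>)
  have sI: "(LINT x|lborel. s x) \<le> 8 * unit_ball_vol 3 * h"
  proof -
    have "ennreal (LINT x|lborel. s x) = (\<integral>\<^sup>+x. ennreal (s x) \<partial>lborel)"
      using si s0 by (intro nn_integral_eq_integral[symmetric]) auto
    then have "ennreal (LINT x|lborel. s x) \<le> ennreal (8 * unit_ball_vol 3 * h)" using le by simp
    then show ?thesis by (rule ennreal_le_iff[THEN iffD1, rotated]) (use h in simp)
  qed
  have si': "integrable lebesgue s" "(LINT x|lebesgue. s x) = (LINT x|lborel. s x)"
    using si sm integrable_completion[of s lborel] integral_completion[of s lborel] by auto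
  define R where "R = (\<lambda>x. f x * (1 / h\<^sup>2) + (B / h ^ 3) * s x)"
  have Ri: "integrable lebesgue R" unfolding R_def using f(1) si'(1) by simp
  have le_R: "AE x in lebesgue. f x / (norm (x - p))\<^sup>2 \<le> R x"
    using B(1)
  proof eventually_elim
    fix x assume fx: "f x \<le> B / h ^ 3"
    show "f x / (norm (x - p))\<^sup>2 \<le> R x"
    proof (cases "x \<in> ball p h")
      case True
      have "f x / (norm (x - p))\<^sup>2 = f x * s x" using True by (simp add: s_def)
      also have "\<dots> \<le> (B / h ^ 3) * s x" by (rule mult_right_mono[OF fx s0])
      also have "\<dots> \<le> R x" using f(2) by (simp add: R_def)
      finally show ?thesis .
    next
      case False
      then have "h \<le> norm (x - p)" by (simp add: dist_norm norm_minus_commute)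
      then have "1 / (norm (x - p))\<^sup>2 \<le> 1 / h\<^sup>2" using h by (intro divide_left_mono power_mono mult_pos_pos zero_less_power) auto
      then have "f x * (1 / (norm (x - p))\<^sup>2) \<le> f x * (1 / h\<^sup>2)" by (rule mult_left_mono[OF _ f(2)])
      also have "\<dots> \<le> R x" using B(2) h s0 by (simp add: R_def)
      finally show ?thesis by simp
    qed
  qed
  have [measurable]: "f \<in> borel_measurable lebesgue" using f(1) by auto
  have m: "(\<lambda>x. f x / (norm (x - p))\<^sup>2) \<in> borel_measurable lebesgue"
  proof -
    have [measurable]: "(\<lambda>x. (norm (x - p))\<^sup>2) \<in> borel_measurable lebesgue"
      by (rule measurable_completion) measurable
    show ?thesis by measurable
  qed
  show i: "integrable lebesgue (\<lambda>x. f x / (norm (x - p))\<^sup>2)"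
    by (rule Bochner_Integration.integrable_bound[OF Ri m])
       (use le_R f(2) in \<open>auto elim!: eventually_mono\<close>)
  have "(LINT x|lebesgue. f x / (norm (x - p))\<^sup>2) \<le> (LINT x|lebesgue. R x)"
    by (rule integral_mono_AE[OF i Ri le_R])
  also have "\<dots> = (LINT x|lebesgue. f x) * (1 / h\<^sup>2) + (B / h ^ 3) * (LINT x|lborel. s x)"
    unfolding R_def using f(1) si' by simp
  also have "\<dots> \<le> 1 * (1 / h\<^sup>2) + (B / h ^ 3) * (8 * unit_ball_vol 3 * h)"
    using f(3) sI B(2) h by (intro add_mono mult_right_mono mult_left_mono) auto
  also have "\<dots> = (1 + 8 * unit_ball_vol 3 * B) / h\<^sup>2"
    using h by (simp add: field_simps power2_eq_square power3_eq_cube)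
  finally show "(LINT x|lebesgue. f x / (norm (x - p))\<^sup>2) \<le> (1 + 8 * unit_ball_vol 3 * B) / h\<^sup>2" .
qed

section \<open>Cutoff functions\<close>

lemma partial_affine:
  assumes "f differentiable (at (c *\<^sub>R (x - p)))"
  shows "partial e (\<lambda>x. f (c *\<^sub>R (x - p))) x = c * partial e f (c *\<^sub>R (x - p))"
proof -
  let ?D = "frechet_derivative f (at (c *\<^sub>R (x - p)))"
  have D: "(f has_derivative ?D) (at (c *\<^sub>R (x - p)))"
    using assms frechet_derivative_works by blast
  have "((\<lambda>x. f (c *\<^sub>R (x - p))) has_derivative (\<lambda>v. ?D (c *\<^sub>R v))) (at x)"
    by (rule has_derivative_compose[where f = "\<lambda>x. c *\<^sub>R (x - p)" and g = f, OF _ D])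
       (auto intro!: derivative_eq_intros)
  from partial_eqI[OF this] show ?thesis
    using linear_scale[OF linear_frechet_derivative[OF assms]] by (simp add: partial_def)
qed

lemma smooth_affine: "smooth f \<Longrightarrow> smooth (\<lambda>x. f (c *\<^sub>R (x - p)))"
proof -
  have "Ck_on k UNIV (\<lambda>x. a * f (c *\<^sub>R (x - p)))" if "smooth f" for k a f
    using that
  proof (induction k arbitrary: a f)
    case 0
    then show ?case
      by (auto intro!: continuous_intros continuous_on_compose2[OF smooth_continuous[OF 0, of UNIV]])
  next
    case (Suc k)
    have d: "f differentiable (at y)" for y using Suc.prems by (rule smooth_differentiable)
    have d': "(\<lambda>x. f (c *\<^sub>R (x - p))) differentiable (at x)" for x
      by (rule differentiable_compose[of f "\<lambda>x. c *\<^sub>R (x - p)", OF d]) (auto intro: derivative_intros)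
    have "partial e (\<lambda>x. a * f (c *\<^sub>R (x - p))) = (\<lambda>x. (a * c) * partial e f (c *\<^sub>R (x - p)))" for e
      by (auto simp: partial_cmult[OF d'] partial_affine[OF d])
    then have "Ck_on k UNIV (partial e (\<lambda>x. a * f (c *\<^sub>R (x - p))))" if "e \<in> Basis" for e
      using Suc.IH[OF smooth_partial[OF Suc.prems that]] by simp
    then show ?case using d' by (auto simp: partial_def intro!: differentiable_mult)
  qed
  from this[of f _ 1] show "smooth f \<Longrightarrow> smooth (\<lambda>x. f (c *\<^sub>R (x - p)))"
    by (simp add: smooth_def)
qed

text \<open>The bounds on the derivatives are those of a fixed profile rescaled to the length \<open>d\<close>, so that \<open>B\<close> can be chosen
  once for all scales and centres.\<close>

definition cutoff :: "real \<Rightarrow> 'a::euclidean_space \<Rightarrow> real \<Rightarrow> ('a \<Rightarrow> real) \<Rightarrow> bool" where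
  "cutoff B p d \<kappa> \<longleftrightarrow> smooth \<kappa> \<and> (\<forall>x. 0 \<le> \<kappa> x \<and> \<kappa> x \<le> 1) \<and>
     (\<forall>x. norm (x - p) \<le> d / 4 \<longrightarrow> \<kappa> x = 1) \<and> (\<forall>x. norm (x - p) \<ge> d / 2 \<longrightarrow> \<kappa> x = 0) \<and>
     (\<forall>x. norm (grad \<kappa> x) \<le> B / d) \<and> (\<forall>x. \<bar>laplacian \<kappa> x\<bar> \<le> B / d\<^sup>2)"

text \<open>Applying \<open>flat_step\<close> twice yields a function that is constant on both sides: the inner application vanishes for
  \<open>|x| \<ge> 1 / 2\<close>, and the outer one vanishes as soon as the inner value is at least \<open>m\<close>, its value at
  \<open>|x| = 1 / 4\<close>.\<close>

lemma cutoff_unit_exists: "\<exists>B>0. \<exists>\<kappa> :: 'a::euclidean_space \<Rightarrow> real. cutoff B 0 1 \<kappa>"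
proof -
  \<comment> \<open>The number \<open>3 / 16\<close> is \<open>(1 / 2)^2 - (1 / 4)^2\<close>.\<close>
  define m where "m = flat_step (3 / 16)"
  have m: "m > 0" by (simp add: m_def flat_step_pos)
  have fm: "flat_step m > 0" using m by (rule flat_step_pos)
  define \<kappa> :: "'a \<Rightarrow> real" where
    "\<kappa> = (\<lambda>x. 1 - (1 / flat_step m) * flat_step (m - flat_step (1 / 4 - (norm (x - 0))\<^sup>2)))"
  have sm: "smooth \<kappa>"
    unfolding \<kappa>_def by (intro smooth_diff smooth_const smooth_cmult smooth_flat_step smooth_norm_sq)
  have nn: "0 \<le> \<kappa> x" for x
  proof -
    have "flat_step (m - flat_step (1 / 4 - (norm (x - 0))\<^sup>2)) \<le> flat_step m"
      by (intro flat_step_mono) (simp add: flat_step_nonneg)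
    then show ?thesis using fm by (simp add: \<kappa>_def)
  qed
  have le1: "\<kappa> x \<le> 1" for x using fm by (simp add: \<kappa>_def flat_step_nonneg)
  have one: "\<kappa> x = 1" if "norm x \<le> 1 / 4" for x
  proof -
    have "(norm x)\<^sup>2 \<le> (1 / 4)\<^sup>2" using that by (intro power_mono) auto
    then have "m \<le> flat_step (1 / 4 - (norm (x - 0))\<^sup>2)"
      unfolding m_def by (intro flat_step_mono) (simp add: power2_eq_square)
    then show ?thesis by (simp add: \<kappa>_def flat_step_0)
  qed
  have zero: "\<kappa> x = 0" if "norm x \<ge> 1 / 2" for x
  proof -
    have "(1 / 2)\<^sup>2 \<le> (norm x)\<^sup>2" using that by (intro power_mono) auto
    then have "flat_step (1 / 4 - (norm (x - 0))\<^sup>2) = 0"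
      by (intro flat_step_0) (simp add: power2_eq_square)
    then show ?thesis using fm by (simp add: \<kappa>_def)
  qed
  have out: "\<kappa> x = 0" if "x \<notin> cball 0 (1 / 2)" for x using zero that by simp
  have test: "test_function UNIV \<kappa>"
    by (rule test_functionI[OF sm compact_cball[of 0 "1 / 2"]]) (use out in auto)
  obtain B1 where B1: "B1 > 0" "\<And>x. norm (grad \<kappa> x) \<le> B1"
    using test_function_grad_bounded[OF test] by blast
  have "laplacian \<kappa> x = 0" if "x \<notin> cball 0 (1 / 2)" for x
    unfolding laplacian_def
    by (intro sum.neutral ballI partial_outside[OF compact_cball _ that]) (rule partial_outside[OF compact_cball out])
  then obtain B2 where B2: "B2 > 0" "\<And>x. norm (laplacian \<kappa> x) \<le> B2"
    using compact_support_bounded[OF smooth_continuous[OF smooth_laplacian[OF sm]] compact_cball] by blast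
  have "norm (grad \<kappa> x) \<le> max B1 B2" "\<bar>laplacian \<kappa> x\<bar> \<le> max B1 B2" for x
    using B1(2)[of x] B2(2)[of x] by auto
  then have "cutoff (max B1 B2) 0 1 \<kappa>"
    unfolding cutoff_def using sm nn le1 one zero by simp
  moreover have "max B1 B2 > 0" using B1(1) by simp
  ultimately show ?thesis by blast
qed

lemma cutoff_exists: "\<exists>B>0. \<forall>(p::'a::euclidean_space) d. d > 0 \<longrightarrow> (\<exists>\<kappa>. cutoff B p d \<kappa>)"
proof -
  obtain \<kappa> :: "'a \<Rightarrow> real" and B where B: "B > 0" and "cutoff B 0 1 \<kappa>"
    using cutoff_unit_exists by blast
  then have \<kappa>: "smooth \<kappa>" "\<And>x. 0 \<le> \<kappa> x" "\<And>x. \<kappa> x \<le> 1" "\<And>x. norm x \<le> 1 / 4 \<Longrightarrow> \<kappa> x = 1"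
    "\<And>x. norm x \<ge> 1 / 2 \<Longrightarrow> \<kappa> x = 0" "\<And>x. norm (grad \<kappa> x) \<le> B" "\<And>x. \<bar>laplacian \<kappa> x\<bar> \<le> B"
    by (simp_all add: cutoff_def)
  have "cutoff B p d (\<lambda>x. \<kappa> ((1 / d) *\<^sub>R (x - p)))" if "d > 0" for p d
    unfolding cutoff_def
  proof (intro conjI allI impI)
    fix x
    note d = \<open>d > 0\<close>
    let ?f = "\<lambda>x. \<kappa> ((1 / d) *\<^sub>R (x - p))"
    have nrm: "norm ((1 / d) *\<^sub>R (x - p)) = norm (x - p) / d" using d by (simp only: norm_scaleR) simp
    show sm: "smooth ?f" by (rule smooth_affine[OF \<kappa>(1)])
    show "0 \<le> ?f x" "?f x \<le> 1" by (rule \<kappa>)+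
    show "?f x = 1" if "norm (x - p) \<le> d / 4"
      by (rule \<kappa>(4)) (subst nrm, use d that in \<open>simp add: field_simps\<close>)
    show "?f x = 0" if "norm (x - p) \<ge> d / 2"
      by (rule \<kappa>(5)) (subst nrm, use d that in \<open>simp add: field_simps\<close>)
    have p1: "partial e ?f = (\<lambda>x. (1 / d) * partial e \<kappa> ((1 / d) *\<^sub>R (x - p)))" for e
      by (rule ext, rule partial_affine[OF smooth_differentiable[OF \<kappa>(1)]])
    have "grad ?f x = (1 / d) *\<^sub>R grad \<kappa> ((1 / d) *\<^sub>R (x - p))"
      by (rule grad_eqI) (simp add: p1 inner_grad)
    then show "norm (grad ?f x) \<le> B / d"
      using d \<kappa>(6)[of "(1 / d) *\<^sub>R (x - p)"] by (simp add: divide_right_mono)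
    have "partial e (partial e ?f) x = (1 / d) * ((1 / d) * partial e (partial e \<kappa>) ((1 / d) *\<^sub>R (x - p)))"
      if "e \<in> Basis" for e
      unfolding p1
      by (subst partial_cmult, rule smooth_differentiable, rule smooth_affine[OF smooth_partial[OF \<kappa>(1) that]],
          subst partial_affine[OF smooth_differentiable[OF smooth_partial[OF \<kappa>(1) that]]], rule refl)
    then have "laplacian ?f x = (1 / d\<^sup>2) * laplacian \<kappa> ((1 / d) *\<^sub>R (x - p))"
      by (simp add: laplacian_def sum_divide_distrib power2_eq_square)
    then show "\<bar>laplacian ?f x\<bar> \<le> B / d\<^sup>2"
      using \<kappa>(7)[of "(1 / d) *\<^sub>R (x - p)"] by (simp add: divide_right_mono)
  qed
  with B show ?thesis by blast
qed

section \<open>Mirror points of convex domains\<close>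

text \<open>The mirror image of \<open>p\<close> in the supporting hyperplane at a nearest boundary point \<open>q\<close>. The ball about \<open>p\<close> that
  touches the boundary at \<open>q\<close> lies in the domain, which forces the normal of the hyperplane to be parallel to
  \<open>p - q\<close>.\<close>

lemma convex_mirror_point:
  fixes U :: "'a::euclidean_space set"
  assumes "open U" "bounded U" "convex U" "p \<in> U"
  obtains d p' where "d > 0" "ball p d \<subseteq> U" "norm (p - p') = 2 * d"
    "\<And>x. x \<in> U \<Longrightarrow> norm (x - p) \<le> norm (x - p')"
proof -
  have "U \<noteq> UNIV" using assms(2) not_bounded_UNIV by blast
  then have "frontier U \<noteq> {}" using assms(4) frontier_not_empty[of U] by blast
  then obtain q where q: "q \<in> frontier U" "\<And>y. y \<in> frontier U \<Longrightarrow> dist p q \<le> dist p y"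
    using distance_attains_inf[of "frontier U" p] by auto
  define d where "d = dist p q"
  have "q \<notin> U" using q(1) assms(1) by (simp add: frontier_def interior_open)
  then have d: "d > 0" using assms(4) by (auto simp: d_def)
  have ball: "ball p d \<subseteq> U"
  proof (rule ccontr)
    assume "\<not> ball p d \<subseteq> U"
    moreover have "p \<in> ball p d \<inter> U" using d assms(4) by simp
    then have "ball p d \<inter> U \<noteq> {}" by blast
    ultimately have "ball p d \<inter> frontier U \<noteq> {}"
      by (intro connected_Int_frontier) auto
    then show False using q(2) by (force simp: d_def)
  qed
  obtain a b where ab: "a \<noteq> 0" "\<forall>x\<in>{q}. a \<bullet> x \<le> b" "\<forall>x\<in>U. a \<bullet> x \<ge> b"
    using separating_hyperplane_sets[of "{q}" U] assms(3,4) \<open>q \<notin> U\<close> by auto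
  then have sep: "a \<bullet> (x - q) \<ge> 0" if "x \<in> U" for x
    using that by (force simp: inner_diff_right)
  have na: "norm a > 0" using ab(1) by simp
  \<comment> \<open>The ball of radius \<open>d\<close> about \<open>p\<close> lies on the positive side of the hyperplane.\<close>
  have ge: "a \<bullet> (p - q) \<ge> d * norm a"
  proof (rule ccontr)
    assume "\<not> a \<bullet> (p - q) \<ge> d * norm a"
    then have "a \<bullet> (p - q) / norm a < d" using na by (simp add: field_simps)
    moreover have "0 \<le> a \<bullet> (p - q) / norm a" using sep[OF assms(4)] na by simp
    ultimately obtain t where t: "a \<bullet> (p - q) / norm a < t" "t < d" "t > 0"
      using dense by (metis le_less_trans)
    let ?x = "p - (t / norm a) *\<^sub>R a"
    have "dist p ?x < d" using t na by (simp add: dist_norm)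
    then have "?x \<in> U" using ball by auto
    from sep[OF this] have "a \<bullet> (p - q) - t * norm a \<ge> 0"
      using na by (simp add: inner_diff_right dot_square_norm power2_eq_square)
    with t(1) na show False by (simp add: field_simps)
  qed
  \<comment> \<open>Equality holds in the Cauchy-Schwarz inequality, because \<open>p - q\<close> has norm \<open>d\<close>.\<close>
  have pq: "p - q = (d / norm a) *\<^sub>R a"
  proof -
    have "(norm (w - k *\<^sub>R a))\<^sup>2 = (norm w)\<^sup>2 - 2 * k * (a \<bullet> w) + k\<^sup>2 * (norm a)\<^sup>2" for w k
      unfolding power2_norm_eq_inner
      by (simp add: inner_diff_left inner_diff_right inner_commute[of w a] power2_eq_square algebra_simps)
    from this[of "p - q" "d / norm a"]
    have "(norm (p - q - (d / norm a) *\<^sub>R a))\<^sup>2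
        = (norm (p - q))\<^sup>2 - 2 * (d / norm a) * (a \<bullet> (p - q)) + (d / norm a)\<^sup>2 * (norm a)\<^sup>2" .
    also have "\<dots> = 2 * d\<^sup>2 - 2 * (d / norm a) * (a \<bullet> (p - q))"
      using na by (simp add: d_def dist_norm power_divide)
    also have "\<dots> \<le> 2 * d\<^sup>2 - 2 * (d / norm a) * (d * norm a)"
      using ge d na by (intro diff_left_mono mult_left_mono) auto
    also have "\<dots> = 0" using na by (simp add: power2_eq_square)
    finally show ?thesis by simp
  qed
  show ?thesis
  proof (rule that[OF d ball, of "2 *\<^sub>R q - p"])
    have "p - (2 *\<^sub>R q - p) = 2 *\<^sub>R (p - q)" by (simp add: scaleR_2 algebra_simps)
    then show "norm (p - (2 *\<^sub>R q - p)) = 2 * d" by (simp add: d_def dist_norm)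
    fix x assume x: "x \<in> U"
    have "(norm (a + b))\<^sup>2 - (norm (a - b))\<^sup>2 = 4 * (b \<bullet> a)" for a b :: 'a
      unfolding power2_norm_eq_inner
      by (simp add: inner_add_left inner_add_right inner_diff_left inner_diff_right inner_commute[of a b])
    from this[of "x - q" "p - q"]
    have diff: "(norm (x - (2 *\<^sub>R q - p)))\<^sup>2 - (norm (x - p))\<^sup>2 = 4 * ((p - q) \<bullet> (x - q))"
      by (simp add: scaleR_2 algebra_simps)
    have "(p - q) \<bullet> (x - q) = (d / norm a) * (a \<bullet> (x - q))"
      unfolding pq by simp
    then have "(p - q) \<bullet> (x - q) \<ge> 0"
      using sep[OF x] d na by simp
    with diff have "(norm (x - p))\<^sup>2 \<le> (norm (x - (2 *\<^sub>R q - p)))\<^sup>2" by linarith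
    then show "norm (x - p) \<le> norm (x - (2 *\<^sub>R q - p))"
      by (rule power2_le_imp_le) simp
  qed
qed

section \<open>The gradient bound on convex domains\<close>

text \<open>The partial derivatives of \<open>\<zeta>\<close> are again test functions, so the definition of the weak gradient applies to each
  component.\<close>

lemma weak_green_identity:
  assumes "open U" "has_weak_gradient U u g" "test_function U \<zeta>"
  shows "integrable (lebesgue_on U) (\<lambda>x. u x * laplacian \<zeta> x)"
    and "(LINT x|lebesgue_on U. g x \<bullet> grad \<zeta> x) = - (LINT x|lebesgue_on U. u x * laplacian \<zeta> x)"
proof -
  have li: "locally_integrable U u" "locally_integrable U g"
    using assms(2) by (auto simp: has_weak_gradient_def)
  have i1: "integrable (lebesgue_on U) (\<lambda>x. u x * partial e (partial e \<zeta>) x)" if "e \<in> Basis" for e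
    using locally_integrable_mult_test[OF li(1) test_function_partial[OF test_function_partial[OF assms(3) that] that]]
    by (simp add: set_integral_lebesgue_on[OF assms(1)])
  have i2: "integrable (lebesgue_on U) (\<lambda>x. (g x \<bullet> e) * partial e \<zeta> x)" if "e \<in> Basis" for e
    using locally_integrable_mult_test[OF locally_integrable_inner[OF li(2)] test_function_partial[OF assms(3) that]]
    by (simp add: set_integral_lebesgue_on[OF assms(1)])
  have eq: "(LINT x|lebesgue_on U. u x * partial e (partial e \<zeta>) x)
      = - (LINT x|lebesgue_on U. (g x \<bullet> e) * partial e \<zeta> x)" if "e \<in> Basis" for e
    using assms(2) test_function_partial[OF assms(3) that] that
    by (simp add: has_weak_gradient_def partial_def[of e "partial e \<zeta>"] set_integral_lebesgue_on[OF assms(1)])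
  have lap: "u x * laplacian \<zeta> x = (\<Sum>e\<in>Basis. u x * partial e (partial e \<zeta>) x)" for x
    by (simp add: laplacian_def sum_distrib_left)
  have gr: "g x \<bullet> grad \<zeta> x = (\<Sum>e\<in>Basis. (g x \<bullet> e) * partial e \<zeta> x)" for x
    by (subst euclidean_inner) (simp add: inner_grad)
  show "integrable (lebesgue_on U) (\<lambda>x. u x * laplacian \<zeta> x)"
    unfolding lap by (intro Bochner_Integration.integrable_sum i1)
  show "(LINT x|lebesgue_on U. g x \<bullet> grad \<zeta> x) = - (LINT x|lebesgue_on U. u x * laplacian \<zeta> x)"
    unfolding lap gr
    by (subst (1 2) Bochner_Integration.integral_sum) (auto simp: i1 i2 eq sum_negf)
qed

text \<open>Up to a constant, \<open>1 / |x - p|^2\<close> is the size of the gradient of the Newtonian kernel with pole \<open>p\<close>. Thus \<open>N\<close>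
  bounds the gradient of the potential that the density \<open>f\<close> generates in free space.\<close>

definition potential_bound :: "(real^3) set \<Rightarrow> (real^3 \<Rightarrow> real) \<Rightarrow> real \<Rightarrow> bool" where
  "potential_bound U f N \<longleftrightarrow> integrable (lebesgue_on U) f \<and> (\<forall>x. 0 \<le> f x) \<and>
     (\<forall>p. integrable (lebesgue_on U) (\<lambda>x. f x / (norm (x - p))\<^sup>2) \<and>
       (LINT x|lebesgue_on U. f x / (norm (x - p))\<^sup>2) \<le> N)"

text \<open>The upper bound is \<open>1 / A - 1 / B = (B - A) / (A B)\<close> for the softened distances \<open>A \<le> B\<close> to \<open>p\<close> and \<open>p'\<close>,
  where \<open>B - A\<close> is at most the distance of the two poles.\<close>

lemma newton_difference_bound:
  assumes "d > 0" "norm (x - p) \<le> norm (x - p')" "norm (p - p') = 2 * d" "x \<noteq> p"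
  shows "0 \<le> plummer (- 1 / 2) d p x - plummer (- 1 / 2) d p' x"
    and "plummer (- 1 / 2) d p x - plummer (- 1 / 2) d p' x \<le> 2 * d * (1 / (norm (x - p))\<^sup>2)"
proof -
  define a b A B where "a = norm (x - p)" and "b = norm (x - p')"
    and "A = sqrt (a\<^sup>2 + d\<^sup>2)" and "B = sqrt (b\<^sup>2 + d\<^sup>2)"
  have eq: "plummer (- 1 / 2) d p x = 1 / A" "plummer (- 1 / 2) d p' x = 1 / B"
    using powr_minus_divide[of "a\<^sup>2 + d\<^sup>2" "1 / 2"] powr_minus_divide[of "b\<^sup>2 + d\<^sup>2" "1 / 2"]
    by (simp_all add: plummer_def A_def B_def a_def b_def powr_half_sqrt)
  have a: "a > 0" "a \<le> b" using assms by (auto simp: a_def b_def)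
  have A: "A > 0" "a \<le> A" "b \<le> B" "A \<le> B"
    using a assms(1) by (auto simp: A_def B_def intro!: real_le_rsqrt add_nonneg_pos power_mono)
  show "0 \<le> plummer (- 1 / 2) d p x - plummer (- 1 / 2) d p' x"
    unfolding eq using A by (simp add: frac_le)
  have "B - A \<le> b - a"
  proof -
    have "A\<^sup>2 = a\<^sup>2 + d\<^sup>2" "B\<^sup>2 = b\<^sup>2 + d\<^sup>2" by (simp_all add: A_def B_def)
    then have "(B - A) * (B + A) = (b - a) * (b + a)"
      by (simp add: algebra_simps power2_eq_square)
    also have "\<dots> \<le> (b - a) * (B + A)" using A a by (intro mult_left_mono) auto
    finally show ?thesis using A a by (simp add: mult_le_cancel_right)
  qed
  moreover have "b - a \<le> 2 * d"
  proof -
    have "x - p' = (x - p) + (p - p')" by simp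
    then have "b \<le> a + norm (p - p')" unfolding a_def b_def by (metis norm_triangle_ineq)
    then show ?thesis using assms(3) by simp
  qed
  ultimately have BA: "B - A \<le> 2 * d" by simp
  have "1 / A - 1 / B = (B - A) / (A * B)" using A by (simp add: field_simps)
  also have "\<dots> \<le> (B - A) / (a * a)"
    using A a by (intro divide_left_mono mult_mono mult_pos_pos) auto
  also have "\<dots> \<le> 2 * d / (a * a)" using BA a by (intro divide_right_mono) auto
  finally show "plummer (- 1 / 2) d p x - plummer (- 1 / 2) d p' x \<le> 2 * d * (1 / (norm (x - p))\<^sup>2)"
    unfolding eq by (simp add: a_def power2_eq_square)
qed

text \<open>The numbers \<open>5 / 4 = (1 / 2)^2 + 1\<close> and \<open>13 / 4 = (3 / 2)^2 + 1\<close> are the extreme values, in units of \<open>d^2\<close>, of the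
  softened squared distances from a point of the ball of radius \<open>d / 2\<close> about \<open>p\<close> to \<open>p\<close> and to its mirror
  image.\<close>

definition mirror_gap :: real where
  "mirror_gap = 3 * ((5 / 4) powr (- 5 / 2) - (13 / 4) powr (- 5 / 2))"

lemma mirror_gap_pos: "mirror_gap > 0"
  unfolding mirror_gap_def using powr_less_mono2_neg[of "- 5 / 2" "5 / 4" "13 / 4"] by simp

lemma mollifier_gap:
  assumes "d > 0" "norm (p - p') = 2 * d" "norm (x - p) \<le> d / 2"
  shows "mirror_gap / d ^ 3 \<le> mollifier d p x - mollifier d p' x"
proof -
  have "norm (p - p') \<le> norm (x - p') + norm (x - p)"
    using norm_triangle_ineq4[of "x - p'" "x - p"] by simp
  then have far: "3 / 2 * d \<le> norm (x - p')" using assms by simp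
  have "(norm (x - p))\<^sup>2 \<le> (d / 2)\<^sup>2" using assms by (intro power_mono) auto
  then have 1: "(norm (x - p))\<^sup>2 + d\<^sup>2 \<le> 5 / 4 * d\<^sup>2" by (simp add: power_divide)
  have "(3 / 2 * d)\<^sup>2 \<le> (norm (x - p'))\<^sup>2" using far assms(1) by (intro power_mono) auto
  then have 2: "13 / 4 * d\<^sup>2 \<le> (norm (x - p'))\<^sup>2 + d\<^sup>2" by (simp add: power_mult_distrib power_divide)
  have "(5 / 4 * d\<^sup>2) powr (- 5 / 2) \<le> plummer (- 5 / 2) d p x"
    unfolding plummer_def using 1 assms(1) by (intro powr_mono2') (auto intro: add_nonneg_pos)
  moreover have "plummer (- 5 / 2) d p' x \<le> (13 / 4 * d\<^sup>2) powr (- 5 / 2)"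
    unfolding plummer_def using 2 assms(1) by (intro powr_mono2') auto
  ultimately have "3 * d\<^sup>2 * ((5 / 4 * d\<^sup>2) powr (- 5 / 2) - (13 / 4 * d\<^sup>2) powr (- 5 / 2))
      \<le> 3 * d\<^sup>2 * (plummer (- 5 / 2) d p x - plummer (- 5 / 2) d p' x)"
    by (intro mult_left_mono) auto
  also have "\<dots> = mollifier d p x - mollifier d p' x" by (simp add: mollifier_def algebra_simps)
  also have "3 * d\<^sup>2 * ((5 / 4 * d\<^sup>2) powr (- 5 / 2) - (13 / 4 * d\<^sup>2) powr (- 5 / 2))
      = (d\<^sup>2 * (d\<^sup>2) powr (- 5 / 2)) * mirror_gap"
  proof -
    have "(5 / 4 * d\<^sup>2) powr (- 5 / 2) = (5 / 4) powr (- 5 / 2) * (d\<^sup>2) powr (- 5 / 2)"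
      "(13 / 4 * d\<^sup>2) powr (- 5 / 2) = (13 / 4) powr (- 5 / 2) * (d\<^sup>2) powr (- 5 / 2)"
      by (rule powr_mult; simp)+
    then show ?thesis by (simp only: mirror_gap_def algebra_simps)
  qed
  also have "d\<^sup>2 * (d\<^sup>2) powr (- 5 / 2) = 1 / d ^ 3"
    using square_powr[OF assms(1), of "- 5 / 2"] assms(1)
    by (simp add: powr_neg_numeral field_simps eval_nat_numeral)
  finally show ?thesis by simp
qed

lemma integrable_mult_indicator_cball:
  fixes f :: "'a::euclidean_space \<Rightarrow> real"
  assumes "integrable (lebesgue_on U) f"
  shows "integrable (lebesgue_on U) (\<lambda>x. f x * indicator (cball p r) x)"
proof (rule integrable_mult_bounded[OF assms, of _ 1])
  show "indicator (cball p r) \<in> borel_measurable (lebesgue_on U)"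
    by (intro measurable_restrict_space1 borel_measurable_indicator) auto
qed (auto simp: indicator_def)

text \<open>Kato's inequality for the difference of two kernels softened at scale \<open>d\<close>, with poles \<open>p\<close> and \<open>p'\<close>. On the
  domain the difference is nonnegative and superharmonic; \<open>mollifier_gap\<close> bounds its Laplacian away from zero near
  \<open>p\<close>, and \<open>newton_difference_bound\<close> gains the factor \<open>d\<close> that makes \<open>u\<close> small near the boundary.\<close>

lemma mirror_L1_bound:
  fixes U :: "(real^3) set"
  assumes U: "open U" "bounded U" and sol: "poisson_dirichlet_solution U f u"
    and pot: "potential_bound U f N"
    and d: "d > 0" "norm (p - p') = 2 * d" "\<And>x. x \<in> U \<Longrightarrow> norm (x - p) \<le> norm (x - p')"
  shows "(LINT x|lebesgue_on U. \<bar>u x\<bar> * indicator (cball p (d / 2)) x) \<le> 2 / mirror_gap * N * d ^ 4"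
proof -
  let ?M = "lebesgue_on U"
  have f: "integrable ?M f" "\<And>x. 0 \<le> f x"
    and N: "integrable ?M (\<lambda>x. f x / (norm (x - p))\<^sup>2)" "(LINT x|?M. f x / (norm (x - p))\<^sup>2) \<le> N"
    using pot by (simp_all add: potential_bound_def)
  define \<zeta> where "\<zeta> = (\<lambda>x. plummer (- 1 / 2) d p x - plummer (- 1 / 2) d p' x)"
  have sm: "smooth \<zeta>" unfolding \<zeta>_def by (intro smooth_diff smooth_plummer d)
  have \<zeta>0: "0 \<le> \<zeta> x" if "x \<in> U" for x
  proof (cases "x = p")
    case False
    then show ?thesis unfolding \<zeta>_def using newton_difference_bound(1)[OF d(1) d(3)[OF that] d(2)] by simp
  next
    case True
    have "plummer (- 1 / 2) d p' x \<le> plummer (- 1 / 2) d p x"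
      unfolding plummer_def using True d(1)
      by (intro powr_mono2') auto
    then show ?thesis by (simp add: \<zeta>_def)
  qed
  have lap: "laplacian \<zeta> x = mollifier d p' x - mollifier d p x" for x
  proof -
    have "partial e \<zeta> = (\<lambda>x. partial e (plummer (- 1 / 2) d p) x + (- 1) * partial e (plummer (- 1 / 2) d p') x)" for e
    proof
      fix x
      note sd = smooth_differentiable[OF smooth_plummer[OF d(1)]]
      have "\<zeta> = (\<lambda>x. plummer (- 1 / 2) d p x + (- 1) * plummer (- 1 / 2) d p' x)" by (auto simp: \<zeta>_def)
      then show "partial e \<zeta> x = partial e (plummer (- 1 / 2) d p) x + (- 1) * partial e (plummer (- 1 / 2) d p') x"
        by (simp only: partial_add[OF sd differentiable_mult[OF differentiable_const sd]] partial_cmult[OF sd])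
    qed
    note p1 = this
    have "partial e (partial e \<zeta>) x = partial e (partial e (plummer (- 1 / 2) d p)) x
        + (- 1) * partial e (partial e (plummer (- 1 / 2) d p')) x" if e: "e \<in> Basis" for e
    proof -
      note sd = smooth_differentiable[OF smooth_partial[OF smooth_plummer[OF d(1)] e]]
      show ?thesis unfolding p1
        by (simp only: partial_add[OF sd differentiable_mult[OF differentiable_const sd]] partial_cmult[OF sd])
    qed
    then have "laplacian \<zeta> x = laplacian (plummer (- 1 / 2) d p) x - laplacian (plummer (- 1 / 2) d p') x"
      by (simp add: laplacian_def sum_subtractf)
    then show ?thesis unfolding laplacian_newton[OF d(1)] by simp
  qed
  have u: "H10 U u" using sol by (simp add: poisson_dirichlet_solution_def)
  have ui: "integrable ?M u" by (rule H10_integrable[OF U u])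
  define m where "m = mirror_gap / d ^ 3"
  have m: "m > 0" using mirror_gap_pos d(1) by (simp add: m_def)
  have lap0: "laplacian \<zeta> x \<le> 0" if "x \<in> U" for x
  proof -
    have "mollifier d p' x \<le> mollifier d p x"
      unfolding mollifier_def plummer_def using d(1) d(3)[OF that]
      by (intro mult_left_mono powr_mono2' add_right_mono power_mono) (auto intro: add_nonneg_pos)
    then show ?thesis by (simp add: lap)
  qed
  obtain B where B: "\<And>x. x \<in> U \<Longrightarrow> norm (laplacian \<zeta> x) \<le> B" "B \<ge> 0"
    using continuous_bounded_on_bounded[OF U(2) smooth_continuous[OF smooth_laplacian[OF sm]]] by blast
  have lm: "laplacian \<zeta> \<in> borel_measurable ?M" "\<zeta> \<in> borel_measurable ?M"
    by (intro continuous_measurable_lebesgue_on smooth_continuous smooth_laplacian sm U)+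
  have i1: "integrable ?M (\<lambda>x. \<bar>u x\<bar> * laplacian \<zeta> x)"
    by (rule integrable_mult_bounded[of _ _ _ B]) (use ui lm(1) B(1) in auto)
  have i2: "integrable ?M (\<lambda>x. \<bar>u x\<bar> * indicator (cball p (d / 2)) x)"
    by (rule integrable_mult_indicator_cball[OF integrable_abs[OF ui]])
  have "m * (LINT x|?M. \<bar>u x\<bar> * indicator (cball p (d / 2)) x)
      = (LINT x|?M. m * (\<bar>u x\<bar> * indicator (cball p (d / 2)) x))" by simp
  also have "\<dots> \<le> (LINT x|?M. - (\<bar>u x\<bar> * laplacian \<zeta> x))"
  proof (rule integral_mono)
    fix x assume "x \<in> space ?M"
    then have x: "x \<in> U" by simp
    show "m * (\<bar>u x\<bar> * indicator (cball p (d / 2)) x) \<le> - (\<bar>u x\<bar> * laplacian \<zeta> x)"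
    proof (cases "x \<in> cball p (d / 2)")
      case True
      then have "norm (x - p) \<le> d / 2" by (simp add: dist_norm norm_minus_commute)
      from mollifier_gap[OF d(1,2) this] have "m \<le> - laplacian \<zeta> x" by (simp add: lap m_def)
      then have "\<bar>u x\<bar> * m \<le> \<bar>u x\<bar> * (- laplacian \<zeta> x)" by (rule mult_left_mono) simp
      then show ?thesis using True by (simp add: mult.commute)
    next
      case False
      have "\<bar>u x\<bar> * laplacian \<zeta> x \<le> 0" using lap0[OF x] by (simp add: mult_nonneg_nonpos)
      then show ?thesis using False by simp
    qed
  qed (use i1 i2 in auto)
  also have "\<dots> = - (LINT x|?M. \<bar>u x\<bar> * laplacian \<zeta> x)" by simp
  also have "\<dots> \<le> (LINT x|?M. \<bar>f x\<bar> * \<zeta> x)"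
    by (rule kato_inequality[OF U sol f(1) sm \<zeta>0])
  also have "\<dots> \<le> (LINT x|?M. 2 * d * (f x / (norm (x - p))\<^sup>2))"
  proof (rule integral_mono_AE)
    obtain Bz where Bz: "\<And>x. x \<in> U \<Longrightarrow> norm (\<zeta> x) \<le> Bz" "Bz \<ge> 0"
      using continuous_bounded_on_bounded[OF U(2) smooth_continuous[OF sm]] by blast
    show "integrable ?M (\<lambda>x. \<bar>f x\<bar> * \<zeta> x)"
      by (rule integrable_mult_bounded[of _ _ _ Bz]) (use f(1) lm(2) Bz(1) in auto)
    show "integrable ?M (\<lambda>x. 2 * d * (f x / (norm (x - p))\<^sup>2))" by (rule integrable_mult_right[OF N(1)])
    \<comment> \<open>At \<open>x = p\<close> the quotient has the value 0 and the bound fails, but a point is a null set.\<close>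
    have "AE x in lebesgue. x \<noteq> p"
      by (rule AE_completion) (rule AE_lborel_singleton)
    then show "AE x in ?M. \<bar>f x\<bar> * \<zeta> x \<le> 2 * d * (f x / (norm (x - p))\<^sup>2)"
      unfolding AE_lebesgue_on[OF U(1)]
    proof (rule eventually_mono, intro impI)
      fix x assume "x \<noteq> p" "x \<in> U"
      then have "\<zeta> x \<le> 2 * d * (1 / (norm (x - p))\<^sup>2)"
        unfolding \<zeta>_def using newton_difference_bound(2)[OF d(1) d(3) d(2)] by blast
      then have "f x * \<zeta> x \<le> f x * (2 * d * (1 / (norm (x - p))\<^sup>2))"
        by (rule mult_left_mono[OF _ f(2)])
      then show "\<bar>f x\<bar> * \<zeta> x \<le> 2 * d * (f x / (norm (x - p))\<^sup>2)"
        using f(2)[of x] by (simp add: mult_ac)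
    qed
  qed
  also have "\<dots> = 2 * d * (LINT x|?M. f x / (norm (x - p))\<^sup>2)" by (rule integral_mult_right_zero)
  also have "\<dots> \<le> 2 * d * N" using N(2) d(1) by (intro mult_left_mono) auto
  finally have "m * (LINT x|?M. \<bar>u x\<bar> * indicator (cball p (d / 2)) x) \<le> 2 * d * N" .
  then have "(LINT x|?M. \<bar>u x\<bar> * indicator (cball p (d / 2)) x) \<le> 2 * d * N / m"
    using m by (simp add: field_simps)
  also have "2 * d * N / m = 2 / mirror_gap * N * d ^ 4"
    by (simp add: m_def eval_nat_numeral)
  finally show ?thesis .
qed

lemma partial_cong_open:
  assumes "open V" "\<And>x. x \<in> V \<Longrightarrow> f x = g x" "x \<in> V" "g differentiable at x"
  shows "partial e f x = partial e g x"
proof -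
  have "(g has_derivative frechet_derivative g (at x)) (at x)"
    using assms(4) frechet_derivative_works by blast
  then have "(f has_derivative frechet_derivative g (at x)) (at x)"
    by (rule has_derivative_transform_within_open[OF _ assms(1,3)]) (use assms(2) in auto)
  from partial_eqI[OF this] show ?thesis by (simp add: partial_def)
qed

text \<open>This confines the derivatives of a cutoff function to the shell on which it varies.\<close>

lemma locally_constant_derivatives:
  assumes "open V" "\<And>x. x \<in> V \<Longrightarrow> f x = c" "x \<in> V"
  shows "grad f x = 0" "laplacian f x = 0"
proof -
  have p: "partial e f y = 0" if "y \<in> V" for e y
    using partial_cong_open[OF assms(1), of f "\<lambda>_. c" y e] assms(2) that by simp
  then have "partial e (partial e f) x = 0" for e
    using partial_cong_open[OF assms(1), of "partial e f" "\<lambda>_. 0" x e] assms(3) by simp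
  then show "grad f x = 0" "laplacian f x = 0"
    using p assms(3) by (auto simp: grad_def laplacian_def)
qed

text \<open>With \<open>D\<close> the derivative of the softened Newtonian kernel in direction \<open>e\<close> and \<open>\<rho>\<close> the mollifier, both with pole
  \<open>y\<close>, one has \<open>\<Delta>(D \<kappa>) = - \<partial>(\<rho> \<kappa>) + R\<close>, where \<open>\<partial>\<close> is the derivative in direction \<open>e\<close> and where every term of \<open>R\<close>
  contains a derivative of \<open>\<kappa>\<close>. Testing the equation with \<open>D \<kappa>\<close> and integrating by parts gives
  \<open>\<integral> (\<nabla>u \<bullet> e) \<rho> \<kappa> = - \<integral> u R - \<integral> f D \<kappa>\<close>. The remainder \<open>R\<close> lives at distance at least \<open>d / 8\<close> from the
  pole, where all kernels are bounded independently of the softening, and \<open>|D|\<close> is at most \<open>1 / |x - y|^2\<close>.\<close>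

lemma mollified_gradient_bound:
  fixes U :: "(real^3) set"
  assumes U: "open U" "bounded U" and sol: "poisson_dirichlet_solution U f u"
    and pot: "potential_bound U f N"
    and d: "d > 0" "ball p d \<subseteq> U"
    and S: "(LINT x|lebesgue_on U. \<bar>u x\<bar> * indicator (cball p (d / 2)) x) \<le> S * d ^ 4"
    and cut: "cutoff B p d \<kappa>" and B: "B \<ge> 0"
    and e: "e \<in> Basis" and y: "norm (y - p) \<le> d / 8" and \<epsilon>: "0 < \<epsilon>" "\<epsilon> \<le> d"
  shows "\<bar>LINT x|lebesgue_on U. (weak_gradient U u x \<bullet> e) * (\<kappa> x * mollifier \<epsilon> y x)\<bar>
    \<le> 102464 * B * S + N"
proof -
  let ?M = "lebesgue_on U" and ?g = "weak_gradient U u"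
  have f: "integrable ?M f" "\<And>x. 0 \<le> f x"
    and N: "integrable ?M (\<lambda>x. f x / (norm (x - y))\<^sup>2)" "(LINT x|?M. f x / (norm (x - y))\<^sup>2) \<le> N"
    using pot by (simp_all add: potential_bound_def)
  have u: "H10 U u" using sol by (simp add: poisson_dirichlet_solution_def)
  have wg: "has_weak_gradient U u ?g" by (rule H10_has_weak_gradient[OF u])
  have ui: "integrable ?M u" by (rule H10_integrable[OF U u])
  have \<kappa>: "smooth \<kappa>" "\<And>x. 0 \<le> \<kappa> x" "\<And>x. \<kappa> x \<le> 1" "\<And>x. norm (x - p) \<le> d / 4 \<Longrightarrow> \<kappa> x = 1"
    "\<And>x. norm (x - p) \<ge> d / 2 \<Longrightarrow> \<kappa> x = 0" "\<And>x. norm (grad \<kappa> x) \<le> B / d"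
    "\<And>x. \<bar>laplacian \<kappa> x\<bar> \<le> B / d\<^sup>2"
    using cut by (simp_all add: cutoff_def)
  have ne: "norm e = 1" using e by simp
  have sub: "cball p (d / 2) \<subseteq> U" using d by (auto simp: subset_iff)
  have out: "\<kappa> x = 0" if "x \<notin> cball p (d / 2)" for x
    using \<kappa>(5)[of x] that by (simp add: dist_norm norm_minus_commute)
  have test\<kappa>: "test_function U \<kappa>"
    by (rule test_functionI[OF \<kappa>(1) compact_cball sub out])
  define D where "D = newton_deriv e \<epsilon> y"
  define \<rho> where "\<rho> = mollifier \<epsilon> y"
  have smD: "smooth D" and sm\<rho>: "smooth \<rho>"
    unfolding D_def \<rho>_def by (intro smooth_newton_deriv smooth_mollifier \<epsilon>)+
  define \<zeta> where "\<zeta> = (\<lambda>x. D x * \<kappa> x)"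
  define \<xi> where "\<xi> = (\<lambda>x. \<rho> x * \<kappa> x)"
  have t\<zeta>: "test_function U \<zeta>" unfolding \<zeta>_def by (rule test_function_mult[OF smD test\<kappa>])
  have t\<xi>: "test_function U \<xi>" unfolding \<xi>_def by (rule test_function_mult[OF sm\<rho> test\<kappa>])
  define R where "R = (\<lambda>x. \<rho> x * partial e \<kappa> x + (D x * laplacian \<kappa> x + 2 * (grad D x \<bullet> grad \<kappa> x)))"
  have smR: "smooth R"
  proof -
    have "smooth (\<lambda>x. grad D x \<bullet> grad \<kappa> x)"
      unfolding inner_grad_sum by (intro smooth_sum smooth_mult smooth_partial smD \<kappa>(1))
    then show ?thesis
      unfolding R_def by (intro smooth_add smooth_mult smooth_cmult sm\<rho> smD smooth_partial \<kappa>(1) e smooth_laplacian)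
  qed
  have lap\<zeta>: "laplacian \<zeta> x = - partial e \<xi> x + R x" for x
  proof -
    have "partial e \<xi> x = \<rho> x * partial e \<kappa> x + partial e \<rho> x * \<kappa> x"
      unfolding \<xi>_def by (rule partial_mult[OF smooth_differentiable[OF sm\<rho>] smooth_differentiable[OF \<kappa>(1)]])
    moreover have "laplacian D x = - partial e \<rho> x"
      unfolding D_def \<rho>_def by (rule laplacian_newton_deriv[OF \<epsilon>(1)])
    ultimately show ?thesis
      unfolding \<zeta>_def laplacian_mult[OF smD \<kappa>(1)] R_def by simp
  qed
  have Rbound: "\<bar>R x\<bar> \<le> 102464 * B / d ^ 4 * indicator (cball p (d / 2)) x" for x
  proof -
    consider "norm (x - p) < d / 4" | "x \<notin> cball p (d / 2)" | "d / 4 \<le> norm (x - p)" "x \<in> cball p (d / 2)"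
      by linarith
    then show ?thesis
    proof cases
      case 1
      have "\<kappa> z = 1" if "z \<in> ball p (d / 4)" for z
        using \<kappa>(4)[of z] that by (simp add: dist_norm norm_minus_commute)
      moreover have "x \<in> ball p (d / 4)" using 1 by (simp add: dist_norm norm_minus_commute)
      ultimately have "grad \<kappa> x = 0" "laplacian \<kappa> x = 0"
        using locally_constant_derivatives[OF open_ball] by blast+
      then have "R x = 0" using inner_grad[OF e, of \<kappa> x] by (simp add: R_def)
      then show ?thesis using B d(1) by simp
    next
      case 2
      have "open (- cball p (d / 2))" by (simp add: open_Compl)
      from locally_constant_derivatives[OF this, of \<kappa> 0 x] have "grad \<kappa> x = 0" "laplacian \<kappa> x = 0"
        using out 2 by auto
      then have "R x = 0" using inner_grad[OF e, of \<kappa> x] by (simp add: R_def)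
      then show ?thesis using B d(1) by simp
    next
      case 3
      \<comment> \<open>The shell begins at distance \<open>d / 4\<close> from \<open>p\<close>, and the pole is within \<open>d / 8\<close> of \<open>p\<close>. The final
        constant is \<open>3 * 8^5 + 8^2 + 2 * 4 * 8^3\<close>.\<close>
      define s where "s = d / 8"
      have s: "s > 0" using d(1) by (simp add: s_def)
      have "norm (x - p) \<le> norm (x - y) + norm (y - p)"
        using norm_triangle_ineq[of "x - y" "y - p"] by simp
      then have sx: "s \<le> norm (x - y)" using 3(1) y by (simp add: s_def)
      then have xy: "x \<noteq> y" using s by auto
      have "\<rho> x \<le> 3 * \<epsilon>\<^sup>2 * s powr (- 5)"
        unfolding \<rho>_def by (rule mollifier_le[OF \<epsilon>(1) s sx])
      also have "\<dots> \<le> 3 * d\<^sup>2 * s powr (- 5)"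
        using \<epsilon> by (intro mult_right_mono mult_left_mono power_mono) auto
      also have "\<dots> = 98304 / d ^ 3"
        using s d(1) by (simp add: s_def powr_neg_numeral field_simps eval_nat_numeral)
      finally have r: "\<rho> x \<le> 98304 / d ^ 3" .
      have r0: "0 \<le> \<rho> x" by (simp add: \<rho>_def mollifier_nonneg)
      have "\<bar>D x\<bar> \<le> 1 / (norm (x - y))\<^sup>2"
        unfolding D_def by (rule newton_deriv_le[OF \<epsilon>(1) ne xy])
      also have "\<dots> \<le> 1 / s\<^sup>2"
        using s sx by (intro divide_left_mono power_mono mult_pos_pos zero_less_power) auto
      also have "\<dots> = 64 / d\<^sup>2" by (simp add: s_def power_divide)
      finally have D: "\<bar>D x\<bar> \<le> 64 / d\<^sup>2" .
      have "norm (grad D x) \<le> 4 * s powr (- 3)"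
        unfolding D_def by (rule grad_newton_deriv_le[OF \<epsilon>(1) ne s sx])
      also have "\<dots> = 2048 / d ^ 3"
        using s by (simp add: s_def powr_neg_numeral power_divide)
      finally have gD: "norm (grad D x) \<le> 2048 / d ^ 3" .
      have pk: "\<bar>partial e \<kappa> x\<bar> \<le> B / d"
        using Cauchy_Schwarz_ineq2[of "grad \<kappa> x" e] \<kappa>(6)[of x] ne by (simp add: inner_grad[OF e])
      have 1: "\<bar>\<rho> x * partial e \<kappa> x\<bar> \<le> 98304 / d ^ 3 * (B / d)"
        unfolding abs_mult using r r0 pk d(1) by (intro mult_mono) auto
      have 2: "\<bar>D x * laplacian \<kappa> x\<bar> \<le> 64 / d\<^sup>2 * (B / d\<^sup>2)"
        unfolding abs_mult using D \<kappa>(7) by (intro mult_mono) auto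
      have "\<bar>grad D x \<bullet> grad \<kappa> x\<bar> \<le> norm (grad D x) * norm (grad \<kappa> x)" by (rule Cauchy_Schwarz_ineq2)
      also have "\<dots> \<le> 2048 / d ^ 3 * (B / d)" using gD \<kappa>(6) d(1) by (intro mult_mono) auto
      finally have 3: "\<bar>grad D x \<bullet> grad \<kappa> x\<bar> \<le> 2048 / d ^ 3 * (B / d)" .
      have "\<bar>R x\<bar> \<le> 98304 / d ^ 3 * (B / d) + (64 / d\<^sup>2 * (B / d\<^sup>2) + 2 * (2048 / d ^ 3 * (B / d)))"
      proof -
        have "\<bar>a + (b + 2 * c)\<bar> \<le> A + (B' + 2 * C)" if "\<bar>a\<bar> \<le> A" "\<bar>b\<bar> \<le> B'" "\<bar>c\<bar> \<le> C"
          for a b c A B' C :: real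
          using that by linarith
        from this[OF 1 2 3] show ?thesis unfolding R_def .
      qed
      also have "\<dots> = 102464 * B / d ^ 4"
        using d(1) by (simp add: field_simps eval_nat_numeral)
      finally show ?thesis using \<open>x \<in> cball p (d / 2)\<close> by simp
    qed
  qed
  have iu\<xi>: "integrable ?M (\<lambda>x. u x * partial e \<xi> x)"
    using locally_integrable_mult_test[of U u, OF _ test_function_partial[OF t\<xi> e]] wg
    by (simp add: has_weak_gradient_def set_integral_lebesgue_on[OF U(1)])
  have eq\<xi>: "(LINT x|?M. u x * partial e \<xi> x) = - (LINT x|?M. (?g x \<bullet> e) * \<xi> x)"
    using wg t\<xi> e by (simp add: has_weak_gradient_def partial_def[of e \<xi>] set_integral_lebesgue_on[OF U(1)])
  have iu\<zeta>: "integrable ?M (\<lambda>x. u x * laplacian \<zeta> x)"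
    and eq\<zeta>: "(LINT x|?M. ?g x \<bullet> grad \<zeta> x) = - (LINT x|?M. u x * laplacian \<zeta> x)"
    using weak_green_identity[OF U(1) wg t\<zeta>] by blast+
  have uR: "u x * R x = u x * laplacian \<zeta> x + u x * partial e \<xi> x" for x
    by (simp add: lap\<zeta> algebra_simps)
  have iuR: "integrable ?M (\<lambda>x. u x * R x)" unfolding uR using iu\<zeta> iu\<xi> by simp
  have split: "(LINT x|?M. u x * R x) = (LINT x|?M. u x * laplacian \<zeta> x) + (LINT x|?M. u x * partial e \<xi> x)"
    unfolding uR using iu\<zeta> iu\<xi> by simp
  have weak: "(LINT x|?M. ?g x \<bullet> grad \<zeta> x) = (LINT x|?M. f x * \<zeta> x)"
    by (rule poisson_dirichlet_test[OF U(1) sol t\<zeta>])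
  have main: "(LINT x|?M. (?g x \<bullet> e) * \<xi> x) = - (LINT x|?M. u x * R x) - (LINT x|?M. f x * \<zeta> x)"
    using split eq\<xi> eq\<zeta> weak by linarith
  have "\<bar>LINT x|?M. f x * \<zeta> x\<bar> \<le> (LINT x|?M. f x / (norm (x - y))\<^sup>2)"
  proof -
    have pw: "norm (f x * \<zeta> x) \<le> f x / (norm (x - y))\<^sup>2" for x
    proof (cases "x = y")
      case True
      then show ?thesis by (simp add: \<zeta>_def D_def newton_deriv_def)
    next
      case False
      have "\<bar>\<zeta> x\<bar> \<le> 1 / (norm (x - y))\<^sup>2 * 1"
        unfolding \<zeta>_def abs_mult D_def using \<kappa>(2,3)[of x] newton_deriv_le[OF \<epsilon>(1) ne False]
        by (intro mult_mono) auto
      then have "f x * \<bar>\<zeta> x\<bar> \<le> f x * (1 / (norm (x - y))\<^sup>2)" using f(2) by (intro mult_left_mono) auto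
      then show ?thesis using f(2)[of x] by (simp add: abs_mult)
    qed
    have "\<zeta> \<in> borel_measurable ?M"
      by (intro continuous_measurable_lebesgue_on smooth_continuous test_function_smooth[OF t\<zeta>] U)
    then have fm: "(\<lambda>x. f x * \<zeta> x) \<in> borel_measurable ?M" using f(1) by measurable
    have "integrable ?M (\<lambda>x. f x * \<zeta> x)"
      by (rule Bochner_Integration.integrable_bound[OF N(1) fm], intro AE_I2 order_trans[OF pw])
         (simp add: divide_right_mono)
    then have "norm (LINT x|?M. f x * \<zeta> x) \<le> (LINT x|?M. f x / (norm (x - y))\<^sup>2)"
      by (rule Bochner_Integration.integral_norm_bound_integral[OF _ N(1) pw])
    then show ?thesis by simp
  qed
  then have fN: "\<bar>LINT x|?M. f x * \<zeta> x\<bar> \<le> N" using N(2) by linarith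
  have "\<bar>LINT x|?M. u x * R x\<bar> \<le> 102464 * B * S"
  proof -
    define k where "k = 102464 * B / d ^ 4"
    have k: "k \<ge> 0" using B d(1) by (simp add: k_def)
    have i2: "integrable ?M (\<lambda>x. k * (\<bar>u x\<bar> * indicator (cball p (d / 2)) x))"
      by (intro integrable_mult_right integrable_mult_indicator_cball integrable_abs ui)
    have "norm (u x * R x) \<le> k * (\<bar>u x\<bar> * indicator (cball p (d / 2)) x)" for x
    proof -
      have "\<bar>u x\<bar> * \<bar>R x\<bar> \<le> \<bar>u x\<bar> * (k * indicator (cball p (d / 2)) x)"
        unfolding k_def using Rbound by (intro mult_left_mono) auto
      then show ?thesis by (simp add: abs_mult mult_ac)
    qed
    from Bochner_Integration.integral_norm_bound_integral[OF iuR i2 this]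
    have "\<bar>LINT x|?M. u x * R x\<bar> \<le> k * (LINT x|?M. \<bar>u x\<bar> * indicator (cball p (d / 2)) x)"
      by simp
    also have "\<dots> \<le> k * (S * d ^ 4)" by (rule mult_left_mono[OF S k])
    also have "\<dots> = 102464 * B * S" using d(1) by (simp add: k_def)
    finally show ?thesis .
  qed
  with fN have "\<bar>LINT x|?M. (?g x \<bullet> e) * \<xi> x\<bar> \<le> 102464 * B * S + N"
    unfolding main by linarith
  then show ?thesis by (simp add: \<xi>_def \<rho>_def mult.commute)
qed

text \<open>Near each point the two local estimates bound all mollifications of the components of \<open>\<nabla>u\<close>, with a constant
  depending neither on the point nor on the domain. Removing the mollification bounds the components on a small
  ball, and countably many balls cover the domain.\<close>

theorem convex_domain_gradient_bound:
  "\<exists>C>0. \<forall>(U :: (real^3) set) f u N. open U \<and> bounded U \<and> convex U \<and>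
     poisson_dirichlet_solution U f u \<and> potential_bound U f N \<longrightarrow>
     (AE x in lebesgue_on U. norm (weak_gradient U u x) \<le> C * N)"
proof -
  obtain B where B: "B > 0" "\<And>(p::real^3) d. d > 0 \<Longrightarrow> \<exists>\<kappa>. cutoff B p d \<kappa>"
    using cutoff_exists[where 'a = "real^3"] by blast
  define c where "c = (102464 * B * (2 / mirror_gap) + 1) / mollifier_mass"
  have c: "c > 0"
    using B(1) mirror_gap_pos mollifier_mass_pos unfolding c_def by (intro divide_pos_pos add_nonneg_pos) auto
  show ?thesis
  proof (intro exI[of _ "3 * c"] conjI allI impI)
    show "3 * c > 0" using c by simp
    fix U :: "(real^3) set" and f u N
    assume "open U \<and> bounded U \<and> convex U \<and> poisson_dirichlet_solution U f u \<and> potential_bound U f N"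
    then have U: "open U" "bounded U" "convex U" and sol: "poisson_dirichlet_solution U f u"
      and pot: "potential_bound U f N"
      by auto
    let ?g = "weak_gradient U u"
    have u: "H10 U u" using sol by (simp add: poisson_dirichlet_solution_def)
    have wg: "has_weak_gradient U u ?g" by (rule H10_has_weak_gradient[OF u])
    have gi: "locally_integrable U (\<lambda>x. ?g x \<bullet> e)" for e
      using wg by (auto simp: has_weak_gradient_def intro: locally_integrable_inner)
    have comp: "AE x in lebesgue. x \<in> U \<longrightarrow> \<sigma> * (?g x \<bullet> e) - c * N \<le> 0"
      if e: "e \<in> Basis" and \<sigma>: "\<bar>\<sigma>\<bar> = 1" for e \<sigma>
    proof (rule AE_on_open_local)
      fix p assume "p \<in> U"
      then obtain d p' where d: "d > 0" "ball p d \<subseteq> U" "norm (p - p') = 2 * d"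
        "\<And>x. x \<in> U \<Longrightarrow> norm (x - p) \<le> norm (x - p')"
        using convex_mirror_point[OF U] by metis
      obtain \<kappa> where cut: "cutoff B p d \<kappa>" using B(2)[OF d(1)] by blast
      then have \<kappa>: "smooth \<kappa>" "\<And>x. norm (x - p) \<le> d / 4 \<Longrightarrow> \<kappa> x = 1" "\<And>x. norm (x - p) \<ge> d / 2 \<Longrightarrow> \<kappa> x = 0"
        by (simp_all add: cutoff_def)
      note S = mirror_L1_bound[OF U(1,2) sol pot d(1,3,4)]
      have bd: "\<bar>LINT x|lebesgue_on U. (?g x \<bullet> e) * (\<kappa> x * mollifier \<epsilon> y x)\<bar> \<le> mollifier_mass * (c * N)"
        if "norm (y - p) \<le> d / 8" "0 < \<epsilon>" "\<epsilon> \<le> d" for y \<epsilon>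
      proof -
        have "\<bar>LINT x|lebesgue_on U. (?g x \<bullet> e) * (\<kappa> x * mollifier \<epsilon> y x)\<bar>
            \<le> 102464 * B * (2 / mirror_gap * N) + N"
          by (rule mollified_gradient_bound[OF U(1,2) sol pot d(1,2) S cut less_imp_le[OF B(1)] e that])
        also have "\<dots> = mollifier_mass * (c * N)"
          using mollifier_mass_pos by (simp add: c_def field_simps)
        finally show ?thesis .
      qed
      have sub: "cball p (d / 2) \<subseteq> U" using d(1,2) by (auto simp: subset_iff)
      have out: "\<kappa> x = 0" if "x \<notin> cball p (d / 2)" for x
        using \<kappa>(3)[of x] that by (simp add: dist_norm norm_minus_commute)
      have test\<kappa>: "test_function U \<kappa>"
        by (rule test_functionI[OF \<kappa>(1) compact_cball sub out])
      define F where "F = (\<lambda>x. \<sigma> * ((?g x \<bullet> e) * \<kappa> x))"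
      have F0: "F x = 0" if "x \<notin> U" for x
      proof -
        have "x \<notin> cball p (d / 2)" using that sub by blast
        from out[OF this] show ?thesis by (simp add: F_def)
      qed
      have Fi: "integrable lebesgue F"
      proof -
        have "set_integrable lebesgue U F"
          unfolding F_def by (intro set_integrable_mult_right locally_integrable_mult_test[OF gi test\<kappa>])
        then show ?thesis using set_integral_eq_whole(2)[of U F lebesgue] F0 by simp
      qed
      have "AE x in lebesgue. x \<in> ball p (d / 8) \<longrightarrow> F x - c * N \<le> 0"
      proof (rule mollified_bound_imp_AE_bound[OF Fi open_ball d(1)])
        fix \<epsilon> y assume y: "y \<in> ball p (d / 8)" and \<epsilon>: "0 < \<epsilon>" "\<epsilon> \<le> d"
        have y: "norm (y - p) \<le> d / 8" using y by (simp add: dist_norm norm_minus_commute)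
        have "(LINT x|lebesgue. F x * mollifier \<epsilon> y x) = (LINT x:U|lebesgue. F x * mollifier \<epsilon> y x)"
          by (rule set_integral_eq_whole(1)[symmetric]) (simp add: F0)
        also have "\<dots> = (LINT x|lebesgue_on U. \<sigma> * ((?g x \<bullet> e) * (\<kappa> x * mollifier \<epsilon> y x)))"
          by (simp add: set_integral_lebesgue_on[OF U(1)] F_def mult.assoc)
        also have "\<dots> = \<sigma> * (LINT x|lebesgue_on U. (?g x \<bullet> e) * (\<kappa> x * mollifier \<epsilon> y x))"
          by (rule integral_mult_right_zero)
        also have "\<dots> \<le> \<bar>\<sigma>\<bar> * \<bar>LINT x|lebesgue_on U. (?g x \<bullet> e) * (\<kappa> x * mollifier \<epsilon> y x)\<bar>"
          unfolding abs_mult[symmetric] by (rule abs_ge_self)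
        also have "\<dots> \<le> mollifier_mass * (c * N)" using bd[OF y \<epsilon>] \<sigma> by simp
        finally show "(LINT x|lebesgue. F x * mollifier \<epsilon> y x) \<le> mollifier_mass * (c * N)" .
      qed
      then have "AE x in lebesgue. x \<in> ball p (d / 8) \<longrightarrow> \<sigma> * (?g x \<bullet> e) - c * N \<le> 0"
      proof (rule eventually_mono, intro impI)
        fix x assume *: "x \<in> ball p (d / 8) \<longrightarrow> F x - c * N \<le> 0" and x: "x \<in> ball p (d / 8)"
        have "\<kappa> x = 1" using \<kappa>(2)[of x] x d(1) by (simp add: dist_norm norm_minus_commute)
        then show "\<sigma> * (?g x \<bullet> e) - c * N \<le> 0" using * x by (simp add: F_def)
      qed
      then show "\<exists>r>0. AE x in lebesgue. x \<in> ball p r \<longrightarrow> \<sigma> * (?g x \<bullet> e) - c * N \<le> 0"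
        using d(1) by (intro exI[of _ "d / 8"]) simp
    qed
    have "AE x in lebesgue. \<forall>e\<in>Basis. x \<in> U \<longrightarrow> \<bar>?g x \<bullet> e\<bar> \<le> c * N"
    proof (subst AE_ball_countable)
      show "countable (Basis :: (real^3) set)" by (simp add: countable_finite)
      show "\<forall>e\<in>Basis. AE x in lebesgue. x \<in> U \<longrightarrow> \<bar>?g x \<bullet> e\<bar> \<le> c * N"
      proof
        fix e :: "real^3" assume e: "e \<in> Basis"
        have "\<bar>1 :: real\<bar> = 1" "\<bar>- 1 :: real\<bar> = 1" by auto
        from comp[OF e this(1)] comp[OF e this(2)]
        show "AE x in lebesgue. x \<in> U \<longrightarrow> \<bar>?g x \<bullet> e\<bar> \<le> c * N"
          by eventually_elim auto
      qed
    qed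
    then show "AE x in lebesgue_on U. norm (?g x) \<le> 3 * c * N"
      unfolding AE_lebesgue_on[OF U(1)]
    proof (rule eventually_mono, intro impI)
      fix x assume *: "\<forall>e\<in>Basis. x \<in> U \<longrightarrow> \<bar>?g x \<bullet> e\<bar> \<le> c * N" and "x \<in> U"
      have "norm (?g x) \<le> (\<Sum>e\<in>Basis. \<bar>?g x \<bullet> e\<bar>)" by (rule norm_le_l1)
      also have "\<dots> \<le> (\<Sum>e\<in>(Basis :: (real^3) set). c * N)" using * \<open>x \<in> U\<close> by (intro sum_mono) auto
      also have "\<dots> = 3 * c * N" by simp
      finally show "norm (?g x) \<le> 3 * c * N" .
    qed
  qed
qed

section \<open>Regularized delta functions and Green's functions\<close>

text \<open>The total mass comes from testing with the constant function 1, and the pointwise bound is the norm bound for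
  \<open>p = \<infinity>\<close>. That norm only sees the interior of the element; its frontier is a null set by convexity, and outside
  the element the function vanishes.\<close>

lemma regularized_delta_density:
  assumes mesh: "tetrahedral_mesh T" and h: "h > 0" and \<delta>: "regularized_delta C T h z \<delta>"
  shows "integrable lebesgue \<delta>" "(LINT x|lebesgue. \<delta> x) = 1" "AE x in lebesgue. \<delta> x \<le> \<bar>C\<bar> / h ^ 3"
proof -
  obtain \<tau> where \<tau>: "\<tau> \<in> T" "\<And>x. x \<notin> \<tau> \<Longrightarrow> \<delta> x = 0"
    "\<And>v. v \<in> P1_space T \<Longrightarrow> (LINT x:\<tau>|lebesgue. \<delta> x * v x) = v z"
    and Lp: "\<And>p::ennreal. 1 \<le> p \<Longrightarrow> Lp_norm p (interior \<tau>) \<delta> \<le> ennreal (C * h powr (- 3 * (1 - enn2real (1 / p))))"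
    using \<delta> unfolding regularized_delta_def by blast
  have nn: "0 \<le> \<delta> x" for x using \<delta> by (simp add: regularized_delta_def)
  have "(\<lambda>x. 1) \<in> P1_space T"
    unfolding P1_space_def by (auto intro!: exI[of _ "0 :: real^3"] exI[of _ "1 :: real"])
  from \<tau>(3)[OF this] have "(LINT x:\<tau>|lebesgue. \<delta> x) = 1" by simp
  then show one: "(LINT x|lebesgue. \<delta> x) = 1"
    using set_integral_eq_whole(1)[of \<tau> \<delta> lebesgue] \<tau>(2) by simp
  \<comment> \<open>The integral of a function that is not integrable has the value 0.\<close>
  then show "integrable lebesgue \<delta>"
    using not_integrable_integral_eq[of lebesgue \<delta>] by auto
  let ?M = "lebesgue_on (interior \<tau>)"
  have le: "Lp_norm \<infinity> (interior \<tau>) \<delta> \<le> ennreal (C * h powr (- 3))"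
    using Lp[of \<infinity>] by simp
  then have "\<delta> \<in> borel_measurable ?M"
    by (auto simp: Lp_norm_def top_unique split: if_splits)
  with le have sup: "esssup ?M (\<lambda>x. ennreal (norm (\<delta> x))) \<le> ennreal (C * h powr (- 3))"
    by (simp add: Lp_norm_def)
  have "AE x in ?M. ennreal (norm (\<delta> x)) \<le> esssup ?M (\<lambda>x. ennreal (norm (\<delta> x)))"
    by (rule esssup_AE)
  then have "AE x in ?M. \<delta> x \<le> \<bar>C\<bar> / h ^ 3"
  proof (rule eventually_mono)
    fix x assume "ennreal (norm (\<delta> x)) \<le> esssup ?M (\<lambda>x. ennreal (norm (\<delta> x)))"
    also note sup
    also have "ennreal (C * h powr (- 3)) \<le> ennreal (\<bar>C\<bar> / h ^ 3)"
      using h by (intro ennreal_leI) (simp add: powr_neg_numeral divide_right_mono)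
    finally show "\<delta> x \<le> \<bar>C\<bar> / h ^ 3" using nn[of x] h by (simp add: ennreal_le_iff)
  qed
  then have inner: "AE x in lebesgue. x \<in> interior \<tau> \<longrightarrow> \<delta> x \<le> \<bar>C\<bar> / h ^ 3"
    by (simp add: AE_lebesgue_on)
  have "convex \<tau>"
    using mesh \<tau>(1) by (auto simp: tetrahedral_mesh_def intro: convex_simplex)
  then have "frontier \<tau> \<in> null_sets lebesgue"
    using negligible_convex_frontier negligible_iff_null_sets by blast
  then have "AE x in lebesgue. x \<notin> frontier \<tau>" by (rule AE_not_in)
  with inner show "AE x in lebesgue. \<delta> x \<le> \<bar>C\<bar> / h ^ 3"
  proof eventually_elim
    fix x assume x: "x \<in> interior \<tau> \<longrightarrow> \<delta> x \<le> \<bar>C\<bar> / h ^ 3" "x \<notin> frontier \<tau>"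
    show "\<delta> x \<le> \<bar>C\<bar> / h ^ 3"
    proof (cases "x \<in> interior \<tau>")
      case False
      then have "x \<notin> \<tau>" using x(2) closure_subset by (auto simp: frontier_def)
      then show ?thesis using \<tau>(2) h by simp
    qed (use x in auto)
  qed
qed

theorem lemma3p4:
  fixes \<Omega> :: "(real^3) set" and \<T> :: "real \<Rightarrow> (real^3) set set" and C\<^sub>\<delta> :: real
  assumes "open \<Omega>" "\<Omega> \<noteq> {}" "bounded \<Omega>" "convex \<Omega>" "Ck_boundary 2 \<Omega>"
    and "\<And>h. 0 < h \<Longrightarrow> h < 1 \<Longrightarrow> tetrahedral_mesh (\<T> h)"
    and "\<And>h. 0 < h \<Longrightarrow> h < 1 \<Longrightarrow> mesh_domain (\<T> h) \<subseteq> \<Omega>"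
    and "shape_regular \<T>" "quasi_uniform \<T>"
  shows "\<exists>C>0. \<forall>h. 0 < h \<and> h < 1 \<longrightarrow>
           (\<forall>z\<in>mesh_domain (\<T> h). \<forall>\<delta> G.
              regularized_delta C\<^sub>\<delta> (\<T> h) h z \<delta> \<longrightarrow>
              poisson_dirichlet_solution \<Omega> \<delta> G \<longrightarrow>
              Lp_norm \<infinity> \<Omega> (weak_gradient \<Omega> G) \<le> ennreal (C * h powr (- 2)))"
proof -
  obtain c where c: "c > 0"
    and bound: "\<forall>(U :: (real^3) set) f u N. open U \<and> bounded U \<and> convex U \<and>
      poisson_dirichlet_solution U f u \<and> potential_bound U f N \<longrightarrow>
      (AE x in lebesgue_on U. norm (weak_gradient U u x) \<le> c * N)"
    using convex_domain_gradient_bound by (elim exE conjE)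
  define A where "A = 1 + 8 * unit_ball_vol 3 * \<bar>C\<^sub>\<delta>\<bar>"
  have A: "A > 0" unfolding A_def by (intro add_pos_nonneg mult_nonneg_nonneg) auto
  show ?thesis
  proof (intro exI[of _ "c * A"] conjI allI impI ballI)
    show "c * A > 0" using c A by simp
    fix h z \<delta> G
    assume h: "0 < h \<and> h < 1" and \<delta>: "regularized_delta C\<^sub>\<delta> (\<T> h) h z \<delta>"
      and G: "poisson_dirichlet_solution \<Omega> \<delta> G"
    have mesh: "tetrahedral_mesh (\<T> h)" and h0: "h > 0" using assms(6) h by auto
    note density = regularized_delta_density[OF mesh h0 \<delta>]
    have nn: "0 \<le> \<delta> x" for x using \<delta> by (simp add: regularized_delta_def)
    have one: "(LINT x|lebesgue. \<delta> x) \<le> 1" using density(2) by simp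
    note pot = inverse_square_potential_bound[OF density(1) nn one density(3) abs_ge_zero h0]
    have restrict: "integrable (lebesgue_on \<Omega>) f \<and> (LINT x|lebesgue_on \<Omega>. f x) \<le> (LINT x|lebesgue. f x)"
      if f: "integrable lebesgue f" "\<And>x. 0 \<le> f x" for f :: "real^3 \<Rightarrow> real"
    proof -
      have i: "integrable lebesgue (\<lambda>x. indicator \<Omega> x *\<^sub>R f x)"
        using assms(1) by (intro integrable_mult_indicator f) auto
      then have "integrable (lebesgue_on \<Omega>) f"
        using set_integral_lebesgue_on(2)[OF assms(1), of f] by (simp add: set_integrable_def)
      moreover have "(LINT x|lebesgue_on \<Omega>. f x) = (LINT x|lebesgue. indicator \<Omega> x *\<^sub>R f x)"
        using set_integral_lebesgue_on(1)[OF assms(1), of f] by (simp add: set_lebesgue_integral_def)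
      moreover have "\<dots> \<le> (LINT x|lebesgue. f x)"
        using f by (intro integral_mono i) (auto simp: indicator_def)
      ultimately show ?thesis by simp
    qed
    have "potential_bound \<Omega> \<delta> (A / h\<^sup>2)"
      unfolding potential_bound_def
    proof (intro conjI allI)
      show "integrable (lebesgue_on \<Omega>) \<delta>" using restrict[OF density(1) nn] by blast
      fix p
      have "0 \<le> \<delta> x / (norm (x - p))\<^sup>2" for x using nn[of x] by simp
      note pr = restrict[OF pot(1) this]
      show "integrable (lebesgue_on \<Omega>) (\<lambda>x. \<delta> x / (norm (x - p))\<^sup>2)" using pr by blast
      show "(LINT x|lebesgue_on \<Omega>. \<delta> x / (norm (x - p))\<^sup>2) \<le> A / h\<^sup>2"
        using pr pot(2)[of p] by (auto simp: A_def intro: order_trans)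
    qed (rule nn)
    then have "AE x in lebesgue_on \<Omega>. norm (weak_gradient \<Omega> G x) \<le> c * (A / h\<^sup>2)"
      using bound assms(1,3,4) G by blast
    moreover have "c * (A / h\<^sup>2) = c * A * h powr (- 2)"
      using h0 by (simp add: powr_neg_numeral)
    ultimately have le: "AE x in lebesgue_on \<Omega>. ennreal (norm (weak_gradient \<Omega> G x)) \<le> ennreal (c * A * h powr (- 2))"
      by (auto elim!: eventually_mono intro: ennreal_leI)
    have "H10 \<Omega> G" using G by (simp add: poisson_dirichlet_solution_def)
    then have "has_weak_gradient \<Omega> G (weak_gradient \<Omega> G)" by (rule H10_has_weak_gradient)
    then have "weak_gradient \<Omega> G \<in> borel_measurable (lebesgue_on \<Omega>)"
      by (intro locally_integrable_measurable[OF assms(1)]) (simp add: has_weak_gradient_def)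
    then show "Lp_norm \<infinity> \<Omega> (weak_gradient \<Omega> G) \<le> ennreal (c * A * h powr (- 2))"
      using esssup_I[OF _ le] by (simp add: Lp_norm_def)
  qed
qed

end
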